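(* Let $\alpha$ be a quadratic irrational with continued fraction expansion $\alpha=[a_0;a_1,a_2,\dots]$ and convergents $p_k/q_k=[a_0;a_1,\dots,a_k]$. There exist constants $K_c(\alpha)>0$ (for each real $c>0$) and $K_\infty(\alpha)>0$ such that for any real $c>0$ and any integer $k\ge 1$, \[ \log \left( \sum_{N=0}^{q_k-1} P_N (p_k/q_k)^c \right)^{1/c} = K_c (\alpha ) k +O \left( \max \{ 1, 1/c \} \right) \] and \[ \log \max_{0 \le N < q_k} P_N (p_k/q_k) = K_{\infty} (\alpha ) k +O(1), \] where the implied constants depend only on $\alpha$.
   Context: For real $\alpha$ and integer $N\ge 0$, the Sudler product is $P_N(\alpha)=\prod_{n=1}^N |2\sin(\pi n\alpha)|$ (the empty product $P_0(\alpha)$ equals $1$). A quadratic irrational is an irrational real root of a quadratic polynomial with integer coefficients (equivalently, its continued fraction is eventually periodic). *)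

theory Defs
  imports Complex_Main
begin

definition sudler :: "nat \<Rightarrow> real \<Rightarrow> real" where
  "sudler N \<alpha> = (\<Prod>n = 1..N. \<bar>2 * sin (pi * real n * \<alpha>)\<bar>)"

definition quadratic_irrational :: "real \<Rightarrow> bool" where
  "quadratic_irrational \<alpha> \<longleftrightarrow> \<alpha> \<notin> \<rat> \<and>
     (\<exists>a b c :: int. a \<noteq> 0 \<and> of_int a * \<alpha>\<^sup>2 + of_int b * \<alpha> + of_int c = 0)"

text \<open>
  The complete quotients and partial quotients are those of the Gauss algorithm. They are
  meaningful at every index only for irrational \<open>\<alpha>\<close>: for rational \<open>\<alpha>\<close> the fractional part
  eventually vanishes and division by zero yields junk values.
\<close>

fun cf_complete_quotient :: "real \<Rightarrow> nat \<Rightarrow> real" where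
  "cf_complete_quotient \<alpha> 0 = \<alpha>"
| "cf_complete_quotient \<alpha> (Suc n) = 1 / frac (cf_complete_quotient \<alpha> n)"

definition cf_partial_quotient :: "real \<Rightarrow> nat \<Rightarrow> int" where
  "cf_partial_quotient \<alpha> n = \<lfloor>cf_complete_quotient \<alpha> n\<rfloor>"

fun cf_value :: "int list \<Rightarrow> rat" where
  "cf_value [] = 0"
| "cf_value [a] = of_int a"
| "cf_value (a # b # as) = of_int a + 1 / cf_value (b # as)"

definition cf_convergent :: "real \<Rightarrow> nat \<Rightarrow> rat" where
  "cf_convergent \<alpha> k = cf_value (map (cf_partial_quotient \<alpha>) [0..<Suc k])"

text \<open>
  \<open>quotient_of\<close> returns the fraction in lowest terms with positive denominator.
\<close>

definition cf_num :: "real \<Rightarrow> nat \<Rightarrow> int" where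
  "cf_num \<alpha> k = fst (quotient_of (cf_convergent \<alpha> k))"

definition cf_denom :: "real \<Rightarrow> nat \<Rightarrow> nat" where
  "cf_denom \<alpha> k = nat (snd (quotient_of (cf_convergent \<alpha> k)))"

end

theory Submission
  imports Defs "HOL-Analysis.Analysis" "HOL-Real_Asymp.Real_Asymp"
begin

text \<open>
  For \<open>0 < \<alpha> \<le> 1\<close> the double sine function \<open>S\<close> with periods \<open>1\<close> and \<open>\<alpha>\<close> satisfies
  \<open>S(x + \<alpha>) = S(x) / (2 sin \<pi>x)\<close> and \<open>S(x + 1) = S(x) / (2 sin (\<pi>x/\<alpha>))\<close>. Walking from \<open>\<alpha>\<close> to
  \<open>(N + 1) \<alpha> - M\<close> by such steps gives the exact reciprocity
  \<open>P\<^sub>N(\<alpha>) = P\<^sub>M(1/\<alpha>) S(\<alpha>) / S((N + 1) \<alpha> - M)\<close>. Taking for \<open>M\<close> the integer part of \<open>(N + 1/2) \<alpha>\<close> keeps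
  the argument of \<open>S\<close> away from its zero and its pole, and iterating along the Gauss map writes
  \<open>P\<^sub>N(p/q)\<close> as a product of values of a fixed nonsingular function along a chain of indices. Inverse
  branches of the Gauss map contract, so two chains with the same digits have comparable products;
  hence \<open>P\<^sub>N\<close> for a concatenated word \<open>uv\<close> of bounded partial quotients is, up to a bounded factor,
  the product of a Sudler product for \<open>u\<close> and one for \<open>v\<close>. The free energies are therefore additive
  up to \<open>O(max 1 (1/c))\<close> under concatenation, and a periodic continued fraction (Lagrange) makes
  them linear up to the same error. Positivity of the slope follows from \<open>P\<^sub>q\<^sub>-\<^sub>1(p/q) = q\<close>.
\<close>

section \<open>Stirling asymptotics\<close>

text \<open>A chain is an Ostrowski-like expansion: if
  \<open>N j = a * N (j+1) + N (j+2) + c\<close>, the centred argument of the double sine obeys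
  \<open>r j = - \<alpha> j * (r (j+1) + a/2 - c)\<close>. The digits \<open>c\<close> thus govern a
  chain up to a geometrically fading influence of its far end, which is why words can be cut and
  glued. Two obstacles shape the details. Cutting and gluing put foreign data at the seam: the new
  chain need not be rounded, and its arguments may approach the zero or the pole. A margin at the
  last letter of the left word is carried back, and becomes uniform by comparison with the rounded
  chain once the contraction has taken effect. Moreover, the double sine enters only as a limit of
  partial products; truncating at a level that grows with the distance from the seam takes the place
  of a Lipschitz bound for the limit. In the variable \<open>y = x - (1 + \<alpha>)/2\<close> its
  logarithm is odd, with the zero and the pole at \<open>y = - (1 + \<alpha>)/2\<close> and
  \<open>y = (1 + \<alpha>)/2\<close>. The \<open>1/c\<close> in the error comes from counting:
  cutting is made injective on indices by recording one extra bit.\<close>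

lemma Digamma_ln_bounds:
  fixes v :: real
  assumes v: "v > 0"
  shows "0 \<le> Digamma (v + 1/2) - ln v" "Digamma (v + 1/2) - ln v \<le> 1 / v\<^sup>2"
proof -
  \<comment> \<open>\<open>k n\<close> is the error of the midpoint rule for the integral of
    \<open>1/x\<close> over the unit interval starting at \<open>v + n\<close>. Convexity gives its
    sign, and the trapezoidal rule bounds it from above. The half-shift in
    \<open>Digamma (v + 1/2)\<close> makes the total error quadratic in \<open>1/v\<close>.\<close>
  define k where "k n = ln (v + real n + 1) - ln (v + real n) - 1 / (v + real n + 1/2)" for n
  have k_ge: "0 \<le> k n" for n
    using ln_inverse_approx_ge[of "v + real n" "v + real n + 1"] v
    by (simp add: k_def field_simps)
  have k_le: "k n \<le> 1 / (v + real n)\<^sup>2 - 1 / (v + real (Suc n))\<^sup>2" for n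
  proof -
    define w where "w = v + real n"
    have w: "w > 0" using v by (simp add: w_def)
    have "ln (w + 1) - ln w \<le> (1 / w + 1 / (w + 1)) / 2"
      using ln_inverse_approx_le[of w 1] w by (simp add: inverse_eq_divide)
    hence "k n \<le> (1 / w + 1 / (w + 1)) / 2 - 1 / (w + 1/2)"
      by (simp add: k_def w_def)
    also have "\<dots> = 1 / (2 * w * (w + 1) * (2 * w + 1))"
    proof -
      have [simp]: "w \<noteq> 0" "w + 1 \<noteq> 0" "2 * w + 1 \<noteq> 0" "w + 1/2 \<noteq> 0" using w by auto
      have "1 / (w + 1/2) = 2 / (2 * w + 1)" by (simp add: field_simps)
      moreover have "(1 / w + 1 / (w + 1)) / 2 = (2 * w + 1) / (2 * w * (w + 1))"
        by (simp add: divide_simps)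
      moreover have "(2 * w + 1) / (2 * w * (w + 1)) - 2 / (2 * w + 1) = 1 / (2 * w * (w + 1) * (2 * w + 1))"
        by (simp add: divide_simps) (simp add: algebra_simps)
      ultimately show ?thesis by (simp only:)
    qed
    \<comment> \<open>A deliberately coarse bound: its right-hand side is the telescoping difference
      \<open>1/w^2 - 1/(w+1)^2\<close>.\<close>
    also have "\<dots> \<le> (2 * w + 1) / (w * (w + 1))\<^sup>2"
    proof -
      define p where "p = w * (w + 1)"
      define t where "t = 2 * w + 1"
      have pt: "p > 0" "t > 0" using w by (auto simp: p_def t_def)
      have "p \<le> 2 * (t * t)" using w by (simp add: p_def t_def algebra_simps)
      hence "p / (2 * p\<^sup>2 * t) \<le> 2 * (t * t) / (2 * p\<^sup>2 * t)" using pt by (intro divide_right_mono) auto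
      also have "p / (2 * p\<^sup>2 * t) = 1 / (2 * p * t)" using pt by (simp add: power2_eq_square)
      also have "2 * (t * t) / (2 * p\<^sup>2 * t) = t / p\<^sup>2" using pt by simp
      finally show ?thesis by (simp add: p_def t_def mult.assoc)
    qed
    also have "\<dots> = 1 / w\<^sup>2 - 1 / (w + 1)\<^sup>2"
      using w by (simp add: divide_simps power2_eq_square) (simp add: algebra_simps)
    finally show ?thesis by (simp add: w_def add_ac)
  qed
  have sum_k: "(\<Sum>n<m. k n) = ln (v + real m) - ln v - (\<Sum>n<m. inverse (v + 1/2 + real n))" for m
    by (induction m) (simp_all add: k_def inverse_eq_divide add_ac)
  have "(\<lambda>m. (ln (real m) - (\<Sum>n<m. inverse (v + 1/2 + real n))) + (ln (v + real m) - ln (real m)) - ln v)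
          \<longlonglongrightarrow> Digamma (v + 1/2) + 0 - ln v"
  proof (intro tendsto_intros)
    show "(\<lambda>m. ln (real m) - (\<Sum>n<m. inverse (v + 1/2 + real n))) \<longlonglongrightarrow> Digamma (v + 1/2)"
      using Digamma_LIMSEQ[of "v + 1/2"] v by simp
    show "(\<lambda>m. ln (v + real m) - ln (real m)) \<longlonglongrightarrow> 0"
      using v by real_asymp
  qed
  hence lim: "(\<lambda>m. \<Sum>n<m. k n) \<longlonglongrightarrow> Digamma (v + 1/2) - ln v"
    by (simp add: sum_k algebra_simps)
  show "0 \<le> Digamma (v + 1/2) - ln v"
    by (rule LIMSEQ_le_const[OF lim]) (auto intro!: sum_nonneg k_ge)
  have "(\<Sum>n<m. k n) \<le> 1 / v\<^sup>2" for m
  proof -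
    have "(\<Sum>n<m. k n) \<le> (\<Sum>n<m. 1 / (v + real n)\<^sup>2 - 1 / (v + real (Suc n))\<^sup>2)"
      by (intro sum_mono k_le)
    also have "\<dots> = 1 / v\<^sup>2 - 1 / (v + real m)\<^sup>2"
      using sum_lessThan_telescope'[of "\<lambda>n. 1 / (v + real n)\<^sup>2" m] by simp
    finally show ?thesis using zero_le_power2[of "v + real m"]
      by (smt (verit) divide_nonneg_nonneg)
  qed
  thus "Digamma (v + 1/2) - ln v \<le> 1 / v\<^sup>2"
    by (intro LIMSEQ_le_const2[OF lim]) auto
qed

text \<open>The shift by \<open>1/2\<close> absorbs the usual term \<open>- ln z / 2\<close> of
  Stirling's formula, so that the remainder is monotone and tends to a constant.\<close>

definition stirling_remainder :: "real \<Rightarrow> real" where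
  "stirling_remainder z = ln_Gamma (z + 1/2) - (z * ln z - z)"

text \<open>The derivative \<open>Digamma (x + 1/2) - ln x\<close> lies between \<open>0\<close> and
  \<open>1/x^2\<close>, so the remainder increases while its sum with \<open>1/x\<close>
  decreases.\<close>

lemma stirling_remainder_diff:
  assumes "0 < z" "z \<le> w"
  shows "0 \<le> stirling_remainder w - stirling_remainder z" "stirling_remainder w - stirling_remainder z \<le> 1 / z - 1 / w"
proof -
  have der: "(stirling_remainder has_real_derivative Digamma (x + 1/2) - ln x) (at x)" if "x > 0" for x
    unfolding stirling_remainder_def using that by (auto intro!: derivative_eq_intros)
  have "stirling_remainder z \<le> stirling_remainder w"
  proof (rule DERIV_nonneg_imp_nondecreasing[OF assms(2)])
    fix x assume "z \<le> x" "x \<le> w"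
    hence "x > 0" using assms by simp
    thus "\<exists>y. (stirling_remainder has_real_derivative y) (at x) \<and> 0 \<le> y"
      using der Digamma_ln_bounds(1) by blast
  qed
  thus "0 \<le> stirling_remainder w - stirling_remainder z" by simp
  have "stirling_remainder w + 1 / w \<le> stirling_remainder z + 1 / z"
  proof (rule DERIV_nonpos_imp_nonincreasing[of z w "\<lambda>x. stirling_remainder x + 1 / x"])
    fix x assume x: "z \<le> x" "x \<le> w"
    hence x0: "x > 0" using assms by simp
    have "((\<lambda>x. stirling_remainder x + 1 / x) has_real_derivative (Digamma (x + 1/2) - ln x - 1 / x\<^sup>2)) (at x)"
      using x0 by (auto intro!: derivative_eq_intros der simp: power2_eq_square)
    moreover have "Digamma (x + 1/2) - ln x - 1 / x\<^sup>2 \<le> 0"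
      using Digamma_ln_bounds(2)[OF x0] by simp
    ultimately show "\<exists>y. ((\<lambda>x. stirling_remainder x + 1 / x) has_real_derivative y) (at x) \<and> y \<le> 0" by blast
  qed (use assms in auto)
  thus "stirling_remainder w - stirling_remainder z \<le> 1 / z - 1 / w" by simp
qed

lemma ln_Gamma_duplication:
  fixes z :: real
  assumes "z > 0"
  shows "ln_Gamma z + ln_Gamma (z + 1/2) = ln 2 * (1 - 2 * z) + ln pi / 2 + ln_Gamma (2 * z)"
proof -
  have ni: "complex_of_real x \<notin> \<int>\<^sub>\<le>\<^sub>0" if "x > 0" for x
    using that by (auto simp: of_real_in_nonpos_Ints_iff)
  have "Gamma (complex_of_real z) * Gamma (complex_of_real z + 1/2) =
      exp ((1 - 2 * complex_of_real z) * of_real (ln 2)) * of_real (sqrt pi) * Gamma (2 * complex_of_real z)"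
    using assms ni[of z] ni[of "z + 1/2"] by (intro Gamma_legendre_duplication) auto
  also have "\<dots> = of_real (exp ((1 - 2 * z) * ln 2) * sqrt pi * Gamma (2 * z))"
    by (simp flip: Gamma_complex_of_real exp_of_real)
  finally have "of_real (Gamma z * Gamma (z + 1/2)) = complex_of_real (exp ((1 - 2 * z) * ln 2) * sqrt pi * Gamma (2 * z))"
    by (simp flip: Gamma_complex_of_real)
  hence "Gamma z * Gamma (z + 1/2) = exp ((1 - 2 * z) * ln 2) * sqrt pi * Gamma (2 * z)"
    unfolding of_real_eq_iff .
  hence "exp (ln_Gamma z + ln_Gamma (z + 1/2)) = exp ((1 - 2 * z) * ln 2 + ln pi / 2 + ln_Gamma (2 * z))"
    using assms by (simp add: Gamma_real_pos_exp exp_add powr_half_sqrt[symmetric] powr_def)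
  thus ?thesis by (simp add: algebra_simps)
qed

text \<open>Monotonicity and boundedness along the integers give a limit \<open>c\<close>, and the
  two-sided difference bound extends it to real arguments. Legendre duplication then identifies it,
  since \<open>c\<close> enters that identity as \<open>c + c - c\<close>.\<close>

lemma stirling_remainder_tendsto: "(stirling_remainder \<longlongrightarrow> ln (2 * pi) / 2) at_top"
proof -
  define c where "c = (SUP n. stirling_remainder (real (Suc n)))"
  have bdd: "bdd_above (range (\<lambda>n. stirling_remainder (real (Suc n))))"
  proof (rule bdd_aboveI)
    fix y assume "y \<in> range (\<lambda>n. stirling_remainder (real (Suc n)))"
    then obtain n where "y = stirling_remainder (real (Suc n))" by blast
    thus "y \<le> stirling_remainder 1 + 1" using stirling_remainder_diff(2)[of 1 "real (Suc n)"]
      by (smt (verit) divide_nonneg_nonneg div_by_1 of_nat_0_le_iff of_nat_Suc)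
  qed
  have inc: "incseq (\<lambda>n. stirling_remainder (real (Suc n)))"
    using stirling_remainder_diff(1) by (intro incseq_SucI) fastforce
  have lim: "(\<lambda>n. stirling_remainder (real (Suc n))) \<longlonglongrightarrow> c"
    unfolding c_def by (rule LIMSEQ_incseq_SUP[OF bdd inc])
  have near: "\<bar>stirling_remainder z - c\<bar> \<le> 1 / z" if "z > 0" for z
  proof -
    obtain N where N: "z \<le> real N" using real_arch_simple by blast
    have ev: "\<forall>n\<ge>N. 0 \<le> stirling_remainder (real (Suc n)) - stirling_remainder z \<and> stirling_remainder (real (Suc n)) - stirling_remainder z \<le> 1 / z"
    proof (intro allI impI)
      fix n assume "n \<ge> N"
      hence "z \<le> real (Suc n)" using N by linarith
      thus "0 \<le> stirling_remainder (real (Suc n)) - stirling_remainder z \<and> stirling_remainder (real (Suc n)) - stirling_remainder z \<le> 1 / z"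
        using stirling_remainder_diff[of z "real (Suc n)"] that
        by (smt (verit, best) of_nat_0_le_iff divide_nonneg_nonneg)
    qed
    have l2: "(\<lambda>n. stirling_remainder (real (Suc n)) - stirling_remainder z) \<longlonglongrightarrow> c - stirling_remainder z"
      by (intro tendsto_intros lim)
    have "0 \<le> c - stirling_remainder z" by (rule LIMSEQ_le_const[OF l2]) (use ev in blast)
    moreover have "c - stirling_remainder z \<le> 1 / z" by (rule LIMSEQ_le_const2[OF l2]) (use ev in blast)
    ultimately show ?thesis by simp
  qed
  have to_c: "(stirling_remainder \<longlongrightarrow> c) at_top"
  proof (rule tendsto_0_le[where K = 1, THEN LIM_zero_cancel])
    show "((\<lambda>z::real. 1 / z) \<longlongrightarrow> 0) at_top" by real_asymp
    show "\<forall>\<^sub>F z in at_top. norm (stirling_remainder z - c) \<le> norm (1 / z) * 1"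
      using eventually_gt_at_top[of 0] by eventually_elim (use near in auto)
  qed
  define \<phi> where "\<phi> z = z * ln z - z" for z :: real
  \<comment> \<open>Duplication is applied at \<open>z + 1/2\<close>, so that the Gamma arguments
    \<open>z + 1/2\<close>, \<open>z + 1\<close> and \<open>2 * z + 1\<close> are the half-shifts of
    \<open>z\<close>, \<open>z + 1/2\<close> and \<open>2 * z + 1/2\<close>.\<close>
  have eq: "stirling_remainder z + stirling_remainder (z + 1/2) - stirling_remainder (2 * z + 1/2) =
      ln pi / 2 + (\<phi> (2 * z + 1/2) - 2 * z * ln 2 - \<phi> z - \<phi> (z + 1/2))" if "z > 0" for z
    using ln_Gamma_duplication[of "z + 1/2"] that
    by (simp add: stirling_remainder_def \<phi>_def algebra_simps)
  have "((\<lambda>z. stirling_remainder z + stirling_remainder (z + 1/2) - stirling_remainder (2 * z + 1/2)) \<longlongrightarrow> c + c - c) at_top"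
    by (intro tendsto_intros to_c filterlim_compose[OF to_c]) real_asymp+
  moreover have "((\<lambda>z. stirling_remainder z + stirling_remainder (z + 1/2) - stirling_remainder (2 * z + 1/2)) \<longlongrightarrow> ln pi / 2 + ln 2 / 2) at_top"
  proof (rule Lim_transform_eventually)
    have "((\<lambda>z. \<phi> (2 * z + 1/2) - 2 * z * ln 2 - \<phi> z - \<phi> (z + 1/2)) \<longlongrightarrow> ln 2 / 2) at_top"
      unfolding \<phi>_def by real_asymp
    thus "((\<lambda>z. ln pi / 2 + (\<phi> (2 * z + 1/2) - 2 * z * ln 2 - \<phi> z - \<phi> (z + 1/2))) \<longlongrightarrow> ln pi / 2 + ln 2 / 2) at_top"
      by (intro tendsto_intros)
    show "\<forall>\<^sub>F z in at_top. ln pi / 2 + (\<phi> (2 * z + 1/2) - 2 * z * ln 2 - \<phi> z - \<phi> (z + 1/2)) =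
        stirling_remainder z + stirling_remainder (z + 1/2) - stirling_remainder (2 * z + 1/2)"
      using eventually_gt_at_top[of 0] by eventually_elim (simp add: eq)
  qed
  ultimately have "c = ln pi / 2 + ln 2 / 2"
    by (intro tendsto_unique[of at_top]) auto
  thus ?thesis using to_c by (simp add: ln_mult add_divide_distrib add_ac)
qed

text \<open>Relative to \<open>z + 1/2\<close> the two arguments are displaced by
  \<open>u - 1/2\<close> and by its negative. The first-order terms in \<open>ln z\<close> cancel,
  and the limit does not depend on \<open>u\<close>.\<close>

lemma ln_Gamma_pair_tendsto:
  fixes u :: real
  shows "((\<lambda>z. ln_Gamma (z + u) + ln_Gamma (z + 1 - u) - 2 * (z * ln z - z)) \<longlongrightarrow> ln (2 * pi)) at_top"
proof (rule Lim_transform_eventually)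
  define \<phi> where "\<phi> z = z * ln z - z" for z :: real
  have "((\<lambda>z. stirling_remainder (z + (u - 1/2)) + stirling_remainder (z + (1/2 - u)) + (\<phi> (z + (u - 1/2)) + \<phi> (z + (1/2 - u)) - 2 * \<phi> z))
    \<longlongrightarrow> ln (2 * pi) / 2 + ln (2 * pi) / 2 + 0) at_top"
  proof (intro tendsto_intros filterlim_compose[OF stirling_remainder_tendsto])
    show "((\<lambda>z. \<phi> (z + (u - 1/2)) + \<phi> (z + (1/2 - u)) - 2 * \<phi> z) \<longlongrightarrow> 0) at_top"
      unfolding \<phi>_def by real_asymp
  qed real_asymp+
  thus "((\<lambda>z. stirling_remainder (z + (u - 1/2)) + stirling_remainder (z + (1/2 - u)) + (\<phi> (z + (u - 1/2)) + \<phi> (z + (1/2 - u)) - 2 * \<phi> z))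
    \<longlongrightarrow> ln (2 * pi)) at_top" by simp
  show "\<forall>\<^sub>F z in at_top. stirling_remainder (z + (u - 1/2)) + stirling_remainder (z + (1/2 - u)) + (\<phi> (z + (u - 1/2)) + \<phi> (z + (1/2 - u)) - 2 * \<phi> z)
     = ln_Gamma (z + u) + ln_Gamma (z + 1 - u) - 2 * (z * ln z - z)"
    by (rule always_eventually) (simp add: stirling_remainder_def \<phi>_def algebra_simps)
qed

section \<open>The double sine function\<close>

lemma ln_Gamma_reflection:
  fixes x :: real
  assumes "0 < x" "x < 1"
  shows "ln_Gamma x + ln_Gamma (1 - x) = ln pi - ln (sin (pi * x))"
proof -
  have "Gamma (complex_of_real x) * Gamma (1 - complex_of_real x) = of_real pi / sin (of_real pi * complex_of_real x)"
    by (rule Gamma_reflection_complex)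
  hence "complex_of_real (Gamma x * Gamma (1 - x)) = of_real (pi / sin (pi * x))"
    by (simp flip: Gamma_complex_of_real sin_of_real)
  hence "Gamma x * Gamma (1 - x) = pi / sin (pi * x)" unfolding of_real_eq_iff .
  moreover have "sin (pi * x) > 0" using assms by (intro sin_gt_zero) auto
  moreover have "ln (Gamma x * Gamma (1 - x)) = ln_Gamma x + ln_Gamma (1 - x)"
    using assms Gamma_real_pos[of x] Gamma_real_pos[of "1 - x"] by (subst ln_mult_pos) (auto simp: ln_Gamma_real_pos)
  ultimately show ?thesis by (simp add: ln_div)
qed

text \<open>With \<open>x = y + (1 + \<alpha>)/2\<close> the summands are \<open>ln_Gamma ((n+1) *
  \<alpha> + 1 - x) - ln_Gamma (n * \<alpha> + x)\<close>: this is the expansion of the double sine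
  as a product of Gamma quotients. The closing term is the counterterm that makes it converge; it
  equals \<open>(2 * y / \<alpha>) * \<phi> (L * \<alpha>)\<close> for
  \<open>\<phi> z = z * ln z - z\<close>.\<close>

definition ln_double_sine_partial :: "nat \<Rightarrow> real \<Rightarrow> real \<Rightarrow> real" where
  "ln_double_sine_partial L y \<alpha> = (\<Sum>n<L. ln_Gamma ((real n + 1/2) * \<alpha> + 1/2 - y) - ln_Gamma ((real n + 1/2) * \<alpha> + 1/2 + y))
     + 2 * y * (real L * ln (real L * \<alpha>) - real L)"

definition ln_double_sine :: "real \<Rightarrow> real \<Rightarrow> real" where
  "ln_double_sine y \<alpha> = lim (\<lambda>L. ln_double_sine_partial L y \<alpha>)"

text \<open>As a function of \<open>y\<close> the expression is odd and has the derivative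
  \<open>- ln (1 - y^2 / w^2)\<close>, which is quadratically small; integrating gives the cubic
  bound.\<close>

lemma entropy_central_difference:
  fixes w y :: real
  assumes w: "w > 0" and y: "\<bar>y\<bar> \<le> w / 2"
  shows "\<bar>((w - y) * ln (w - y) - (w - y)) - ((w + y) * ln (w + y) - (w + y)) + 2 * y * ln w\<bar>
           \<le> 2 * \<bar>y\<bar> ^ 3 / w\<^sup>2"
proof -
  define f where "f y = ((w - y) * ln (w - y) - (w - y)) - ((w + y) * ln (w + y) - (w + y)) + 2 * y * ln w" for y
  have pos: "\<bar>f y\<bar> \<le> 2 * y ^ 3 / w\<^sup>2" if y: "0 < y" "y \<le> w / 2" for y
  proof -
    have "\<exists>z>0. z < y \<and> f y - f 0 = (y - 0) * (2 * ln w - ln (w - z) - ln (w + z))"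
    proof (rule MVT2)
      fix x assume x: "0 \<le> x" "x \<le> y"
      show "(f has_real_derivative 2 * ln w - ln (w - x) - ln (w + x)) (at x)"
        unfolding f_def using x y w by (auto intro!: derivative_eq_intros)
    qed (use y in auto)
    then obtain z where z: "0 < z" "z < y" "f y = y * (2 * ln w - ln (w - z) - ln (w + z))"
      by (auto simp: f_def)
    have lt: "z < w" using z y w by simp
    have w0: "w \<noteq> 0" using w by simp
    have fac: "(w - z) * (w + z) = w\<^sup>2 - z\<^sup>2" by (simp add: power2_eq_square algebra_simps)
    have zw: "z\<^sup>2 < w\<^sup>2" using lt z(1) by (intro power_strict_mono) auto
    have z2: "z\<^sup>2 \<le> w\<^sup>2 / 4" using z(1,2) y w power_mono[of z "w/2" 2] by (simp add: power_divide)
    have eq: "2 * ln w - ln (w - z) - ln (w + z) = ln (w\<^sup>2 / (w\<^sup>2 - z\<^sup>2))"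
    proof -
      have "ln (w\<^sup>2 / (w\<^sup>2 - z\<^sup>2)) = ln (w\<^sup>2) - ln ((w - z) * (w + z))"
        unfolding fac using w zw by (subst ln_div) auto
      also have "\<dots> = 2 * ln w - (ln (w - z) + ln (w + z))"
        using w lt z(1) by (subst ln_mult) (auto simp: ln_realpow)
      finally show ?thesis by simp
    qed
    have "ln (w\<^sup>2 / (w\<^sup>2 - z\<^sup>2)) \<le> w\<^sup>2 / (w\<^sup>2 - z\<^sup>2) - 1"
      using w zw by (intro ln_le_minus_one) auto
    also have "\<dots> = z\<^sup>2 / (w\<^sup>2 - z\<^sup>2)" using zw by (simp add: field_simps)
    also have "\<dots> \<le> z\<^sup>2 / (w\<^sup>2 / 2)"
      using z2 w zw by (intro divide_left_mono) (auto intro: mult_pos_pos)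
    also have "\<dots> \<le> 2 * y\<^sup>2 / w\<^sup>2"
      using z w by (auto intro!: divide_right_mono power_mono)
    finally have up: "2 * ln w - ln (w - z) - ln (w + z) \<le> 2 * y\<^sup>2 / w\<^sup>2" unfolding eq .
    have lo: "0 \<le> 2 * ln w - ln (w - z) - ln (w + z)"
      unfolding eq using w zw by (intro ln_ge_zero) (auto simp: field_simps)
    have "f y \<le> y * (2 * y\<^sup>2 / w\<^sup>2)" unfolding z(3) using up y by (intro mult_left_mono) auto
    moreover have "f y \<ge> 0" unfolding z(3) using lo y by simp
    ultimately show ?thesis by (simp add: power3_eq_cube power2_eq_square mult_ac)
  qed
  have odd: "f (- y) = - f y" for y by (simp add: f_def)
  consider "y = 0" | "y > 0" | "y < 0" by linarith
  hence "\<bar>f y\<bar> \<le> 2 * \<bar>y\<bar> ^ 3 / w\<^sup>2"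
  proof cases
    case 3
    thus ?thesis using pos[of "-y"] odd[of y] y by simp
  qed (use pos[of y] y in \<open>auto simp: f_def\<close>)
  thus ?thesis by (simp add: f_def)
qed

text \<open>The point \<open>w = (n + 1/2) * \<alpha>\<close> lies midway between
  \<open>n * \<alpha>\<close> and \<open>(n+1) * \<alpha>\<close>, so the increment of the
  counterterm cancels the main term \<open>2 * y * ln w\<close> of the Gamma quotient up to central
  differences. Stirling remainders and the two central differences contribute \<open>3\<close>,
  \<open>2\<close> and \<open>1\<close> over \<open>w^2\<close>, whence the \<open>6\<close>. The
  hypothesis on \<open>n\<close> gives \<open>w\<close> at least \<open>2\<close>, hence
  \<open>|y|\<close> at most \<open>w/2\<close>.\<close>

lemma ln_double_sine_partial_Suc:
  assumes \<kappa>: "0 < \<kappa>" and \<alpha>: "\<kappa> \<le> \<alpha>" "\<alpha> \<le> 1" and y: "\<bar>y\<bar> \<le> 1" and n: "2 / \<kappa> \<le> real n"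
  shows "\<bar>ln_double_sine_partial (Suc n) y \<alpha> - ln_double_sine_partial n y \<alpha>\<bar> \<le> 6 / \<kappa>\<^sup>2 * (1 / real n - 1 / real (Suc n))"
proof -
  define \<phi> where "\<phi> z = z * ln z - z" for z :: real
  define f where "f w y = \<phi> (w - y) - \<phi> (w + y) + 2 * y * ln w" for w y
  define w where "w = (real n + 1/2) * \<alpha>"
  have a0: "\<alpha> > 0" using \<kappa> \<alpha> by simp
  have n0: "real n > 0" using n \<kappa> by (smt (verit) divide_pos_pos)
  have wk: "w \<ge> (real n + 1/2) * \<kappa>" unfolding w_def using \<alpha> by (intro mult_left_mono) auto
  have "real n * \<kappa> \<ge> 2" using n \<kappa> by (simp add: field_simps)
  hence w2: "w \<ge> 2" using wk \<kappa> by (simp add: algebra_simps)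
  have phi: "real m * ln (real m * \<alpha>) - real m = \<phi> (real m * \<alpha>) / \<alpha>" for m
    using a0 by (simp add: \<phi>_def field_simps)
  have "ln_double_sine_partial (Suc n) y \<alpha> - ln_double_sine_partial n y \<alpha> = ln_Gamma (w + 1/2 - y) - ln_Gamma (w + 1/2 + y)
      + (2 * y / \<alpha>) * (\<phi> (w + \<alpha>/2) - \<phi> (w - \<alpha>/2))"
  proof -
    have "real (Suc n) * \<alpha> = w + \<alpha>/2" "real n * \<alpha> = w - \<alpha>/2"
      by (simp_all add: w_def algebra_simps)
    thus ?thesis unfolding ln_double_sine_partial_def sum.lessThan_Suc phi
      by (simp add: w_def[symmetric] right_diff_distrib)
  qed
  also have "\<dots> = (stirling_remainder (w - y) - stirling_remainder (w + y)) + f w y - (2 * y / \<alpha>) * f w (\<alpha>/2)"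
    using a0 by (simp add: stirling_remainder_def f_def \<phi>_def algebra_simps)
  finally have eq: "ln_double_sine_partial (Suc n) y \<alpha> - ln_double_sine_partial n y \<alpha> = \<dots>" .
  have st: "\<bar>stirling_remainder (w - y) - stirling_remainder (w + y)\<bar> \<le> 3 / w\<^sup>2"
  proof -
    define z where "z = \<bar>y\<bar>"
    have z: "0 \<le> z" "z \<le> 1" using y by (auto simp: z_def)
    have wz: "w - z > 0" using w2 z by linarith
    have "\<bar>stirling_remainder (w - y) - stirling_remainder (w + y)\<bar> = \<bar>stirling_remainder (w + z) - stirling_remainder (w - z)\<bar>"
      by (auto simp: z_def abs_if)
    also have "\<dots> \<le> 1 / (w - z) - 1 / (w + z)"
      using stirling_remainder_diff[of "w - z" "w + z"] wz z by auto
    also have "\<dots> = 2 * z / (w\<^sup>2 - z\<^sup>2)"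
    proof -
      have "w - z \<noteq> 0" "w + z \<noteq> 0" using wz z by auto
      thus ?thesis by (simp add: diff_frac_eq square_diff_square_factored power2_eq_square[of w] power2_eq_square[of z] mult.commute)
    qed
    also have "\<dots> \<le> 2 / (3/4 * w\<^sup>2)"
    proof (rule frac_le)
      have "z\<^sup>2 \<le> 1" using z by (simp add: power_le_one)
      moreover have "w\<^sup>2 \<ge> 2\<^sup>2" using w2 by (intro power_mono) auto
      ultimately show "3/4 * w\<^sup>2 \<le> w\<^sup>2 - z\<^sup>2" by simp
    qed (use z w2 in auto)
    also have "\<dots> = (8/3) / w\<^sup>2" by simp
    also have "\<dots> \<le> 3 / w\<^sup>2" by (intro divide_right_mono) auto
    finally show ?thesis .
  qed
  have f1: "\<bar>f w y\<bar> \<le> 2 / w\<^sup>2"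
  proof -
    have "\<bar>f w y\<bar> \<le> 2 * \<bar>y\<bar> ^ 3 / w\<^sup>2"
      unfolding f_def \<phi>_def using y w2 by (intro entropy_central_difference) auto
    also have "\<dots> \<le> 2 * 1 / w\<^sup>2" using y by (intro divide_right_mono mult_left_mono power_le_one) auto
    finally show ?thesis by simp
  qed
  have f2: "\<bar>(2 * y / \<alpha>) * f w (\<alpha>/2)\<bar> \<le> 1 / w\<^sup>2"
  proof -
    have "\<bar>f w (\<alpha>/2)\<bar> \<le> 2 * \<bar>\<alpha>/2\<bar> ^ 3 / w\<^sup>2"
      unfolding f_def \<phi>_def using \<alpha> a0 w2 by (intro entropy_central_difference) auto
    hence "\<bar>(2 * y / \<alpha>) * f w (\<alpha>/2)\<bar> \<le> (2 * 1 / \<alpha>) * (2 * (\<alpha>/2) ^ 3 / w\<^sup>2)"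
      unfolding abs_mult using y a0 by (intro mult_mono) (auto simp: divide_right_mono)
    also have "\<dots> = (\<alpha>\<^sup>2 / 2) / w\<^sup>2" using a0 by (simp add: power3_eq_cube power2_eq_square)
    also have "\<dots> \<le> 1 / w\<^sup>2" using a0 \<alpha> power_le_one[of \<alpha> 2] by (intro divide_right_mono) auto
    finally show ?thesis .
  qed
  have "\<bar>ln_double_sine_partial (Suc n) y \<alpha> - ln_double_sine_partial n y \<alpha>\<bar> \<le> 3 / w\<^sup>2 + 2 / w\<^sup>2 + 1 / w\<^sup>2"
    unfolding eq using st f1 f2 by linarith
  also have "\<dots> = 6 / w\<^sup>2" by (simp add: field_simps)
  also have "\<dots> \<le> 6 / (\<kappa>\<^sup>2 * (real n * (real n + 1)))"
  proof (rule divide_left_mono)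
    have "\<kappa>\<^sup>2 * (real n * (real n + 1)) \<le> \<kappa>\<^sup>2 * (real n + 1/2)\<^sup>2"
      by (intro mult_left_mono) (auto simp: power2_eq_square algebra_simps)
    also have "\<dots> = ((real n + 1/2) * \<kappa>)\<^sup>2" by (simp add: power_mult_distrib)
    also have "\<dots> \<le> w\<^sup>2" using wk \<kappa> by (intro power_mono) auto
    finally show "\<kappa>\<^sup>2 * (real n * (real n + 1)) \<le> w\<^sup>2" .
  qed (use n0 \<kappa> w2 in auto)
  also have "\<dots> = 6 / \<kappa>\<^sup>2 * (1 / real n - 1 / real (Suc n))"
    using n0 \<kappa> by (simp add: divide_simps)
  finally show ?thesis .
qed

lemma ln_double_sine_partial_diff:
  assumes \<kappa>: "0 < \<kappa>" and \<alpha>: "\<kappa> \<le> \<alpha>" "\<alpha> \<le> 1" and y: "\<bar>y\<bar> \<le> 1" and L: "2 / \<kappa> \<le> real L" and M: "L \<le> M"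
  shows "\<bar>ln_double_sine_partial M y \<alpha> - ln_double_sine_partial L y \<alpha>\<bar> \<le> 6 / \<kappa>\<^sup>2 * (1 / real L - 1 / real M)"
  using M
proof (induction M rule: dec_induct)
  case (step n)
  have "\<bar>ln_double_sine_partial (Suc n) y \<alpha> - ln_double_sine_partial n y \<alpha>\<bar> \<le> 6 / \<kappa>\<^sup>2 * (1 / real n - 1 / real (Suc n))"
    using step L by (intro ln_double_sine_partial_Suc[OF \<kappa> \<alpha> y]) linarith
  moreover have "6 / \<kappa>\<^sup>2 * (1 / real L - 1 / real (Suc n)) =
      6 / \<kappa>\<^sup>2 * (1 / real L - 1 / real n) + 6 / \<kappa>\<^sup>2 * (1 / real n - 1 / real (Suc n))"
    by (simp add: right_diff_distrib)
  ultimately show ?case using step.IH by linarith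
qed auto

lemma ln_double_sine_partial_tendsto:
  assumes \<alpha>: "0 < \<alpha>" "\<alpha> \<le> 1" and y: "\<bar>y\<bar> \<le> 1"
  shows "(\<lambda>L. ln_double_sine_partial L y \<alpha>) \<longlonglongrightarrow> ln_double_sine y \<alpha>"
proof -
  have "Cauchy (\<lambda>L. ln_double_sine_partial L y \<alpha>)"
  proof (rule metric_CauchyI)
    fix e :: real assume e: "e > 0"
    obtain N where N: "real N > max (2 / \<alpha>) (6 / \<alpha>\<^sup>2 / (e/2))" using reals_Archimedean2 by blast
    have N0: "real N > 0" using N \<alpha> by (smt (verit) divide_pos_pos max.cobounded1)
    have h: "\<bar>ln_double_sine_partial M y \<alpha> - ln_double_sine_partial N y \<alpha>\<bar> < e / 2" if "M \<ge> N" for M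
    proof -
      have "\<bar>ln_double_sine_partial M y \<alpha> - ln_double_sine_partial N y \<alpha>\<bar> \<le> 6 / \<alpha>\<^sup>2 * (1 / real N - 1 / real M)"
        using N that by (intro ln_double_sine_partial_diff[OF \<alpha>(1) order_refl \<alpha>(2) y]) auto
      also have "\<dots> \<le> 6 / \<alpha>\<^sup>2 * (1 / real N)" by (intro mult_left_mono) auto
      also have "\<dots> < e / 2" using N e N0 \<alpha> by (simp add: field_simps)
      finally show ?thesis .
    qed
    show "\<exists>M. \<forall>m\<ge>M. \<forall>n\<ge>M. dist (ln_double_sine_partial m y \<alpha>) (ln_double_sine_partial n y \<alpha>) < e"
    proof (intro exI[of _ N] allI impI)
      fix m n assume "m \<ge> N" "n \<ge> N"
      thus "dist (ln_double_sine_partial m y \<alpha>) (ln_double_sine_partial n y \<alpha>) < e"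
        using h[of m] h[of n] unfolding dist_real_def by linarith
    qed
  qed
  thus ?thesis unfolding ln_double_sine_def by (simp add: Cauchy_convergent_iff convergent_LIMSEQ_iff)
qed

text \<open>The rate is uniform in \<open>y\<close> and in \<open>\<alpha>\<close> above
  \<open>\<kappa>\<close>; this is what later allows the truncation level to vary with the position
  in a chain.\<close>

lemma ln_double_sine_ln_double_sine_partial:
  assumes \<kappa>: "0 < \<kappa>" and \<alpha>: "\<kappa> \<le> \<alpha>" "\<alpha> \<le> 1" and y: "\<bar>y\<bar> \<le> 1" and L: "2 / \<kappa> \<le> real L"
  shows "\<bar>ln_double_sine y \<alpha> - ln_double_sine_partial L y \<alpha>\<bar> \<le> 6 / \<kappa>\<^sup>2 / real L"
proof (rule LIMSEQ_le_const2)
  show "(\<lambda>M. \<bar>ln_double_sine_partial M y \<alpha> - ln_double_sine_partial L y \<alpha>\<bar>) \<longlonglongrightarrow> \<bar>ln_double_sine y \<alpha> - ln_double_sine_partial L y \<alpha>\<bar>"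
    using \<kappa> \<alpha> y by (intro tendsto_intros ln_double_sine_partial_tendsto) auto
  have "\<bar>ln_double_sine_partial M y \<alpha> - ln_double_sine_partial L y \<alpha>\<bar> \<le> 6 / \<kappa>\<^sup>2 / real L" if "M \<ge> L" for M
  proof -
    have "\<bar>ln_double_sine_partial M y \<alpha> - ln_double_sine_partial L y \<alpha>\<bar> \<le> 6 / \<kappa>\<^sup>2 * (1 / real L - 1 / real M)"
      by (intro ln_double_sine_partial_diff[OF \<kappa> \<alpha> y L that])
    also have "\<dots> \<le> 6 / \<kappa>\<^sup>2 * (1 / real L)" by (intro mult_left_mono) auto
    finally show ?thesis by simp
  qed
  thus "\<exists>N. \<forall>n\<ge>N. \<bar>ln_double_sine_partial n y \<alpha> - ln_double_sine_partial L y \<alpha>\<bar> \<le> 6 / \<kappa>\<^sup>2 / real L" by blast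
qed

text \<open>A shift by \<open>\<alpha>\<close> moves the index of every Gamma factor by one, so the
  partial sums telescope. The end \<open>n = 0\<close> yields the sine through the reflection
  formula; at the end \<open>L\<close> the counterterm cancels the growth and leaves
  \<open>ln (2 * pi)\<close>.\<close>

lemma ln_double_sine_shift_alpha:
  assumes \<alpha>: "0 < \<alpha>" "\<alpha> \<le> 1" and x: "0 < x" "x < 1"
  shows "ln_double_sine (x - (1 + \<alpha>) / 2 + \<alpha>) \<alpha> = ln_double_sine (x - (1 + \<alpha>) / 2) \<alpha> - ln (2 * sin (pi * x))"
proof -
  define y where "y = x - (1 + \<alpha>) / 2"
  define G where "G n = ln_Gamma (real n * \<alpha> + x) + ln_Gamma (real n * \<alpha> + 1 - x)" for n
  have eq: "ln_double_sine_partial L (y + \<alpha>) \<alpha> - ln_double_sine_partial L y \<alpha> =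
      ln pi - ln (sin (pi * x)) - (G L - 2 * (real L * \<alpha> * ln (real L * \<alpha>) - real L * \<alpha>))" for L
  proof -
    have t: "(ln_Gamma ((real n + 1/2) * \<alpha> + 1/2 - (y + \<alpha>)) - ln_Gamma ((real n + 1/2) * \<alpha> + 1/2 + (y + \<alpha>)))
        - (ln_Gamma ((real n + 1/2) * \<alpha> + 1/2 - y) - ln_Gamma ((real n + 1/2) * \<alpha> + 1/2 + y))
       = G n - G (Suc n)" for n
    proof -
      have "(real n + 1/2) * \<alpha> + 1/2 - (y + \<alpha>) = real n * \<alpha> + 1 - x"
        "(real n + 1/2) * \<alpha> + 1/2 + (y + \<alpha>) = real (Suc n) * \<alpha> + x"
        "(real n + 1/2) * \<alpha> + 1/2 - y = real (Suc n) * \<alpha> + 1 - x"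
        "(real n + 1/2) * \<alpha> + 1/2 + y = real n * \<alpha> + x"
        by (simp_all add: y_def algebra_simps add_divide_distrib diff_divide_distrib)
      note e = this
      have gen: "\<And>a b c d :: real. (a - b) - (c - d) = (d + a) - (b + c)" by simp
      show ?thesis unfolding e G_def by (rule gen)
    qed
    have "ln_double_sine_partial L (y + \<alpha>) \<alpha> - ln_double_sine_partial L y \<alpha> = (\<Sum>n<L. G n - G (Suc n)) + 2 * (real L * \<alpha> * ln (real L * \<alpha>) - real L * \<alpha>)"
      unfolding ln_double_sine_partial_def t[symmetric] sum_subtractf by (simp add: algebra_simps)
    also have "(\<Sum>n<L. G n - G (Suc n)) = G 0 - G L" by (rule sum_lessThan_telescope')
    also have "G 0 = ln pi - ln (sin (pi * x))"
      using ln_Gamma_reflection[OF x] by (simp add: G_def)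
    finally show ?thesis by simp
  qed
  have "(\<lambda>L. G L - 2 * (real L * \<alpha> * ln (real L * \<alpha>) - real L * \<alpha>)) \<longlonglongrightarrow> ln (2 * pi)"
    unfolding G_def
    by (rule filterlim_compose[OF ln_Gamma_pair_tendsto]) (use \<alpha> in real_asymp)
  hence "(\<lambda>L. ln_double_sine_partial L (y + \<alpha>) \<alpha> - ln_double_sine_partial L y \<alpha>) \<longlonglongrightarrow> ln pi - ln (sin (pi * x)) - ln (2 * pi)"
    unfolding eq by (intro tendsto_intros)
  moreover have "(\<lambda>L. ln_double_sine_partial L (y + \<alpha>) \<alpha> - ln_double_sine_partial L y \<alpha>) \<longlonglongrightarrow> ln_double_sine (y + \<alpha>) \<alpha> - ln_double_sine y \<alpha>"
    using \<alpha> x by (intro tendsto_intros ln_double_sine_partial_tendsto) (auto simp: y_def abs_le_iff field_simps)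
  ultimately have "ln_double_sine (y + \<alpha>) \<alpha> - ln_double_sine y \<alpha> = ln pi - ln (sin (pi * x)) - ln (2 * pi)"
    by (rule LIMSEQ_unique[rotated])
  moreover have "sin (pi * x) > 0" using x by (intro sin_gt_zero) auto
  ultimately show ?thesis by (simp add: y_def ln_mult)
qed

text \<open>A shift by \<open>1\<close> produces the linear factors
  \<open>(n + u) * \<alpha>\<close> and \<open>(n + 1 - u) * \<alpha>\<close> through
  \<open>Gamma (z + 1) = z * Gamma z\<close>. With \<open>u = x / \<alpha>\<close> these factors
  rebuild Gamma functions with unit steps, so the telescoping and the reflection work as for the
  other period.\<close>

lemma ln_double_sine_shift_one:
  assumes \<alpha>: "0 < \<alpha>" "\<alpha> \<le> 1" and x: "0 < x" "x < \<alpha>"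
  shows "ln_double_sine (x - (1 + \<alpha>) / 2 + 1) \<alpha> = ln_double_sine (x - (1 + \<alpha>) / 2) \<alpha> - ln (2 * sin (pi * (x / \<alpha>)))"
proof -
  define y where "y = x - (1 + \<alpha>) / 2"
  define u where "u = x / \<alpha>"
  have u: "0 < u" "u < 1" "x = u * \<alpha>" using x \<alpha> by (auto simp: u_def)
  define G where "G n = ln_Gamma (real n + u) + ln_Gamma (real n + 1 - u)" for n
  have step: "ln_Gamma (z + 1) = ln_Gamma z + ln z" if "z > 0" for z :: real
  proof -
    have "Gamma (z + 1) = z * Gamma z" using that by (intro Gamma_plus1) auto
    moreover have "ln (z * Gamma z) = ln z + ln (Gamma z)" using that Gamma_real_pos[of z] by (intro ln_mult_pos) auto
    ultimately show ?thesis using that by (simp add: ln_Gamma_real_pos)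
  qed
  have eq: "ln_double_sine_partial L (y + 1) \<alpha> - ln_double_sine_partial L y \<alpha> =
      ln pi - ln (sin (pi * u)) - (G L - 2 * (real L * ln (real L) - real L))" if L: "L > 0" for L
  proof -
    have t: "(ln_Gamma ((real n + 1/2) * \<alpha> + 1/2 - (y + 1)) - ln_Gamma ((real n + 1/2) * \<alpha> + 1/2 + (y + 1)))
        - (ln_Gamma ((real n + 1/2) * \<alpha> + 1/2 - y) - ln_Gamma ((real n + 1/2) * \<alpha> + 1/2 + y))
       = G n - G (Suc n) - 2 * ln \<alpha>" for n
    proof -
      have "(real n + 1 - u) * \<alpha> > 0" "(real n + u) * \<alpha> > 0" using u \<alpha> by auto
      from this[THEN step]
      have "ln_Gamma ((real n + 1/2) * \<alpha> + 1/2 - y) = ln_Gamma ((real n + 1/2) * \<alpha> + 1/2 - (y + 1)) + ln ((real n + 1 - u) * \<alpha>)"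
        "ln_Gamma ((real n + 1/2) * \<alpha> + 1/2 + (y + 1)) = ln_Gamma ((real n + 1/2) * \<alpha> + 1/2 + y) + ln ((real n + u) * \<alpha>)"
        by (simp_all add: y_def u(3) algebra_simps add_divide_distrib diff_divide_distrib)
      moreover have "G (Suc n) = G n + ln (real n + 1 - u) + ln (real n + u)"
        using step[of "real n + u"] step[of "real n + 1 - u"] u by (simp add: G_def algebra_simps)
      ultimately show ?thesis using u \<alpha> by (simp add: ln_mult)
    qed
    have "ln_double_sine_partial L (y + 1) \<alpha> - ln_double_sine_partial L y \<alpha> = (\<Sum>n<L. G n - G (Suc n) - 2 * ln \<alpha>) + 2 * (real L * ln (real L * \<alpha>) - real L)"
      unfolding ln_double_sine_partial_def t[symmetric] sum_subtractf by (simp add: algebra_simps)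
    \<comment> \<open>The accumulated \<open>2 * L * ln \<alpha>\<close> turns
      \<open>ln (L * \<alpha>)\<close> in the counterterm into \<open>ln L\<close>.\<close>
    also have "(\<Sum>n<L. G n - G (Suc n) - 2 * ln \<alpha>) = G 0 - G L - 2 * real L * ln \<alpha>"
      unfolding sum_subtractf[of "\<lambda>n. G n - G (Suc n)"] by (simp add: sum_lessThan_telescope')
    also have "G 0 = ln pi - ln (sin (pi * u))"
      using ln_Gamma_reflection[OF u(1,2)] by (simp add: G_def)
    finally show ?thesis using L \<alpha> by (simp add: ln_mult algebra_simps)
  qed
  have "(\<lambda>L. G L - 2 * (real L * ln (real L) - real L)) \<longlonglongrightarrow> ln (2 * pi)"
    unfolding G_def by (rule filterlim_compose[OF ln_Gamma_pair_tendsto]) real_asymp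
  hence "(\<lambda>L. ln pi - ln (sin (pi * u)) - (G L - 2 * (real L * ln (real L) - real L))) \<longlonglongrightarrow> ln pi - ln (sin (pi * u)) - ln (2 * pi)"
    by (intro tendsto_intros)
  hence "(\<lambda>L. ln_double_sine_partial L (y + 1) \<alpha> - ln_double_sine_partial L y \<alpha>) \<longlonglongrightarrow> ln pi - ln (sin (pi * u)) - ln (2 * pi)"
    by (rule Lim_transform_eventually) (use eventually_gt_at_top[of 0] in \<open>eventually_elim, simp add: eq\<close>)
  moreover have "(\<lambda>L. ln_double_sine_partial L (y + 1) \<alpha> - ln_double_sine_partial L y \<alpha>) \<longlonglongrightarrow> ln_double_sine (y + 1) \<alpha> - ln_double_sine y \<alpha>"
    using \<alpha> x by (intro tendsto_intros ln_double_sine_partial_tendsto) (auto simp: y_def abs_le_iff field_simps)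
  ultimately have "ln_double_sine (y + 1) \<alpha> - ln_double_sine y \<alpha> = ln pi - ln (sin (pi * u)) - ln (2 * pi)"
    by (rule LIMSEQ_unique[rotated])
  moreover have "sin (pi * u) > 0" using u by (intro sin_gt_zero) auto
  ultimately show ?thesis by (simp add: y_def u_def ln_mult)
qed

section \<open>Reciprocity for Sudler products\<close>

lemma ln_Gamma_lipschitz:
  fixes R :: real
  assumes \<delta>: "0 < \<delta>" and R: "R \<ge> 2" and z: "\<delta> \<le> z" "z \<le> R" and z': "\<delta> \<le> z'" "z' \<le> R"
  shows "\<bar>ln_Gamma z - ln_Gamma z'\<bar> \<le> (\<bar>Digamma \<delta>\<bar> + R) * \<bar>z - z'\<bar>"
proof -
  have "Digamma R \<le> R"
  proof -
    have "Digamma R \<le> ln (R - 1/2) + 1 / (R - 1/2)\<^sup>2"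
      using Digamma_ln_bounds(2)[of "R - 1/2"] R by simp
    also have "\<dots> \<le> (R - 1/2 - 1) + 1"
      using R by (intro add_mono ln_le_minus_one) (auto simp: divide_le_eq_1 intro!: one_le_power)
    finally show ?thesis by simp
  qed
  \<comment> \<open>\<open>Digamma\<close> increases, so its values on the interval are controlled
    by those at the two end points.\<close>
  hence D: "\<bar>Digamma x\<bar> \<le> \<bar>Digamma \<delta>\<bar> + R" if "\<delta> \<le> x" "x \<le> R" for x
  proof -
    have "Digamma \<delta> \<le> Digamma x" "Digamma x \<le> Digamma R"
      using that \<delta> by (auto intro!: Digamma_real_mono)
    thus ?thesis using \<open>Digamma R \<le> R\<close> R by linarith
  qed
  have "norm (ln_Gamma z - ln_Gamma z') \<le> (\<bar>Digamma \<delta>\<bar> + R) * norm (z - z')"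
  proof (rule field_differentiable_bound[of "{\<delta>..R}" ln_Gamma Digamma])
    fix x assume "x \<in> {\<delta>..R}"
    thus "(ln_Gamma has_field_derivative Digamma x) (at x within {\<delta>..R})"
      using \<delta> by (intro has_field_derivative_at_within[OF has_field_derivative_ln_Gamma_real]) simp
    show "norm (Digamma x) \<le> \<bar>Digamma \<delta>\<bar> + R"
      using D \<open>x \<in> {\<delta>..R}\<close> by simp
  qed (use z z' in \<open>simp_all\<close>)
  thus ?thesis by simp
qed

text \<open>The margin \<open>\<delta>\<close> keeps all Gamma arguments above
  \<open>\<delta>\<close>, the critical ones being those with \<open>n = 0\<close>. There are
  \<open>L\<close> summands, each with a Lipschitz constant of order \<open>L\<close> and an
  argument that moves by at most \<open>L\<close> times the distance, whence the cube. Polynomial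
  growth in \<open>L\<close> is harmless, because the distances decay geometrically along
  chains.\<close>

lemma ln_double_sine_partial_lipschitz:
  assumes \<kappa>: "0 < \<kappa>" and \<delta>: "0 < \<delta>" and L: "L \<ge> 1"
    and \<alpha>: "\<kappa> \<le> \<alpha>" "\<alpha> \<le> 1" and \<beta>: "\<kappa> \<le> \<beta>" "\<beta> \<le> 1"
    and y: "\<bar>y\<bar> \<le> 1/2 + \<alpha>/2 - \<delta>" and z: "\<bar>z\<bar> \<le> 1/2 + \<beta>/2 - \<delta>"
  shows "\<bar>ln_double_sine_partial L y \<alpha> - ln_double_sine_partial L z \<beta>\<bar> \<le> (2 * (\<bar>Digamma \<delta>\<bar> + 3) + 2 * (2 + 1 / \<kappa>)) * (real L ^ 3 * (\<bar>\<alpha> - \<beta>\<bar> + \<bar>y - z\<bar>))"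
proof -
  define K where "K = \<bar>Digamma \<delta>\<bar>"
  define \<Delta> where "\<Delta> = \<bar>\<alpha> - \<beta>\<bar> + \<bar>y - z\<bar>"
  define l where "l = real L"
  have l: "l \<ge> 1" using L by (simp add: l_def)
  have a0: "0 < \<alpha>" "0 < \<beta>" using \<kappa> \<alpha> \<beta> by auto
  have K0: "K \<ge> 0" by (simp add: K_def)
  have y1: "\<bar>y\<bar> \<le> 1" "\<bar>z\<bar> \<le> 1" using y z \<alpha> \<beta> \<delta> by auto
  have lpow: "l \<le> l ^ 3" "l\<^sup>2 \<le> l ^ 3" using l power_increasing[of 1 3 l] power_increasing[of 2 3 l] by simp_all
  have \<Delta>0: "\<Delta> \<ge> 0" by (simp add: \<Delta>_def)
  define t where "t \<gamma> u n = (real n + 1/2) * \<gamma> + 1/2 + u" for \<gamma> u n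
  have tb: "\<delta> \<le> t \<gamma> u n \<and> t \<gamma> u n \<le> l + 2" if n: "n < L" and \<gamma>: "0 < \<gamma>" "\<gamma> \<le> 1" and u: "\<bar>u\<bar> \<le> 1/2 + \<gamma>/2 - \<delta>" for \<gamma> u n
  proof
    have "(real n + 1/2) * \<gamma> \<ge> \<gamma>/2" using \<gamma> by (simp add: algebra_simps)
    thus "\<delta> \<le> t \<gamma> u n" using u unfolding t_def by linarith
    have "real n + 1 \<le> l" using n by (simp add: l_def)
    moreover have "(real n + 1/2) * \<gamma> \<le> real n + 1/2" using \<gamma> by (intro mult_right_le_one_le) auto
    moreover have "u \<le> 1/2 + \<gamma>/2" using u \<delta> by linarith
    ultimately show "t \<gamma> u n \<le> l + 2" using \<gamma> unfolding t_def by linarith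
  qed
  have single: "\<bar>ln_Gamma (t \<alpha> u n) - ln_Gamma (t \<beta> v n)\<bar> \<le> (K + 3) * l\<^sup>2 * \<Delta>"
    if n: "n < L" and u: "\<bar>u\<bar> = \<bar>y\<bar>" "\<bar>v\<bar> = \<bar>z\<bar>" "\<bar>u - v\<bar> = \<bar>y - z\<bar>" for u v n
  proof -
    have "\<bar>ln_Gamma (t \<alpha> u n) - ln_Gamma (t \<beta> v n)\<bar> \<le> (K + (l + 2)) * \<bar>t \<alpha> u n - t \<beta> v n\<bar>"
      unfolding K_def
    proof (rule ln_Gamma_lipschitz[OF \<delta>])
      have "\<bar>u\<bar> \<le> 1/2 + \<alpha>/2 - \<delta>" "\<bar>v\<bar> \<le> 1/2 + \<beta>/2 - \<delta>" using u y z by simp_all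
      with tb[of n \<alpha> u] tb[of n \<beta> v] n a0 \<alpha> \<beta>
      show "\<delta> \<le> t \<alpha> u n" "t \<alpha> u n \<le> l + 2" "\<delta> \<le> t \<beta> v n" "t \<beta> v n \<le> l + 2" by blast+
    qed (use l in simp)
    also have "\<dots> \<le> ((K + 3) * l) * (l * \<Delta>)"
    proof (intro mult_mono)
      have "K * 1 \<le> K * l" using l K0 by (intro mult_left_mono) auto
      thus "K + (l + 2) \<le> (K + 3) * l" using l by (simp add: algebra_simps)
      have "t \<alpha> u n - t \<beta> v n = (real n + 1/2) * (\<alpha> - \<beta>) + (u - v)"
        by (simp add: t_def left_diff_distrib right_diff_distrib)
      hence "\<bar>t \<alpha> u n - t \<beta> v n\<bar> \<le> (real n + 1/2) * \<bar>\<alpha> - \<beta>\<bar> + \<bar>u - v\<bar>"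
        using abs_triangle_ineq[of "(real n + 1/2) * (\<alpha> - \<beta>)" "u - v"] by (simp add: abs_mult)
      also have "\<dots> \<le> l * \<bar>\<alpha> - \<beta>\<bar> + l * \<bar>y - z\<bar>"
      proof (intro add_mono mult_right_mono)
        have "1 * \<bar>y - z\<bar> \<le> l * \<bar>y - z\<bar>" using l by (intro mult_right_mono) auto
        thus "\<bar>u - v\<bar> \<le> l * \<bar>y - z\<bar>" using u(3) by simp
        have "real n + 1 \<le> l" using n by (simp add: l_def)
        thus "real n + 1/2 \<le> l" by simp
      qed auto
      finally show "\<bar>t \<alpha> u n - t \<beta> v n\<bar> \<le> l * \<Delta>" by (simp add: \<Delta>_def algebra_simps)
    qed (use l K0 in auto)
    finally show ?thesis by (simp add: power2_eq_square mult_ac)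
  qed
  define r where "r \<gamma> = l * ln (l * \<gamma>) - l" for \<gamma>
  have ln_double_sine_partial: "ln_double_sine_partial L u \<gamma> = (\<Sum>n<L. ln_Gamma (t \<gamma> (-u) n) - ln_Gamma (t \<gamma> u n)) + 2 * u * r \<gamma>" for u \<gamma>
    by (simp add: ln_double_sine_partial_def t_def r_def l_def)
  have S: "\<bar>(\<Sum>n<L. ln_Gamma (t \<alpha> (-y) n) - ln_Gamma (t \<alpha> y n)) - (\<Sum>n<L. ln_Gamma (t \<beta> (-z) n) - ln_Gamma (t \<beta> z n))\<bar>
      \<le> 2 * (K + 3) * (l ^ 3 * \<Delta>)"
  proof -
    have "\<bar>(\<Sum>n<L. ln_Gamma (t \<alpha> (-y) n) - ln_Gamma (t \<alpha> y n)) - (\<Sum>n<L. ln_Gamma (t \<beta> (-z) n) - ln_Gamma (t \<beta> z n))\<bar>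
        \<le> (\<Sum>n<L. \<bar>(ln_Gamma (t \<alpha> (-y) n) - ln_Gamma (t \<alpha> y n)) - (ln_Gamma (t \<beta> (-z) n) - ln_Gamma (t \<beta> z n))\<bar>)"
      unfolding sum_subtractf[symmetric] by (rule sum_abs)
    also have "\<dots> \<le> (\<Sum>n<L. 2 * ((K + 3) * l\<^sup>2 * \<Delta>))"
    proof (rule sum_mono)
      fix n assume "n \<in> {..<L}"
      thus "\<bar>(ln_Gamma (t \<alpha> (-y) n) - ln_Gamma (t \<alpha> y n)) - (ln_Gamma (t \<beta> (-z) n) - ln_Gamma (t \<beta> z n))\<bar>
          \<le> 2 * ((K + 3) * l\<^sup>2 * \<Delta>)"
        using single[of n "-y" "-z"] single[of n y z] abs_minus_commute[of z y] by simp
    qed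
    also have "\<dots> = 2 * (K + 3) * (l ^ 3 * \<Delta>)"
      by (simp add: l_def power2_eq_square power3_eq_cube)
    finally show ?thesis .
  qed
  have lnb: "\<bar>ln \<gamma>\<bar> \<le> 1 / \<kappa>" if "\<kappa> \<le> \<gamma>" "\<gamma> \<le> 1" for \<gamma>
  proof -
    have "ln (1 / \<gamma>) \<le> 1 / \<gamma> - 1" using that \<kappa> by (intro ln_le_minus_one) auto
    also have "\<dots> \<le> 1 / \<kappa>" using that \<kappa> frac_le[of 1 1 \<kappa> \<gamma>] by simp
    finally show ?thesis using that \<kappa> by (simp add: ln_div)
  qed
  have rb: "\<bar>r \<alpha>\<bar> \<le> (2 + 1 / \<kappa>) * l ^ 3"
  proof -
    have "\<bar>ln (l * \<alpha>)\<bar> \<le> \<bar>ln l\<bar> + \<bar>ln \<alpha>\<bar>" using l a0 abs_triangle_ineq[of "ln l" "ln \<alpha>"] by (subst ln_mult_pos) auto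
    also have "\<dots> \<le> l + 1 / \<kappa>" using l lnb[OF \<alpha>] ln_le_minus_one[of l] by (auto intro!: add_mono)
    also have "\<dots> \<le> l + l * (1 / \<kappa>)" using l \<kappa> by (simp add: divide_right_mono)
    finally have "l * \<bar>ln (l * \<alpha>)\<bar> \<le> l * (l + l * (1 / \<kappa>))" using l by (intro mult_left_mono) auto
    moreover have "\<bar>r \<alpha>\<bar> \<le> l * \<bar>ln (l * \<alpha>)\<bar> + l"
      using abs_triangle_ineq4[of "l * ln (l * \<alpha>)" l] l by (simp add: r_def abs_mult)
    ultimately have "\<bar>r \<alpha>\<bar> \<le> l * (l + l * (1 / \<kappa>)) + l" by linarith
    also have "\<dots> = (1 + 1/\<kappa>) * l\<^sup>2 + l" by (simp add: power2_eq_square distrib_left distrib_right)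
    also have "\<dots> \<le> (1 + 1/\<kappa>) * l ^ 3 + l ^ 3" using lpow \<kappa> by (intro add_mono mult_left_mono) auto
    finally show ?thesis by (simp add: distrib_right)
  qed
  have rd: "\<bar>r \<alpha> - r \<beta>\<bar> \<le> (1 / \<kappa>) * (l ^ 3 * \<bar>\<alpha> - \<beta>\<bar>)"
  proof -
    have "norm (ln \<alpha> - ln \<beta>) \<le> (1 / \<kappa>) * norm (\<alpha> - \<beta>)"
    proof (rule field_differentiable_bound[of "{\<kappa>..1}" ln "\<lambda>x. 1 / x"])
      fix x assume x: "x \<in> {\<kappa>..1}"
      show "(ln has_field_derivative (1 / x)) (at x within {\<kappa>..1})"
        using x \<kappa> by (auto intro!: derivative_eq_intros)
      show "norm (1 / x) \<le> 1 / \<kappa>" using x \<kappa> by (auto intro!: frac_le)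
    qed (use \<alpha> \<beta> in auto)
    hence "l * \<bar>ln \<alpha> - ln \<beta>\<bar> \<le> l ^ 3 * ((1 / \<kappa>) * \<bar>\<alpha> - \<beta>\<bar>)"
      using lpow l by (intro mult_mono) auto
    moreover have "r \<alpha> - r \<beta> = l * (ln \<alpha> - ln \<beta>)"
      using l a0 by (simp add: r_def ln_mult_pos algebra_simps)
    ultimately have "\<bar>r \<alpha> - r \<beta>\<bar> \<le> l ^ 3 * ((1 / \<kappa>) * \<bar>\<alpha> - \<beta>\<bar>)"
      using l by (simp only: abs_mult)
    thus ?thesis by (simp only: mult_ac)
  qed
  have "\<bar>2 * y * r \<alpha> - 2 * z * r \<beta>\<bar> = \<bar>2 * (y - z) * r \<alpha> + 2 * z * (r \<alpha> - r \<beta>)\<bar>"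
    by (simp add: algebra_simps)
  also have "\<dots> \<le> 2 * \<bar>y - z\<bar> * \<bar>r \<alpha>\<bar> + 2 * \<bar>z\<bar> * \<bar>r \<alpha> - r \<beta>\<bar>"
    by (rule order.trans[OF abs_triangle_ineq]) (simp only: abs_mult abs_numeral order_refl)
  also have "\<dots> \<le> 2 * \<bar>y - z\<bar> * ((2 + 1 / \<kappa>) * l ^ 3) + 2 * 1 * ((1 / \<kappa>) * (l ^ 3 * \<bar>\<alpha> - \<beta>\<bar>))"
    using rb rd y1 by (intro add_mono mult_mono) auto
  also have "\<dots> \<le> 2 * (2 + 1 / \<kappa>) * (l ^ 3 * \<Delta>)"
  proof -
    define m P Q where "m = 1 / \<kappa>" and "P = l ^ 3 * \<bar>\<alpha> - \<beta>\<bar>" and "Q = l ^ 3 * \<bar>y - z\<bar>"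
    have "P \<ge> 0" using l by (simp add: P_def)
    hence "m * P \<le> (2 + m) * P" by (intro mult_right_mono) auto
    moreover have "2 * \<bar>y - z\<bar> * ((2 + m) * l ^ 3) + 2 * 1 * (m * P) = 2 * ((2 + m) * Q) + 2 * (m * P)"
      unfolding P_def Q_def by algebra
    moreover have "2 * (2 + m) * (l ^ 3 * \<Delta>) = 2 * ((2 + m) * P) + 2 * ((2 + m) * Q)"
      unfolding P_def Q_def \<Delta>_def by algebra
    ultimately show ?thesis unfolding P_def[symmetric] m_def[symmetric] by linarith
  qed
  finally have R: "\<bar>2 * y * r \<alpha> - 2 * z * r \<beta>\<bar> \<le> 2 * (2 + 1 / \<kappa>) * (l ^ 3 * \<Delta>)" .
  have "\<bar>ln_double_sine_partial L y \<alpha> - ln_double_sine_partial L z \<beta>\<bar> \<le> 2 * (K + 3) * (l ^ 3 * \<Delta>) + 2 * (2 + 1 / \<kappa>) * (l ^ 3 * \<Delta>)"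
    using S R unfolding ln_double_sine_partial by linarith
  thus ?thesis by (simp add: K_def l_def \<Delta>_def algebra_simps)
qed

text \<open>The point \<open>(\<alpha> - 1) / 2\<close> is the centred coordinate of
  \<open>\<alpha>\<close>, so this is \<open>ln (S(\<alpha>) / S(x))\<close> at
  \<open>x = s + (1 + \<alpha>)/2\<close>.\<close>

definition ln_reciprocity_factor :: "real \<Rightarrow> real \<Rightarrow> real" where
  "ln_reciprocity_factor s \<alpha> = ln_double_sine ((\<alpha> - 1) / 2) \<alpha> - ln_double_sine s \<alpha>"

text \<open>The truncation error at level \<open>L\<close> is added to the Lipschitz bound for the
  partial sum. \<open>L\<close> stays free, since the good choice depends on the distance of the two
  points.\<close>

lemma ln_reciprocity_factor_modulus:
  assumes \<kappa>: "0 < \<kappa>" and \<delta>: "0 < \<delta>" "\<delta> \<le> \<kappa> / 2"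
  obtains C where "C \<ge> 0" "\<And>L s t \<alpha> \<beta>. \<lbrakk>1 \<le> L; 2 / \<kappa> \<le> real L; \<kappa> \<le> \<alpha>; \<alpha> \<le> 1; \<kappa> \<le> \<beta>; \<beta> \<le> 1;
      \<bar>s\<bar> \<le> 1/2 + \<alpha>/2 - \<delta>; \<bar>t\<bar> \<le> 1/2 + \<beta>/2 - \<delta>\<rbrakk> \<Longrightarrow>
      \<bar>ln_reciprocity_factor s \<alpha> - ln_reciprocity_factor t \<beta>\<bar> \<le> C * (1 / real L + real L ^ 3 * (\<bar>\<alpha> - \<beta>\<bar> + \<bar>s - t\<bar>))"
proof -
  define C1 where "C1 = 2 * (\<bar>Digamma \<delta>\<bar> + 3) + 2 * (2 + 1 / \<kappa>)"
  define C2 where "C2 = 12 / \<kappa>\<^sup>2"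
  have C: "C1 \<ge> 0" "C2 \<ge> 0" using \<kappa> by (auto simp: C1_def C2_def)
  have main: "\<bar>ln_double_sine s \<alpha> - ln_double_sine t \<beta>\<bar> \<le> (C1 + C2) * (1 / real L + real L ^ 3 * (\<bar>\<alpha> - \<beta>\<bar> + \<bar>s - t\<bar>))"
    if L: "1 \<le> L" "2 / \<kappa> \<le> real L" and \<alpha>: "\<kappa> \<le> \<alpha>" "\<alpha> \<le> 1" and \<beta>: "\<kappa> \<le> \<beta>" "\<beta> \<le> 1"
      and s: "\<bar>s\<bar> \<le> 1/2 + \<alpha>/2 - \<delta>" and t: "\<bar>t\<bar> \<le> 1/2 + \<beta>/2 - \<delta>" for L s t \<alpha> \<beta>
  proof -
    define a where "a = 1 / real L"
    define b where "b = real L ^ 3 * (\<bar>\<alpha> - \<beta>\<bar> + \<bar>s - t\<bar>)"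
    have ab: "a \<ge> 0" "b \<ge> 0" by (auto simp: a_def b_def)
    have "\<bar>ln_double_sine s \<alpha> - ln_double_sine_partial L s \<alpha>\<bar> \<le> 6 / \<kappa>\<^sup>2 / real L" using s \<alpha> \<delta> by (intro ln_double_sine_ln_double_sine_partial \<kappa> \<alpha> L(2)) auto
    moreover have "\<bar>ln_double_sine t \<beta> - ln_double_sine_partial L t \<beta>\<bar> \<le> 6 / \<kappa>\<^sup>2 / real L" using t \<beta> \<delta> by (intro ln_double_sine_ln_double_sine_partial \<kappa> \<beta> L(2)) auto
    moreover have "\<bar>ln_double_sine_partial L s \<alpha> - ln_double_sine_partial L t \<beta>\<bar> \<le> C1 * b"
      unfolding C1_def b_def by (intro ln_double_sine_partial_lipschitz \<kappa> \<delta>(1) L(1) \<alpha> \<beta> s t)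
    ultimately have "\<bar>ln_double_sine s \<alpha> - ln_double_sine t \<beta>\<bar> \<le> C2 * a + C1 * b"
      by (simp add: C2_def a_def)
    also have "\<dots> \<le> (C1 + C2) * (a + b)" using C ab by (simp add: algebra_simps)
    finally show ?thesis by (simp add: a_def b_def)
  qed
  show ?thesis
  proof (rule that[of "4 * (C1 + C2)"])
    fix L s t \<alpha> \<beta>
    assume L: "1 \<le> L" "2 / \<kappa> \<le> real L" and \<alpha>: "\<kappa> \<le> \<alpha>" "\<alpha> \<le> 1" and \<beta>: "\<kappa> \<le> \<beta>" "\<beta> \<le> 1"
      and s: "\<bar>s\<bar> \<le> 1/2 + \<alpha>/2 - \<delta>" and t: "\<bar>t\<bar> \<le> 1/2 + \<beta>/2 - \<delta>"
    define R where "R = 1 / real L + real L ^ 3 * (\<bar>\<alpha> - \<beta>\<bar> + \<bar>s - t\<bar>)"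
    have "\<bar>ln_double_sine s \<alpha> - ln_double_sine t \<beta>\<bar> \<le> (C1 + C2) * R" unfolding R_def by (rule main[OF L \<alpha> \<beta> s t])
    \<comment> \<open>As \<open>\<delta>\<close> is at most \<open>\<kappa> / 2\<close>, the base
      points \<open>(\<alpha> - 1) / 2\<close> and \<open>(\<beta> - 1) / 2\<close> keep the same
      margin.\<close>
    moreover have "\<bar>ln_double_sine ((\<alpha> - 1) / 2) \<alpha> - ln_double_sine ((\<beta> - 1) / 2) \<beta>\<bar> \<le>
       (C1 + C2) * (1 / real L + real L ^ 3 * (\<bar>\<alpha> - \<beta>\<bar> + \<bar>(\<alpha> - 1) / 2 - (\<beta> - 1) / 2\<bar>))"
      using \<alpha> \<beta> \<delta> \<kappa> by (intro main[OF L \<alpha> \<beta>]) (auto simp: abs_le_iff)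
    moreover have "(C1 + C2) * (1 / real L + real L ^ 3 * (\<bar>\<alpha> - \<beta>\<bar> + \<bar>(\<alpha> - 1) / 2 - (\<beta> - 1) / 2\<bar>)) \<le> (C1 + C2) * (1 / real L + real L ^ 3 * (\<bar>\<alpha> - \<beta>\<bar> + \<bar>\<alpha> - \<beta>\<bar>))"
      using C by (intro mult_left_mono add_left_mono) (auto simp: abs_if field_simps)
    moreover have "(C1 + C2) * (1 / real L + real L ^ 3 * (\<bar>\<alpha> - \<beta>\<bar> + \<bar>\<alpha> - \<beta>\<bar>)) \<le> (C1 + C2) * (3 * R)"
    proof (rule mult_left_mono)
      define p q r where "p = 1 / real L" and "q = real L ^ 3 * \<bar>\<alpha> - \<beta>\<bar>" and "r = real L ^ 3 * \<bar>s - t\<bar>"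
      have "p \<ge> 0" "q \<ge> 0" "r \<ge> 0" by (auto simp: p_def q_def r_def)
      thus "1 / real L + real L ^ 3 * (\<bar>\<alpha> - \<beta>\<bar> + \<bar>\<alpha> - \<beta>\<bar>) \<le> 3 * R"
        unfolding R_def distrib_left p_def[symmetric] q_def[symmetric] r_def[symmetric] by linarith
    qed (use C in auto)
    ultimately have "\<bar>ln_reciprocity_factor s \<alpha> - ln_reciprocity_factor t \<beta>\<bar> \<le> (C1 + C2) * R + (C1 + C2) * (3 * R)"
      unfolding ln_reciprocity_factor_def by linarith
    also have "\<dots> = 4 * (C1 + C2) * R" by simp
    finally show "\<bar>ln_reciprocity_factor s \<alpha> - ln_reciprocity_factor t \<beta>\<bar> \<le> 4 * (C1 + C2) * (1 / real L + real L ^ 3 * (\<bar>\<alpha> - \<beta>\<bar> + \<bar>s - t\<bar>))"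
      unfolding R_def .
  qed (use C in auto)
qed

section \<open>The reciprocity identity\<close>

lemma sudler_0 [simp]: "sudler 0 x = 1"
  by (simp add: sudler_def)

lemma sudler_Suc: "sudler (Suc N) x = sudler N x * \<bar>2 * sin (pi * real (Suc N) * x)\<bar>"
  by (simp add: sudler_def)

lemma abs_sin_shift_int: "\<bar>sin (x + pi * of_int m)\<bar> = \<bar>sin x\<bar>"
  by (simp add: sin_add mult.commute abs_mult)

lemma sudler_plus_int: "sudler N (x + of_int m) = sudler N x"
  unfolding sudler_def
proof (intro prod.cong refl)
  fix n
  have "pi * real n * (x + of_int m) = pi * real n * x + pi * of_int (int n * m)"
    by (simp add: algebra_simps)
  thus "\<bar>2 * sin (pi * real n * (x + of_int m))\<bar> = \<bar>2 * sin (pi * real n * x)\<bar>"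
    using abs_sin_shift_int[of "pi * real n * x" "int n * m"] by (simp only: abs_mult)
qed

text \<open>For \<open>x = (N + 1) * \<alpha> - M\<close> above \<open>\<alpha>\<close>, the step by
  \<open>- \<alpha>\<close> removes the last factor of the product at \<open>\<alpha>\<close>; below
  \<open>\<alpha>\<close>, the step by \<open>+ 1\<close> removes the last factor of the product at
  \<open>1 / \<alpha>\<close>. Both steps stay in the open interval from \<open>0\<close> to
  \<open>1 + \<alpha>\<close> and lower \<open>N + M\<close>. The multiplied form remains meaningful
  where the Sudler products vanish.\<close>

lemma sudler_reciprocity_exp:
  assumes \<alpha>: "0 < \<alpha>" "\<alpha> \<le> 1"
    and "0 < (real N + 1) * \<alpha> - real M" "(real N + 1) * \<alpha> - real M < 1 + \<alpha>"
  shows "sudler N \<alpha> * exp (ln_double_sine ((real N + 1) * \<alpha> - real M - (1 + \<alpha>) / 2) \<alpha>) =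
         sudler M (1 / \<alpha>) * exp (ln_double_sine ((\<alpha> - 1) / 2) \<alpha>)"
  using assms(3,4)
proof (induction "N + M" arbitrary: N M rule: less_induct)
  case less
  define x where "x = (real N + 1) * \<alpha> - real M"
  consider "x > \<alpha>" | "x = \<alpha>" "N = 0" | "x = \<alpha>" "N > 0" | "x < \<alpha>" by linarith
  thus ?case
  proof cases
    case 1
    have "N \<noteq> 0" using 1 by (intro notI) (simp add: x_def)
    then obtain N' where N: "N = Suc N'" by (cases N) auto
    define x' where "x' = (real N' + 1) * \<alpha> - real M"
    have x': "x = x' + \<alpha>" by (simp add: x_def x'_def N algebra_simps)
    have b: "0 < x'" "x' < 1" using 1 less.prems by (simp_all add: x' flip: x_def)
    have sp: "sin (pi * x') > 0" using b by (intro sin_gt_zero) auto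
    have "pi * real (Suc N') * \<alpha> = pi * x' + pi * of_int (int M)"
      by (simp add: x'_def algebra_simps)
    hence "\<bar>sin (pi * real (Suc N') * \<alpha>)\<bar> = sin (pi * x')"
      using abs_sin_shift_int[of "pi * x'" "int M"] sp by simp
    hence f: "sudler N \<alpha> = sudler N' \<alpha> * (2 * sin (pi * x'))"
      unfolding N sudler_Suc by (simp add: abs_mult)
    have "ln_double_sine (x' - (1 + \<alpha>) / 2 + \<alpha>) \<alpha> = ln_double_sine (x' - (1 + \<alpha>) / 2) \<alpha> - ln (2 * sin (pi * x'))"
      by (rule ln_double_sine_shift_alpha[OF \<alpha> b])
    moreover have "x - (1 + \<alpha>) / 2 = x' - (1 + \<alpha>) / 2 + \<alpha>" by (simp add: x')
    ultimately have "exp (ln_double_sine (x - (1 + \<alpha>) / 2) \<alpha>) = exp (ln_double_sine (x' - (1 + \<alpha>) / 2) \<alpha>) / (2 * sin (pi * x'))"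
      using sp by (simp only:) (simp add: exp_diff)
    moreover have "sudler N' \<alpha> * exp (ln_double_sine (x' - (1 + \<alpha>) / 2) \<alpha>) = sudler M (1 / \<alpha>) * exp (ln_double_sine ((\<alpha> - 1) / 2) \<alpha>)"
      using less.hyps[of N' M] N b \<alpha> by (simp add: x'_def)
    ultimately show ?thesis using sp by (simp add: f flip: x_def)
  next
    case 2
    hence "M = 0" by (simp add: x_def)
    thus ?thesis using 2 by (simp add: field_simps)
  next
    case 3
    then obtain N' where N: "N = Suc N'" by (cases N) auto
    \<comment> \<open>Here \<open>\<alpha> = M / N\<close>, so both products contain a vanishing
      sine and the identity reads \<open>0 = 0\<close>.\<close>
    have eq: "real N * \<alpha> = real M" using 3 by (simp add: x_def algebra_simps)
    have "M \<noteq> 0" using eq \<alpha> N by (intro notI) simp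
    then obtain M' where M: "M = Suc M'" by (cases M) auto
    have "sin (pi * real (Suc N') * \<alpha>) = 0"
      using eq unfolding N sin_zero_iff_int2 by (intro exI[of _ "int M"]) (simp add: mult_ac)
    moreover have "sin (pi * real (Suc M') * (1 / \<alpha>)) = 0"
      using eq \<alpha> unfolding M sin_zero_iff_int2 by (intro exI[of _ "int N"]) (simp add: field_simps flip: eq)
    ultimately have "sudler N \<alpha> = 0" "sudler M (1 / \<alpha>) = 0" unfolding N M sudler_Suc by simp_all
    thus ?thesis by simp
  next
    case 4
    have "real N * \<alpha> \<ge> 0" using \<alpha> by simp
    hence "M \<noteq> 0" using 4 by (intro notI) (simp add: x_def algebra_simps)
    then obtain M' where M: "M = Suc M'" by (cases M) auto
    have x0: "0 < x" using less.prems by (simp add: x_def)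
    define x' where "x' = (real N + 1) * \<alpha> - real M'"
    have x': "x' = x + 1" by (simp add: x_def x'_def M algebra_simps)
    define u where "u = x / \<alpha>"
    have "0 < u" "u < 1" using x0 4 \<alpha> by (auto simp: u_def)
    hence "sin (pi * u) > 0" by (intro sin_gt_zero) auto
    hence sp: "sin (pi * (x / \<alpha>)) > 0" by (simp only: u_def)
    have "pi * real (Suc M') * (1 / \<alpha>) = - (pi * (x / \<alpha>)) + pi * of_int (int N + 1)"
      using \<alpha> by (simp add: x_def M field_simps)
    hence "\<bar>sin (pi * real (Suc M') * (1 / \<alpha>))\<bar> = sin (pi * (x / \<alpha>))"
      using abs_sin_shift_int[of "- (pi * (x / \<alpha>))" "int N + 1"] sp by simp
    hence f: "sudler M (1 / \<alpha>) = sudler M' (1 / \<alpha>) * (2 * sin (pi * (x / \<alpha>)))"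
      unfolding M sudler_Suc by (simp add: abs_mult)
    have "ln_double_sine (x - (1 + \<alpha>) / 2 + 1) \<alpha> = ln_double_sine (x - (1 + \<alpha>) / 2) \<alpha> - ln (2 * sin (pi * (x / \<alpha>)))"
      by (rule ln_double_sine_shift_one[OF \<alpha> x0 4])
    moreover have "x' - (1 + \<alpha>) / 2 = x - (1 + \<alpha>) / 2 + 1" by (simp add: x')
    ultimately have "exp (ln_double_sine (x' - (1 + \<alpha>) / 2) \<alpha>) = exp (ln_double_sine (x - (1 + \<alpha>) / 2) \<alpha>) / (2 * sin (pi * (x / \<alpha>)))"
      using sp by (simp only:) (simp add: exp_diff)
    moreover have "sudler N \<alpha> * exp (ln_double_sine (x' - (1 + \<alpha>) / 2) \<alpha>) = sudler M' (1 / \<alpha>) * exp (ln_double_sine ((\<alpha> - 1) / 2) \<alpha>)"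
      using less.hyps[of N M'] M 4 x0 by (simp add: x'_def x'[unfolded x'_def])
    ultimately have "sudler N \<alpha> * exp (ln_double_sine (x - (1 + \<alpha>) / 2) \<alpha>) = sudler M' (1 / \<alpha>) * exp (ln_double_sine ((\<alpha> - 1) / 2) \<alpha>) * (2 * sin (pi * (x / \<alpha>)))"
      using sp by (simp add: field_simps)
    thus ?thesis unfolding f x_def[symmetric] by (simp only: mult_ac)
  qed
qed

lemma sudler_reciprocity:
  assumes \<alpha>: "0 < \<alpha>" "\<alpha> \<le> 1"
    and s: "s = (real N + 1/2) * \<alpha> - real M - 1/2" "\<bar>s\<bar> < 1/2 + \<alpha>/2"
  shows "sudler N \<alpha> = sudler M (1 / \<alpha>) * exp (ln_reciprocity_factor s \<alpha>)"
proof -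
  have "(real N + 1) * \<alpha> - real M - (1 + \<alpha>) / 2 = s"
    by (simp add: s(1) algebra_simps add_divide_distrib)
  moreover from this have "0 < (real N + 1) * \<alpha> - real M" "(real N + 1) * \<alpha> - real M < 1 + \<alpha>"
    using s(2) unfolding abs_less_iff by (simp_all add: add_divide_distrib)
  ultimately have "sudler N \<alpha> * exp (ln_double_sine s \<alpha>) = sudler M (1 / \<alpha>) * exp (ln_double_sine ((\<alpha> - 1) / 2) \<alpha>)"
    using sudler_reciprocity_exp[OF \<alpha>, of N M] by simp
  thus ?thesis by (simp add: ln_reciprocity_factor_def exp_diff field_simps)
qed

text \<open>With \<open>i = k - 1 - j\<close> counting levels from the far end, the truncation level
  \<open>n0 + (i + 1)^2\<close> makes both \<open>1 / L\<close> and \<open>L^3 * \<rho>^i\<close>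
  summable. The bound is therefore independent of the length \<open>k\<close>.\<close>

lemma ln_reciprocity_factor_sum_bound:
  assumes \<kappa>: "0 < \<kappa>" and \<delta>: "0 < \<delta>" "\<delta> \<le> \<kappa> / 2" and \<rho>: "0 < \<rho>" "\<rho> < 1" and E: "E \<ge> 0"
  obtains C where "C \<ge> 0" "\<And>k (s :: nat \<Rightarrow> real) t \<alpha> \<beta>.
      (\<And>j. j < k \<Longrightarrow> \<kappa> \<le> \<alpha> j \<and> \<alpha> j \<le> 1 \<and> \<kappa> \<le> \<beta> j \<and> \<beta> j \<le> 1
        \<and> \<bar>s j\<bar> \<le> 1/2 + \<alpha> j/2 - \<delta> \<and> \<bar>t j\<bar> \<le> 1/2 + \<beta> j/2 - \<delta>
        \<and> \<bar>\<alpha> j - \<beta> j\<bar> + \<bar>s j - t j\<bar> \<le> E * \<rho> ^ (k - Suc j)) \<Longrightarrow>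
      (\<Sum>j<k. \<bar>ln_reciprocity_factor (s j) (\<alpha> j) - ln_reciprocity_factor (t j) (\<beta> j)\<bar>) \<le> C"
proof -
  obtain C where C: "C \<ge> 0" and C_le: "\<And>L s t \<alpha> \<beta>. \<lbrakk>1 \<le> L; 2 / \<kappa> \<le> real L; \<kappa> \<le> \<alpha>; \<alpha> \<le> 1; \<kappa> \<le> \<beta>; \<beta> \<le> 1;
      \<bar>s\<bar> \<le> 1/2 + \<alpha>/2 - \<delta>; \<bar>t\<bar> \<le> 1/2 + \<beta>/2 - \<delta>\<rbrakk> \<Longrightarrow>
      \<bar>ln_reciprocity_factor s \<alpha> - ln_reciprocity_factor t \<beta>\<bar> \<le> C * (1 / real L + real L ^ 3 * (\<bar>\<alpha> - \<beta>\<bar> + \<bar>s - t\<bar>))"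
    using ln_reciprocity_factor_modulus[OF \<kappa> \<delta>] by blast
  obtain n0 :: nat where n0: "2 / \<kappa> \<le> real n0" using real_arch_simple by blast
  define L where "L i = n0 + (Suc i)\<^sup>2" for i
  define f where "f i = C * (1 / (real i + 1)\<^sup>2 + (real n0 + (real i + 1)\<^sup>2) ^ 3 * (E * \<rho> ^ i))" for i
  have f0: "f i \<ge> 0" for i using C E \<rho> by (auto simp: f_def)
  have "summable f"
  proof -
    have s1: "summable (\<lambda>i. 1 / (real i + 1)\<^sup>2)"
      using summable_Suc_iff[of "\<lambda>n. 1 / (real n)\<^sup>2"] inverse_power_summable[of 2, where 'a = real]
      by (simp add: inverse_eq_divide add_ac)
    have s2: "summable (\<lambda>i. (real n0 + (real i + 1)\<^sup>2) ^ 3 * (E * \<rho> ^ i))"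
    proof (rule summable_comparison_test_bigo)
      show "summable (\<lambda>i. norm (1 / (real i + 1)\<^sup>2))" using s1 by simp
      show "(\<lambda>i. (real n0 + (real i + 1)\<^sup>2) ^ 3 * (E * \<rho> ^ i)) \<in> O(\<lambda>i. 1 / (real i + 1)\<^sup>2)"
        using \<rho> by real_asymp
    qed
    show ?thesis unfolding f_def by (intro summable_mult summable_add s1 s2)
  qed
  show ?thesis
  proof (rule that[of "suminf f"])
    show "suminf f \<ge> 0" by (rule suminf_nonneg) fact+
    fix k and s t \<alpha> \<beta> :: "nat \<Rightarrow> real"
    assume A: "\<And>j. j < k \<Longrightarrow> \<kappa> \<le> \<alpha> j \<and> \<alpha> j \<le> 1 \<and> \<kappa> \<le> \<beta> j \<and> \<beta> j \<le> 1
        \<and> \<bar>s j\<bar> \<le> 1/2 + \<alpha> j/2 - \<delta> \<and> \<bar>t j\<bar> \<le> 1/2 + \<beta> j/2 - \<delta>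
        \<and> \<bar>\<alpha> j - \<beta> j\<bar> + \<bar>s j - t j\<bar> \<le> E * \<rho> ^ (k - Suc j)"
    have "(\<Sum>j<k. \<bar>ln_reciprocity_factor (s j) (\<alpha> j) - ln_reciprocity_factor (t j) (\<beta> j)\<bar>) \<le> (\<Sum>j<k. f (k - Suc j))"
    proof (rule sum_mono)
      fix j assume "j \<in> {..<k}"
      hence j: "j < k" by simp
      define i where "i = k - Suc j"
      have "real n0 \<le> real (L i)" unfolding of_nat_le_iff by (simp add: L_def)
      hence L1: "2 / \<kappa> \<le> real (L i)" using n0 by linarith
      have L0: "1 \<le> L i" by (simp add: L_def power2_eq_square)
      have L2: "real (L i) = real n0 + (real i + 1)\<^sup>2" by (simp add: L_def add_ac)
      have "\<bar>ln_reciprocity_factor (s j) (\<alpha> j) - ln_reciprocity_factor (t j) (\<beta> j)\<bar> \<le> C * (1 / real (L i) + real (L i) ^ 3 * (\<bar>\<alpha> j - \<beta> j\<bar> + \<bar>s j - t j\<bar>))"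
        using A[OF j] by (intro C_le L0 L1) auto
      also have "\<dots> \<le> C * (1 / (real i + 1)\<^sup>2 + real (L i) ^ 3 * (E * \<rho> ^ i))"
        using A[OF j] C L2 by (intro mult_left_mono add_mono frac_le) (auto simp: i_def)
      finally show "\<bar>ln_reciprocity_factor (s j) (\<alpha> j) - ln_reciprocity_factor (t j) (\<beta> j)\<bar> \<le> f (k - Suc j)"
        unfolding i_def[symmetric] f_def L2 .
    qed
    also have "\<dots> = (\<Sum>i<k. f i)" by (rule sum.nat_diff_reindex)
    also have "\<dots> \<le> suminf f" by (rule sum_le_suminf) (use \<open>summable f\<close> f0 in auto)
    finally show "(\<Sum>j<k. \<bar>ln_reciprocity_factor (s j) (\<alpha> j) - ln_reciprocity_factor (t j) (\<beta> j)\<bar>) \<le> suminf f" .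
  qed
qed

section \<open>Chains of rounded indices\<close>

text \<open>\<open>cnum w / cden w\<close> is the continued fraction \<open>[0; w]\<close>, the
  empty word giving \<open>0 / 1\<close>. Removing the front letter corresponds to one step of the
  Gauss map, so the levels of a chain are the suffixes \<open>drop j w\<close>.\<close>

fun cnum :: "nat list \<Rightarrow> nat" and cden :: "nat list \<Rightarrow> nat" where
  "cnum [] = 0"
| "cnum (a # w) = cden w"
| "cden [] = 1"
| "cden (a # w) = a * cden w + cnum w"

definition cval :: "nat list \<Rightarrow> real" where
  "cval w = real (cnum w) / real (cden w)"

lemma cden_pos: "set w \<subseteq> {1..A} \<Longrightarrow> cden w > 0"
  by (induction w) auto

lemma cnum_le_cden: "set w \<subseteq> {1..A} \<Longrightarrow> cnum w \<le> cden w"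
  by (cases w) (auto simp: trans_le_add1)

lemma cval_Nil [simp]: "cval [] = 0"
  by (simp add: cval_def)

lemma cval_bounds:
  assumes "set w \<subseteq> {1..A}"
  shows "0 \<le> cval w" "cval w \<le> 1"
  using cnum_le_cden[OF assms] cden_pos[OF assms] by (auto simp: cval_def divide_le_eq)

lemma cval_Cons:
  assumes "set (a # w) \<subseteq> {1..A}"
  shows "cval (a # w) = 1 / (real a + cval w)"
proof -
  have "real (cden w) > 0" using cden_pos[of w A] assms by simp
  hence "real a + real (cnum w) / real (cden w) = (real a * real (cden w) + real (cnum w)) / real (cden w)"
    by (simp add: field_simps)
  thus ?thesis by (simp add: cval_def)
qed

lemma cden_Cons_cval: 
  assumes "set (a # w) \<subseteq> {1..A}"
  shows "real (cden (a # w)) * cval (a # w) = real (cden w)"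
  using cden_pos[OF assms] by (simp add: cval_def del: cden.simps)

lemma cval_Cons_bounds:
  assumes "set (a # w) \<subseteq> {1..A}"
  shows "1 / (real A + 1) \<le> cval (a # w)" "0 < cval (a # w)" "cval (a # w) \<le> 1"
proof -
  have b: "0 \<le> cval w" "cval w \<le> 1" using assms cval_bounds[of w A] by auto
  have a: "1 \<le> real a" "real a \<le> real A" using assms by auto
  show "1 / (real A + 1) \<le> cval (a # w)" unfolding cval_Cons[OF assms] using a b by (intro frac_le) auto
  show "0 < cval (a # w)" unfolding cval_Cons[OF assms] using a b by (intro divide_pos_pos) auto
  show "cval (a # w) \<le> 1" using assms by (rule cval_bounds)
qed

text \<open>The centred argument \<open>s\<close> in the reciprocity between the indices
  \<open>N j\<close> and \<open>N (Suc j)\<close>. Indices are integers here, since modified chains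
  are shown to be nonnegative only afterwards.\<close>

definition chain_residue :: "(nat \<Rightarrow> real) \<Rightarrow> (nat \<Rightarrow> int) \<Rightarrow> nat \<Rightarrow> real" where
  "chain_residue \<alpha> N j = (of_int (N j) + 1/2) * \<alpha> j - of_int (N (Suc j)) - 1/2"

text \<open>The relation \<open>\<alpha> * (a + \<alpha>') = 1\<close> eliminates the indices
  themselves; only the digit \<open>c\<close> survives. The factor \<open>- \<alpha> j\<close> is
  the contraction on which the comparison of chains rests.\<close>

lemma chain_residue_rec:
  assumes "\<alpha> j = 1 / (a + \<alpha> (Suc j))" "a + \<alpha> (Suc j) > 0"
    and "real_of_int (N j) = a * of_int (N (Suc j)) + of_int (N (Suc (Suc j))) + c"
  shows "chain_residue \<alpha> N j = - \<alpha> j * (chain_residue \<alpha> N (Suc j) + (a / 2 - c))"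
proof -
  have "\<alpha> j * (a + \<alpha> (Suc j)) = 1" using assms(1,2) by simp
  hence e: "\<alpha> j * a = 1 - \<alpha> j * \<alpha> (Suc j)" by (simp add: algebra_simps)
  have "chain_residue \<alpha> N j + \<alpha> j * (chain_residue \<alpha> N (Suc j) + (a / 2 - c)) =
     (\<alpha> j * a + \<alpha> j * \<alpha> (Suc j) - 1) * (of_int (N (Suc j)) + 1/2)"
    unfolding chain_residue_def assms(3) by (simp add: algebra_simps)
  thus ?thesis unfolding e by simp
qed

text \<open>The strip condition is equivalent to \<open>N (j+1) < (N j + 1) * \<alpha> j\<close>
  together with \<open>N j * \<alpha> j < N (j+1) + 1\<close>. Since
  \<open>Q j * \<alpha> j = Q (j+1)\<close>, the admissible range passes from level
  \<open>j + 1\<close> to level \<open>j\<close>, and the induction runs from the far end to the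
  front.\<close>

lemma chain_range:
  fixes Q :: "nat \<Rightarrow> nat"
  assumes \<alpha>: "\<And>j. j < k \<Longrightarrow> 0 < \<alpha> j" and Q: "\<And>j. j < k \<Longrightarrow> real (Q j) * \<alpha> j = real (Q (Suc j))"
    and r: "\<And>j. j < k \<Longrightarrow> \<bar>chain_residue \<alpha> N j\<bar> < 1/2 + \<alpha> j / 2"
    and N: "0 \<le> N k" "N k < int (Q k)" and j: "j \<le> k"
  shows "0 \<le> N j \<and> N j < int (Q j)"
  using j
proof (induction rule: inc_induct)
  case (step n)
  have a0: "\<alpha> n > 0" using \<alpha> step by simp
  have e: "(of_int (N n) + 1/2) * \<alpha> n = of_int (N (Suc n)) + 1/2 + chain_residue \<alpha> N n" by (simp add: chain_residue_def)
  have b: "- (1/2 + \<alpha> n / 2) < chain_residue \<alpha> N n" "chain_residue \<alpha> N n < 1/2 + \<alpha> n / 2"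
    using r[of n] step by (auto simp: abs_less_iff)
  have IH: "0 \<le> real_of_int (N (Suc n))" "real_of_int (N (Suc n)) + 1 \<le> real (Q (Suc n))"
    using step.IH by linarith+
  have "(of_int (N n) + 1) * \<alpha> n > 0"
    using e b IH by (simp add: algebra_simps)
  hence "real_of_int (N n) + 1 > 0" using a0 by (simp add: zero_less_mult_iff)
  moreover have "of_int (N n) * \<alpha> n < real (Q n) * \<alpha> n"
    using e b IH Q[of n] step by (simp add: algebra_simps)
  hence "of_int (N n) < real (Q n)" using a0 by simp
  ultimately show ?case by linarith
qed (use N in auto)

lemma cval_drop:
  assumes "set w \<subseteq> {1..A}" "j < length w"
  shows "cval (drop j w) = 1 / (real (w ! j) + cval (drop (Suc j) w))"
    "1 \<le> w ! j" "w ! j \<le> A"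
    "1 / (real A + 1) \<le> cval (drop j w)" "0 < cval (drop j w)" "cval (drop j w) \<le> 1"
    "0 \<le> cval (drop (Suc j) w)" "cval (drop (Suc j) w) \<le> 1"
    "real (cden (drop j w)) * cval (drop j w) = real (cden (drop (Suc j) w))"
proof -
  have d: "drop j w = w ! j # drop (Suc j) w" using assms by (simp add: Cons_nth_drop_Suc)
  have "set (drop j w) \<subseteq> {1..A}" using assms(1) set_drop_subset[of j w] by blast
  hence s: "set (w ! j # drop (Suc j) w) \<subseteq> {1..A}" unfolding d .
  show "cval (drop j w) = 1 / (real (w ! j) + cval (drop (Suc j) w))" unfolding d by (rule cval_Cons[OF s])
  show "1 \<le> w ! j" "w ! j \<le> A" using s by auto
  show "1 / (real A + 1) \<le> cval (drop j w)" "0 < cval (drop j w)" "cval (drop j w) \<le> 1"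
    unfolding d by (rule cval_Cons_bounds[OF s])+
  show "0 \<le> cval (drop (Suc j) w)" "cval (drop (Suc j) w) \<le> 1"
    using s cval_bounds[of "drop (Suc j) w" A] by auto
  show "real (cden (drop j w)) * cval (drop j w) = real (cden (drop (Suc j) w))"
    unfolding d by (rule cden_Cons_cval[OF s])
qed

text \<open>Stated for arbitrary chains in the strip, so that it serves rounded chains as well as
  those altered at a seam.\<close>

lemma sudler_chain:
  assumes w: "set w \<subseteq> {1..A}" and k: "k \<le> length w"
    and N: "\<And>j. j \<le> k \<Longrightarrow> 0 \<le> N j"
    and r: "\<And>j. j < k \<Longrightarrow> \<bar>chain_residue (\<lambda>j. cval (drop j w)) N j\<bar> < 1/2 + cval (drop j w) / 2"
  shows "sudler (nat (N 0)) (cval w) = sudler (nat (N k)) (cval (drop k w)) *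
           exp (\<Sum>j<k. ln_reciprocity_factor (chain_residue (\<lambda>j. cval (drop j w)) N j) (cval (drop j w)))"
  using k N r
proof (induction k)
  case (Suc k)
  let ?a = "cval (drop k w)"
  let ?r = "chain_residue (\<lambda>j. cval (drop j w)) N"
  note cd = cval_drop[OF w, of k]
  have k: "k < length w" using Suc.prems by simp
  have "sudler (nat (N k)) ?a = sudler (nat (N (Suc k))) (1 / ?a) * exp (ln_reciprocity_factor (?r k) ?a)"
  proof (rule sudler_reciprocity)
    show "?r k = (real (nat (N k)) + 1/2) * ?a - real (nat (N (Suc k))) - 1/2"
      using Suc.prems(2) by (simp add: chain_residue_def)
    show "\<bar>?r k\<bar> < 1/2 + ?a / 2" using Suc.prems(3) by blast
  qed (use cd k in auto)
  also have "1 / ?a = cval (drop (Suc k) w) + of_int (int (w ! k))"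
    using cd(1,2,7) k by (simp add: add.commute)
  also have "sudler (nat (N (Suc k))) \<dots> = sudler (nat (N (Suc k))) (cval (drop (Suc k) w))"
    by (rule sudler_plus_int)
  finally have st: "sudler (nat (N k)) ?a = sudler (nat (N (Suc k))) (cval (drop (Suc k) w)) * exp (ln_reciprocity_factor (?r k) ?a)" .
  have "sudler (nat (N 0)) (cval w) = sudler (nat (N k)) ?a * exp (\<Sum>j<k. ln_reciprocity_factor (?r j) (cval (drop j w)))"
    using Suc.prems by (intro Suc.IH) auto
  thus ?case unfolding st by (simp add: exp_add mult_ac)
qed simp

section \<open>The rounded chain and its digits\<close>

fun rounded_chain :: "nat list \<Rightarrow> int \<Rightarrow> nat \<Rightarrow> int" where
  "rounded_chain w N 0 = N"
| "rounded_chain w N (Suc j) = \<lfloor>(of_int (rounded_chain w N j) + 1/2) * cval (drop j w)\<rfloor>"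

lemma rounded_chain_chain_residue: "\<bar>chain_residue (\<lambda>j. cval (drop j w)) (rounded_chain w N) j\<bar> \<le> 1/2"
  using floor_correct[of "(of_int (rounded_chain w N j) + 1/2) * cval (drop j w)"]
  unfolding chain_residue_def rounded_chain.simps by linarith

lemma rounded_chain_range:
  assumes w: "set w \<subseteq> {1..A}" and N: "0 \<le> N" "N < int (cden w)" and j: "j \<le> length w"
  shows "0 \<le> rounded_chain w N j \<and> rounded_chain w N j < int (cden (drop j w))"
  using j
proof (induction j)
  case (Suc j)
  let ?a = "cval (drop j w)"
  have jl: "j < length w" using Suc.prems by simp
  note cd = cval_drop[OF w jl]
  have IH: "0 \<le> real_of_int (rounded_chain w N j)" "real_of_int (rounded_chain w N j) + 1 \<le> real (cden (drop j w))"
    using Suc by linarith+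
  have "0 \<le> (of_int (rounded_chain w N j) + 1/2) * ?a" using IH cd(5) by simp
  moreover have "(of_int (rounded_chain w N j) + 1/2) * ?a < real (cden (drop j w)) * ?a"
    using IH cd(5) by (intro mult_strict_right_mono) auto
  hence "(of_int (rounded_chain w N j) + 1/2) * ?a < of_int (int (cden (drop (Suc j) w)))"
    using cd(9) by simp
  ultimately show ?case unfolding rounded_chain.simps by (simp only: floor_less_iff zero_le_floor)
qed (use N in auto)

text \<open>After the last letter the denominator is \<open>1\<close>, which forces the index
  \<open>0\<close>; one level further the empty word has value \<open>0\<close>, and the floor of
  \<open>0\<close> is \<open>0\<close>. Gluing overwrites these two zeros.\<close>

lemma rounded_chain_length:
  assumes w: "set w \<subseteq> {1..A}" and N: "0 \<le> N" "N < int (cden w)"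
  shows "rounded_chain w N (length w) = 0" "rounded_chain w N (Suc (length w)) = 0"
  using rounded_chain_range[OF w N, of "length w"] by auto

text \<open>The rounded chain ends in the empty product, so iterated reciprocity exhibits the Sudler
  product as an exponential.\<close>

lemma sudler_pos:
  assumes w: "set w \<subseteq> {1..A}" and N: "N < cden w"
  shows "sudler N (cval w) > 0"
proof -
  have "sudler (nat (rounded_chain w (int N) 0)) (cval w) = sudler (nat (rounded_chain w (int N) (length w))) (cval (drop (length w) w)) *
      exp (\<Sum>j<length w. ln_reciprocity_factor (chain_residue (\<lambda>j. cval (drop j w)) (rounded_chain w (int N)) j) (cval (drop j w)))"
  proof (rule sudler_chain[OF w order_refl])
    fix j assume j: "j < length w"
    show "\<bar>chain_residue (\<lambda>j. cval (drop j w)) (rounded_chain w (int N)) j\<bar> < 1/2 + cval (drop j w) / 2"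
      using rounded_chain_chain_residue[of w "int N" j] cval_drop(5)[OF w j] by linarith
  qed (use rounded_chain_range[OF w, of "int N"] N in auto)
  thus ?thesis using rounded_chain_length(1)[OF w, of "int N"] N by simp
qed

text \<open>The defect of \<open>N\<close> in the continuant recursion: adding a solution of the
  homogeneous recursion leaves all digits unchanged.\<close>

definition chain_digit :: "nat list \<Rightarrow> (nat \<Rightarrow> int) \<Rightarrow> nat \<Rightarrow> int" where
  "chain_digit w N j = N j - int (w ! j) * N (Suc j) - N (Suc (Suc j))"

lemma chain_residue_chain_digit:
  assumes w: "set w \<subseteq> {1..A}" and j: "j < length w" and c: "chain_digit u N j = c" "u ! j = w ! j"
  shows "chain_residue (\<lambda>j. cval (drop j w)) N j = - cval (drop j w) * (chain_residue (\<lambda>j. cval (drop j w)) N (Suc j) + (real (w ! j) / 2 - of_int c))"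
proof (rule chain_residue_rec)
  show "cval (drop j w) = 1 / (real (w ! j) + cval (drop (Suc j) w))" "real (w ! j) + cval (drop (Suc j) w) > 0"
    using cval_drop[OF w j] by auto
  have "N j = int (w ! j) * N (Suc j) + N (Suc (Suc j)) + c" using c by (simp add: chain_digit_def)
  thus "real_of_int (N j) = real (w ! j) * of_int (N (Suc j)) + of_int (N (Suc (Suc j))) + of_int c"
    by simp
qed

text \<open>Both residues lie in the half-open interval from \<open>-1/2\<close> to
  \<open>1/2\<close>; with \<open>\<alpha> * (a + \<beta>) = 1\<close> the recursion gives
  \<open>c < a + 1\<close> and \<open>c\<close> at least \<open>-1\<close>. The result yields
  \<open>|a/2 - c|\<close> at most \<open>a/2\<close>, which makes the residue recursion respect the
  strip.\<close>

lemma rounded_chain_chain_digit: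
  assumes w: "set w \<subseteq> {1..A}" and j: "j < length w"
  shows "0 \<le> chain_digit w (rounded_chain w N) j" "chain_digit w (rounded_chain w N) j \<le> int (w ! j)"
proof -
  let ?N = "rounded_chain w N" and ?r = "chain_residue (\<lambda>j. cval (drop j w)) (rounded_chain w N)"
  define c where "c = chain_digit w ?N j"
  define \<alpha> where "\<alpha> = cval (drop j w)"
  define \<beta> where "\<beta> = cval (drop (Suc j) w)"
  note cd = cval_drop[OF w j]
  have ab: "\<alpha> > 0" "0 \<le> \<beta>" "\<beta> \<le> 1" "\<alpha> * (real (w ! j) + \<beta>) = 1"
    using cd by (auto simp: \<alpha>_def \<beta>_def)
  have rng: "- (1/2) \<le> ?r i \<and> ?r i < 1/2" for i
    using floor_correct[of "(of_int (rounded_chain w N i) + 1/2) * cval (drop i w)"]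
    unfolding chain_residue_def rounded_chain.simps by linarith
  have "?r j = - \<alpha> * (?r (Suc j) + (real (w ! j) / 2 - of_int c))"
    unfolding \<alpha>_def by (rule chain_residue_chain_digit[OF w j]) (simp_all add: c_def)
  hence e: "\<alpha> * (?r (Suc j) + real (w ! j) / 2 - of_int c) = - ?r j" by (simp add: algebra_simps)
  have "\<alpha> * (?r (Suc j) + real (w ! j) / 2 - of_int c) \<le> \<alpha> * ((real (w ! j) + \<beta>) / 2)"
    unfolding e using rng[of j] ab(4) by simp
  hence 1: "?r (Suc j) + real (w ! j) / 2 - of_int c \<le> (real (w ! j) + \<beta>) / 2"
    using ab(1) by simp
  have "\<alpha> * (- ((real (w ! j) + \<beta>) / 2)) < \<alpha> * (?r (Suc j) + real (w ! j) / 2 - of_int c)"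
    unfolding e using rng[of j] ab(4) by simp
  hence 2: "- ((real (w ! j) + \<beta>) / 2) < ?r (Suc j) + real (w ! j) / 2 - of_int c"
    using ab(1) by (simp only: mult_less_cancel_left_pos)
  have "of_int c < real (w ! j) + 1" using 2 rng[of "Suc j"] ab by (simp add: field_simps)
  thus "chain_digit w ?N j \<le> int (w ! j)" unfolding c_def by linarith
  have "of_int c > (-1 :: real)"
  proof (rule ccontr)
    assume "\<not> of_int c > (-1 :: real)"
    with 1 rng[of "Suc j"] ab have eq: "\<beta> = 1" "?r (Suc j) = - (1/2)" by (auto simp: field_simps)
    \<comment> \<open>at \<open>\<beta> = 1\<close> the residue is an integer\<close>
    have "of_int (?N (Suc j)) - of_int (?N (Suc (Suc j))) = (- (1/2) :: real)"
      using eq unfolding chain_residue_def \<beta>_def by simp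
    hence "of_int (2 * (?N (Suc j) - ?N (Suc (Suc j)))) = (of_int (-1) :: real)" by simp
    hence "2 * (?N (Suc j) - ?N (Suc (Suc j))) = -1" by (simp only: of_int_eq_iff)
    thus False by presburger
  qed
  thus "0 \<le> chain_digit w ?N j" unfolding c_def by linarith
qed

section \<open>Bounded distortion\<close>

text \<open>\<open>s\<close> belongs to the reference chain, with residues at most
  \<open>1/2\<close>; of the altered chain \<open>t\<close> only the last residue is controlled.
  Towards the front, the margin of \<open>t\<close> shrinks by a factor of at worst
  \<open>\<kappa>\<close> per level, while \<open>|s - t|\<close> contracts like powers of
  \<open>\<rho>\<close>. The first effect is used on finitely many last levels; beyond them
  \<open>t\<close> inherits its margin from \<open>s\<close>. A uniform margin and geometric
  closeness bound the sum.\<close>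

lemma bounded_distortion:
  fixes A :: real
  assumes A: "A \<ge> 1"
  obtains C where "C \<ge> 0" "\<And>k (s :: nat \<Rightarrow> real) t \<alpha> \<beta> a d.
    \<lbrakk>\<And>j. j < k \<Longrightarrow> \<alpha> j = 1 / (a j + \<alpha> (Suc j)) \<and> \<beta> j = 1 / (a j + \<beta> (Suc j)) \<and> 1 \<le> a j \<and> a j \<le> A;
     0 \<le> \<alpha> k; \<alpha> k \<le> 1; 0 \<le> \<beta> k; \<beta> k \<le> 1;
     \<And>j. j < k \<Longrightarrow> s j = - \<alpha> j * (s (Suc j) + d j) \<and> t j = - \<beta> j * (t (Suc j) + d j) \<and> \<bar>d j\<bar> \<le> a j / 2;
     \<And>j. j < k \<Longrightarrow> \<bar>s j\<bar> \<le> 1/2;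
     0 < k \<Longrightarrow> \<bar>t (k - 1)\<bar> \<le> 1/2 + \<beta> (k - 1) / 2 * (1 - 1 / (A + 1))\<rbrakk> \<Longrightarrow>
     (\<forall>j<k. \<bar>t j\<bar> < 1/2 + \<beta> j / 2) \<and>
     (\<Sum>j<k. \<bar>ln_reciprocity_factor (s j) (\<alpha> j) - ln_reciprocity_factor (t j) (\<beta> j)\<bar>) \<le> C"
proof -
  \<comment> \<open>\<open>\<kappa>\<close> bounds the continued fraction values from below.
    \<open>\<rho>\<close> bounds them from above at all levels but the last, where the tail value
    may be \<open>0\<close>. \<open>B\<close> bounds \<open>|t + d|\<close>.\<close>
  define \<kappa> where "\<kappa> = 1 / (A + 1)"
  define \<rho> where "\<rho> = 1 / (1 + \<kappa>)"
  define B where "B = 1 + A / 2"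
  define E0 where "E0 = 2 + B / (1 - \<rho>)"
  define E where "E = E0 + 1"
  have \<kappa>: "0 < \<kappa>" "\<kappa> \<le> 1/2" using A by (auto simp: \<kappa>_def field_simps)
  have \<rho>: "0 < \<rho>" "\<rho> < 1" using \<kappa> by (auto simp: \<rho>_def field_simps)
  have B0: "B \<ge> 0" using A by (simp add: B_def)
  have E0: "E0 \<ge> 0" using B0 \<rho> by (simp add: E0_def)
  have E: "E > 0" using E0 by (simp add: E_def)
  \<comment> \<open>At least \<open>I\<close> levels before the last one, the bound
    \<open>E * \<rho>^i\<close> is below \<open>\<kappa> / 4\<close>; \<open>\<delta>\<close> is a
    margin still available within the last \<open>I\<close> levels.\<close>
  obtain I where I: "\<rho> ^ I < \<kappa> / (4 * E)"
    using real_arch_pow_inv[of "\<kappa> / (4 * E)" \<rho>] \<kappa> E \<rho> by auto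
  define \<delta> where "\<delta> = \<kappa> ^ (I + 2) / 2"
  have \<kappa>I: "\<kappa> ^ (I + 2) \<le> \<kappa> / 2"
  proof -
    have "\<kappa> ^ (I + 2) \<le> \<kappa> ^ 2" using \<kappa> by (intro power_decreasing) auto
    also have "\<dots> \<le> \<kappa> * (1/2)" unfolding power2_eq_square using \<kappa> by (intro mult_left_mono) auto
    finally show ?thesis by simp
  qed
  have \<delta>: "0 < \<delta>" "\<delta> \<le> \<kappa> / 4" "\<delta> \<le> \<kappa> / 2" using \<kappa> \<kappa>I by (auto simp: \<delta>_def)
  obtain C where C: "C \<ge> 0" and C_le: "\<And>k (s :: nat \<Rightarrow> real) t \<alpha> \<beta>.
      (\<And>j. j < k \<Longrightarrow> \<kappa> \<le> \<alpha> j \<and> \<alpha> j \<le> 1 \<and> \<kappa> \<le> \<beta> j \<and> \<beta> j \<le> 1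
        \<and> \<bar>s j\<bar> \<le> 1/2 + \<alpha> j/2 - \<delta> \<and> \<bar>t j\<bar> \<le> 1/2 + \<beta> j/2 - \<delta>
        \<and> \<bar>\<alpha> j - \<beta> j\<bar> + \<bar>s j - t j\<bar> \<le> E * \<rho> ^ (k - Suc j)) \<Longrightarrow>
      (\<Sum>j<k. \<bar>ln_reciprocity_factor (s j) (\<alpha> j) - ln_reciprocity_factor (t j) (\<beta> j)\<bar>) \<le> C"
    using ln_reciprocity_factor_sum_bound[OF \<kappa>(1) \<delta>(1,3) \<rho> less_imp_le[OF E]] by blast
  show ?thesis
  proof (rule that[OF C])
    fix k and s t \<alpha> \<beta> a d :: "nat \<Rightarrow> real"
    assume cf: "\<And>j. j < k \<Longrightarrow> \<alpha> j = 1 / (a j + \<alpha> (Suc j)) \<and> \<beta> j = 1 / (a j + \<beta> (Suc j)) \<and> 1 \<le> a j \<and> a j \<le> A"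
      and fin: "0 \<le> \<alpha> k" "\<alpha> k \<le> 1" "0 \<le> \<beta> k" "\<beta> k \<le> 1"
      and rec: "\<And>j. j < k \<Longrightarrow> s j = - \<alpha> j * (s (Suc j) + d j) \<and> t j = - \<beta> j * (t (Suc j) + d j) \<and> \<bar>d j\<bar> \<le> a j / 2"
      and s: "\<And>j. j < k \<Longrightarrow> \<bar>s j\<bar> \<le> 1/2"
      and t_last: "0 < k \<Longrightarrow> \<bar>t (k - 1)\<bar> \<le> 1/2 + \<beta> (k - 1) / 2 * (1 - 1 / (A + 1))"
    have rng: "0 \<le> \<gamma> j \<and> \<gamma> j \<le> 1" if \<gamma>: "\<And>j. j < k \<Longrightarrow> \<gamma> j = 1 / (a j + \<gamma> (Suc j))" "0 \<le> \<gamma> k" "\<gamma> k \<le> 1" and j: "j \<le> k"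
      for \<gamma> :: "nat \<Rightarrow> real" and j
      using j
    proof (induction rule: inc_induct)
      case (step n)
      thus ?case using \<gamma>(1)[of n] cf[of n] by (simp add: divide_le_eq)
    qed (use \<gamma> in auto)
    have low: "\<kappa> \<le> \<gamma> j" if \<gamma>: "\<And>j. j < k \<Longrightarrow> \<gamma> j = 1 / (a j + \<gamma> (Suc j))" "0 \<le> \<gamma> k" "\<gamma> k \<le> 1" and j: "j < k"
      for \<gamma> :: "nat \<Rightarrow> real" and j
    proof -
      have "0 \<le> \<gamma> (Suc j) \<and> \<gamma> (Suc j) \<le> 1" using rng[OF \<gamma>, of "Suc j"] j by simp
      thus ?thesis unfolding \<kappa>_def \<gamma>(1)[OF j] using cf[OF j] by (intro frac_le) auto
    qed
    have \<alpha>b: "\<kappa> \<le> \<alpha> j" "\<alpha> j \<le> 1" if "j < k" for j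
      using low[of \<alpha> j] rng[of \<alpha> j] cf fin that by auto
    have \<beta>b: "\<kappa> \<le> \<beta> j" "\<beta> j \<le> 1" if "j < k" for j
      using low[of \<beta> j] rng[of \<beta> j] cf fin that by auto
    have up: "\<alpha> j \<le> \<rho>" "\<beta> j \<le> \<rho>" if j: "Suc j < k" for j
    proof -
      have "1 + \<kappa> \<le> a j + \<alpha> (Suc j)" "1 + \<kappa> \<le> a j + \<beta> (Suc j)"
        using \<alpha>b(1)[of "Suc j"] \<beta>b(1)[of "Suc j"] cf[of j] j by auto
      thus "\<alpha> j \<le> \<rho>" "\<beta> j \<le> \<rho>"
        using cf[of j] j \<kappa> unfolding \<rho>_def by (auto intro!: divide_left_mono mult_pos_pos)
    qed
    \<comment> \<open>By \<open>\<beta> j * (a j + \<beta> (Suc j)) = 1\<close>, a relative margin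
      \<open>p\<close> at level \<open>j + 1\<close> becomes \<open>\<beta> (Suc j) * p\<close> at
      level \<open>j\<close>, and \<open>\<beta> (Suc j)\<close> is at least
      \<open>\<kappa>\<close>.\<close>
    have margin: "\<bar>t (k - Suc i)\<bar> \<le> 1/2 + \<beta> (k - Suc i) / 2 * (1 - \<kappa> ^ Suc i)" if "i < k" for i
      using that
    proof (induction i)
      case 0
      thus ?case using t_last by (simp add: \<kappa>_def)
    next
      case (Suc i)
      define j where "j = k - Suc (Suc i)"
      have j: "Suc j = k - Suc i" "j < k" "Suc j < k" using Suc.prems by (auto simp: j_def)
      have IH: "\<bar>t (Suc j)\<bar> \<le> 1/2 + \<beta> (Suc j) / 2 * (1 - \<kappa> ^ Suc i)" unfolding j(1) using Suc by simp
      have b0: "\<beta> j > 0" using \<beta>b[OF j(2)] \<kappa> by simp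
      have ab: "\<beta> j * (a j + \<beta> (Suc j)) = 1" using cf[OF j(2)] \<beta>b[OF j(3)] \<kappa> by auto
      define p where "p = \<kappa> ^ Suc i"
      have "\<bar>t j\<bar> = \<beta> j * \<bar>t (Suc j) + d j\<bar>" using rec[OF j(2)] b0 by (simp add: abs_mult)
      also have "\<dots> \<le> \<beta> j * (1/2 + \<beta> (Suc j) / 2 * (1 - \<kappa> ^ Suc i) + a j / 2)"
        using IH rec[OF j(2)] b0 by (intro mult_left_mono) linarith+
      also have "\<dots> = \<beta> j * (a j + \<beta> (Suc j)) / 2 + \<beta> j / 2 - \<beta> j / 2 * (\<beta> (Suc j) * \<kappa> ^ Suc i)"
        unfolding p_def[symmetric] by (simp add: field_simps)
      also have "\<dots> \<le> 1/2 + \<beta> j / 2 - \<beta> j / 2 * (\<kappa> * \<kappa> ^ Suc i)"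
        unfolding ab using b0 \<beta>b[OF j(3)] \<kappa> by (auto intro!: mult_left_mono mult_right_mono)
      finally have "\<bar>t j\<bar> \<le> 1/2 + \<beta> j / 2 * (1 - \<kappa> * \<kappa> ^ Suc i)"
        by (simp only: right_diff_distrib mult_1_right add_diff_eq)
      thus ?case by (simp only: j_def power_Suc)
    qed
    have t1: "\<bar>t j\<bar> \<le> 1/2 + \<beta> j / 2 * (1 - \<kappa> ^ (k - j))" if "j < k" for j
      using margin[of "k - Suc j"] that by (simp add: Suc_diff_Suc)
    have t_strict: "\<bar>t j\<bar> < 1/2 + \<beta> j / 2" if "j < k" for j
    proof -
      have "0 < \<beta> j / 2 * \<kappa> ^ (k - j)" using \<beta>b[OF that] \<kappa> by simp
      thus ?thesis using t1[OF that] by (simp add: algebra_simps)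
    qed
    have t_one: "\<bar>t j\<bar> \<le> 1" if "j < k" for j
      using t_strict[OF that] \<beta>b[OF that] by simp
    have diff: "\<bar>\<alpha> j - \<beta> j\<bar> = \<alpha> j * \<beta> j * \<bar>\<alpha> (Suc j) - \<beta> (Suc j)\<bar>" if j: "j < k" for j
    proof -
      have "0 \<le> \<alpha> (Suc j)" "0 \<le> \<beta> (Suc j)" using rng[of \<alpha> "Suc j"] rng[of \<beta> "Suc j"] cf fin j by auto
      hence p: "a j + \<alpha> (Suc j) > 0" "a j + \<beta> (Suc j) > 0" using cf[OF j] by linarith+
      hence "\<alpha> j - \<beta> j = \<alpha> j * \<beta> j * (\<beta> (Suc j) - \<alpha> (Suc j))"
        using cf[OF j] by (simp add: diff_frac_eq)
      moreover have "\<alpha> j \<ge> 0" "\<beta> j \<ge> 0" using \<alpha>b[OF j] \<beta>b[OF j] \<kappa> by simp_all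
      ultimately show ?thesis by (simp add: abs_mult abs_minus_commute)
    qed
    have D: "\<bar>\<alpha> (k - Suc i) - \<beta> (k - Suc i)\<bar> \<le> \<rho> ^ (2 * i)" if "i < k" for i
      using that
    proof (induction i)
      case 0
      have "\<bar>\<alpha> (k - 1) - \<beta> (k - 1)\<bar> \<le> 1" using \<alpha>b[of "k - 1"] \<beta>b[of "k - 1"] \<kappa> 0 by (auto simp: abs_le_iff)
      thus ?case by simp
    next
      case (Suc i)
      define j where "j = k - Suc (Suc i)"
      have j: "Suc j = k - Suc i" "j < k" "Suc j < k" using Suc.prems by (auto simp: j_def)
      have "\<bar>\<alpha> j - \<beta> j\<bar> = \<alpha> j * \<beta> j * \<bar>\<alpha> (Suc j) - \<beta> (Suc j)\<bar>" by (rule diff[OF j(2)])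
      also have "\<dots> \<le> \<rho> * \<rho> * \<rho> ^ (2 * i)"
        using up[OF j(3)] Suc.IH Suc.prems \<alpha>b[OF j(2)] \<beta>b[OF j(2)] \<kappa> \<rho> unfolding j(1)
        by (intro mult_mono) auto
      finally show ?case by (simp add: j_def)
    qed
    \<comment> \<open>The forcing term has order \<open>\<rho>^(2 * (i + 1))\<close>, because the
      values \<open>\<alpha> j\<close> and \<open>\<beta> j\<close> approach each other at twice the
      rate. The factor \<open>1 - \<rho>^i\<close> lets the induction absorb it, by
      \<open>\<rho>^i * (1 - \<rho>)^2\<close> being nonnegative; the \<open>2\<close> covers the
      initial difference.\<close>
    have e: "\<bar>s (k - Suc i) - t (k - Suc i)\<bar> \<le> \<rho> ^ i * (2 + B / (1 - \<rho>) * (1 - \<rho> ^ i))" if "i < k" for i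
      using that
    proof (induction i)
      case 0
      thus ?case using s[of "k - 1"] t_one[of "k - 1"] by simp
    next
      case (Suc i)
      define j where "j = k - Suc (Suc i)"
      define G where "G = B / (1 - \<rho>)"
      have G: "G \<ge> 0" "B = G * (1 - \<rho>)" using B0 \<rho> by (auto simp: G_def)
      have j: "Suc j = k - Suc i" "j < k" "Suc j < k" using Suc.prems by (auto simp: j_def)
      have "s j - t j = - (\<alpha> j * (s (Suc j) - t (Suc j)) + (\<alpha> j - \<beta> j) * (t (Suc j) + d j))"
        using rec[OF j(2)] by (simp add: algebra_simps)
      hence "\<bar>s j - t j\<bar> \<le> \<bar>\<alpha> j * (s (Suc j) - t (Suc j))\<bar> + \<bar>(\<alpha> j - \<beta> j) * (t (Suc j) + d j)\<bar>"
        by (metis abs_minus_cancel abs_triangle_ineq)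
      also have "\<dots> \<le> \<rho> * (\<rho> ^ i * (2 + G * (1 - \<rho> ^ i))) + \<rho> ^ (2 * Suc i) * B"
      proof (intro add_mono)
        show "\<bar>\<alpha> j * (s (Suc j) - t (Suc j))\<bar> \<le> \<rho> * (\<rho> ^ i * (2 + G * (1 - \<rho> ^ i)))"
          unfolding abs_mult j(1) G_def using Suc up[OF j(3)] \<alpha>b[OF j(2)] \<kappa> \<rho> by (intro mult_mono) auto
        have "\<bar>t (Suc j) + d j\<bar> \<le> B"
          using t_one[OF j(3)] rec[OF j(2)] cf[OF j(2)] unfolding B_def by linarith
        thus "\<bar>(\<alpha> j - \<beta> j) * (t (Suc j) + d j)\<bar> \<le> \<rho> ^ (2 * Suc i) * B"
          unfolding abs_mult using D[of "Suc i"] Suc.prems \<rho> by (intro mult_mono) (auto simp: j_def)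
      qed
      also have "\<dots> = \<rho> ^ Suc i * (2 + G * (1 - \<rho> ^ i + \<rho> ^ i * (\<rho> - \<rho>\<^sup>2)))"
      proof -
        define p where "p = \<rho> ^ i"
        have p: "\<rho> ^ (2 * Suc i) = (\<rho> * p) * (\<rho> * p)" "\<rho> ^ Suc i = \<rho> * p" "\<rho> ^ i = p"
          by (simp_all add: p_def mult_2 power_add)
        have "\<rho> * (p * (2 + G * (1 - p))) + \<rho> * p * (\<rho> * p) * (G * (1 - \<rho>)) = \<rho> * p * (2 + G * (1 - p + p * (\<rho> - \<rho>\<^sup>2)))"
          by algebra
        thus ?thesis unfolding p G(2)[symmetric] by simp
      qed
      also have "\<dots> \<le> \<rho> ^ Suc i * (2 + G * (1 - \<rho> ^ Suc i))"
      proof (intro mult_left_mono add_left_mono)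
        have "0 \<le> \<rho> ^ i * (1 - \<rho>)\<^sup>2" using \<rho> by simp
        thus "1 - \<rho> ^ i + \<rho> ^ i * (\<rho> - \<rho>\<^sup>2) \<le> 1 - \<rho> ^ Suc i"
          by (simp add: power2_eq_square algebra_simps)
      qed (use \<rho> G in auto)
      finally show ?case by (simp add: j_def G_def)
    qed
    have tot: "\<bar>\<alpha> j - \<beta> j\<bar> + \<bar>s j - t j\<bar> \<le> E * \<rho> ^ (k - Suc j)" "\<bar>s j - t j\<bar> \<le> E * \<rho> ^ (k - Suc j)" if j: "j < k" for j
    proof -
      define i where "i = k - Suc j"
      have i: "i < k" "j = k - Suc i" using j by (auto simp: i_def)
      have "\<bar>s j - t j\<bar> \<le> \<rho> ^ i * (2 + B / (1 - \<rho>) * (1 - \<rho> ^ i))" using e[OF i(1)] i(2) by simp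
      also have "\<dots> \<le> \<rho> ^ i * (2 + B / (1 - \<rho>) * 1)"
        using \<rho> B0 by (intro mult_left_mono add_left_mono) auto
      finally have 1: "\<bar>s j - t j\<bar> \<le> E0 * \<rho> ^ i" by (simp add: E0_def mult.commute)
      have "\<bar>\<alpha> j - \<beta> j\<bar> \<le> \<rho> ^ (2 * i)" using D[OF i(1)] i(2) by simp
      also have "\<dots> \<le> \<rho> ^ i" using \<rho> by (intro power_decreasing) auto
      finally have 2: "\<bar>\<alpha> j - \<beta> j\<bar> \<le> \<rho> ^ i" .
      show "\<bar>\<alpha> j - \<beta> j\<bar> + \<bar>s j - t j\<bar> \<le> E * \<rho> ^ (k - Suc j)"
        using 1 2 by (simp add: E_def i_def distrib_right)
      thus "\<bar>s j - t j\<bar> \<le> E * \<rho> ^ (k - Suc j)" by linarith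
    qed
    \<comment> \<open>Far from the seam, \<open>|t j|\<close> is at most
      \<open>1/2 + \<kappa>/4\<close> by closeness to \<open>s j\<close>; near the seam, the power
      of \<open>\<kappa>\<close> in the propagated margin is bounded below.\<close>
    have tm: "\<bar>t j\<bar> \<le> 1/2 + \<beta> j / 2 - \<delta>" if j: "j < k" for j
    proof (cases "k - Suc j \<ge> I")
      case True
      have "E * \<rho> ^ (k - Suc j) \<le> E * \<rho> ^ I" using True E \<rho> by (intro mult_left_mono power_decreasing) auto
      also have "\<dots> \<le> \<kappa> / 4" using I E by (simp add: field_simps)
      finally have "\<bar>t j\<bar> \<le> 1/2 + \<kappa> / 4" using tot(2)[OF j] s[OF j] by linarith
      thus ?thesis using \<beta>b[OF j] \<delta> by linarith
    next
      case False
      have "\<kappa> * \<kappa> ^ (I + 1) \<le> \<beta> j * \<kappa> ^ (k - j)"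
        using False \<beta>b[OF j] \<kappa> by (intro mult_mono power_decreasing) auto
      hence "\<delta> \<le> \<beta> j / 2 * \<kappa> ^ (k - j)" by (simp add: \<delta>_def)
      thus ?thesis using t1[OF j] by (simp add: algebra_simps)
    qed
    have sm: "\<bar>s j\<bar> \<le> 1/2 + \<alpha> j / 2 - \<delta>" if j: "j < k" for j
      using s[OF j] \<alpha>b[OF j] \<delta> by linarith
    show "(\<forall>j<k. \<bar>t j\<bar> < 1/2 + \<beta> j / 2) \<and> (\<Sum>j<k. \<bar>ln_reciprocity_factor (s j) (\<alpha> j) - ln_reciprocity_factor (t j) (\<beta> j)\<bar>) \<le> C"
    proof
      show "(\<Sum>j<k. \<bar>ln_reciprocity_factor (s j) (\<alpha> j) - ln_reciprocity_factor (t j) (\<beta> j)\<bar>) \<le> C"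
        using \<alpha>b \<beta>b sm tm tot(1) by (intro C_le) auto
    qed (use t_strict in blast)
  qed
qed

text \<open>For a nonempty word this is the continuant of the word without its last letter; the
  value \<open>0\<close> at the empty word continues the recursion by one level.\<close>

fun truncated_cden :: "nat list \<Rightarrow> nat" where
  "truncated_cden [] = 0"
| "truncated_cden [a] = 1"
| "truncated_cden (a # b # w) = a * truncated_cden (b # w) + truncated_cden w"

text \<open>The two solutions of the continuant recursion along \<open>u\<close>, normalised at the right end.\<close>
definition continuant_A :: "nat list \<Rightarrow> nat \<Rightarrow> int" where
  "continuant_A u j = (if j \<le> length u then int (cden (drop j u)) else 0)"

definition continuant_B :: "nat list \<Rightarrow> nat \<Rightarrow> int" where
  "continuant_B u j = (if j \<le> length u then int (truncated_cden (drop j u)) else 1)"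

lemma continuant_A_rec:
  assumes "j < length u"
  shows "continuant_A u j = int (u ! j) * continuant_A u (Suc j) + continuant_A u (Suc (Suc j))"
proof -
  have d: "drop j u = u ! j # drop (Suc j) u" using assms by (simp add: Cons_nth_drop_Suc)
  show ?thesis
  proof (cases "Suc j = length u")
    case False
    hence d2: "drop (Suc j) u = u ! Suc j # drop (Suc (Suc j)) u" using assms by (simp add: Cons_nth_drop_Suc)
    show ?thesis using assms False unfolding continuant_A_def d by (simp add: d2)
  qed (use assms d in \<open>simp add: continuant_A_def\<close>)
qed

lemma continuant_B_rec:
  assumes "j < length u"
  shows "continuant_B u j = int (u ! j) * continuant_B u (Suc j) + continuant_B u (Suc (Suc j))"
proof -
  have d: "drop j u = u ! j # drop (Suc j) u" using assms by (simp add: Cons_nth_drop_Suc)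
  show ?thesis
  proof (cases "Suc j = length u")
    case False
    hence d2: "drop (Suc j) u = u ! Suc j # drop (Suc (Suc j)) u" using assms by (simp add: Cons_nth_drop_Suc)
    show ?thesis using assms False unfolding continuant_B_def d by (simp add: d2)
  qed (use assms d in \<open>simp add: continuant_B_def\<close>)
qed

lemma continuant_A_end [simp]: "continuant_A u (length u) = 1" "continuant_A u (Suc (length u)) = 0"
  by (simp_all add: continuant_A_def)

lemma continuant_B_end [simp]: "continuant_B u (length u) = 0" "continuant_B u (Suc (length u)) = 1"
  by (simp_all add: continuant_B_def)

text \<open>The two solutions have end values \<open>1, 0\<close> and \<open>0, 1\<close>, so
  \<open>x\<close> and \<open>y\<close> shift the entries at \<open>length u\<close> and
  \<open>Suc (length u)\<close> independently while all digits along \<open>u\<close>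
  persist.\<close>

lemma chain_digit_linear:
  assumes "j < length u"
  shows "chain_digit u (\<lambda>j. N j + continuant_A u j * x + continuant_B u j * y) j = chain_digit u N j"
  using continuant_A_rec[OF assms] continuant_B_rec[OF assms] by (simp add: chain_digit_def algebra_simps)

lemma chain_digit_append: "j < length u \<Longrightarrow> chain_digit (u @ v) N j = chain_digit u N j"
  by (simp add: chain_digit_def nth_append)

text \<open>Each difference of logarithms isolates the contribution of the levels of
  \<open>u\<close>. Replacing the tail \<open>v\<close> by \<open>v'\<close> with the digits along
  \<open>u\<close> retained changes this contribution by a bounded amount. The case
  \<open>v' = []\<close> serves for cutting, the case \<open>v = []\<close> for gluing. The last
  hypothesis is the margin at the seam.\<close>

lemma sudler_transfer:
  fixes A :: nat
  assumes A: "A \<ge> 1"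
  obtains C where "C \<ge> 0" "\<And>u v v' N N'.
    \<lbrakk>u \<noteq> []; set (u @ v) \<subseteq> {1..A}; set (u @ v') \<subseteq> {1..A};
     0 \<le> N \<and> N < int (cden (u @ v));
     \<And>j. j < length u \<Longrightarrow> chain_digit u N' j = chain_digit u (rounded_chain (u @ v) N) j;
     0 \<le> N' (length u); N' (length u) < int (cden v');
     \<bar>chain_residue (\<lambda>j. cval (drop j (u @ v'))) N' (length u - 1)\<bar> \<le> 1/2 + cval (drop (length u - 1) (u @ v')) / 2 * (1 - 1 / (real A + 1))\<rbrakk> \<Longrightarrow>
    0 \<le> N' 0 \<and> N' 0 < int (cden (u @ v')) \<and>
    \<bar>(ln (sudler (nat N) (cval (u @ v))) - ln (sudler (nat (rounded_chain (u @ v) N (length u))) (cval v))) -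
     (ln (sudler (nat (N' 0)) (cval (u @ v'))) - ln (sudler (nat (N' (length u))) (cval v')))\<bar> \<le> C"
proof -
  obtain C where C: "C \<ge> 0" and C_le: "\<And>k (s :: nat \<Rightarrow> real) t \<alpha> \<beta> a d.
    \<lbrakk>\<And>j. j < k \<Longrightarrow> \<alpha> j = 1 / (a j + \<alpha> (Suc j)) \<and> \<beta> j = 1 / (a j + \<beta> (Suc j)) \<and> 1 \<le> a j \<and> a j \<le> real A;
     0 \<le> \<alpha> k; \<alpha> k \<le> 1; 0 \<le> \<beta> k; \<beta> k \<le> 1;
     \<And>j. j < k \<Longrightarrow> s j = - \<alpha> j * (s (Suc j) + d j) \<and> t j = - \<beta> j * (t (Suc j) + d j) \<and> \<bar>d j\<bar> \<le> a j / 2;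
     \<And>j. j < k \<Longrightarrow> \<bar>s j\<bar> \<le> 1/2;
     0 < k \<Longrightarrow> \<bar>t (k - 1)\<bar> \<le> 1/2 + \<beta> (k - 1) / 2 * (1 - 1 / (real A + 1))\<rbrakk> \<Longrightarrow>
     (\<forall>j<k. \<bar>t j\<bar> < 1/2 + \<beta> j / 2) \<and>
     (\<Sum>j<k. \<bar>ln_reciprocity_factor (s j) (\<alpha> j) - ln_reciprocity_factor (t j) (\<beta> j)\<bar>) \<le> C"
  proof -
    have "real A \<ge> 1" using A by simp
    thus ?thesis using bounded_distortion[of "real A"] that by blast
  qed
  show ?thesis
  proof (rule that[OF C])
    fix u v v' :: "nat list" and N :: int and N' :: "nat \<Rightarrow> int"
    assume u: "u \<noteq> []" and uv: "set (u @ v) \<subseteq> {1..A}" and uv': "set (u @ v') \<subseteq> {1..A}"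
      and N: "0 \<le> N \<and> N < int (cden (u @ v))"
      and chain_digit: "\<And>j. j < length u \<Longrightarrow> chain_digit u N' j = chain_digit u (rounded_chain (u @ v) N) j"
      and N'k: "0 \<le> N' (length u)" "N' (length u) < int (cden v')"
      and last: "\<bar>chain_residue (\<lambda>j. cval (drop j (u @ v'))) N' (length u - 1)\<bar> \<le> 1/2 + cval (drop (length u - 1) (u @ v')) / 2 * (1 - 1 / (real A + 1))"
    define k where "k = length u"
    define \<alpha> where "\<alpha> = (\<lambda>j. cval (drop j (u @ v)))"
    define \<beta> where "\<beta> = (\<lambda>j. cval (drop j (u @ v')))"
    define s where "s = chain_residue \<alpha> (rounded_chain (u @ v) N)"
    define t where "t = chain_residue \<beta> N'"
    have len: "j < length (u @ v)" "j < length (u @ v')" "(u @ v) ! j = u ! j" "(u @ v') ! j = u ! j" if "j < k" for j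
      using that by (auto simp: k_def nth_append)
    have vv: "set v \<subseteq> {1..A}" "set v' \<subseteq> {1..A}" using uv uv' by auto
    have main: "(\<forall>j<k. \<bar>t j\<bar> < 1/2 + \<beta> j / 2) \<and> (\<Sum>j<k. \<bar>ln_reciprocity_factor (s j) (\<alpha> j) - ln_reciprocity_factor (t j) (\<beta> j)\<bar>) \<le> C"
    proof (rule C_le)
      fix j assume j: "j < k"
      note l = len[OF j]
      show "\<alpha> j = 1 / (real (u ! j) + \<alpha> (Suc j)) \<and> \<beta> j = 1 / (real (u ! j) + \<beta> (Suc j)) \<and> 1 \<le> real (u ! j) \<and> real (u ! j) \<le> real A"
        using cval_drop(1-3)[OF uv l(1)] cval_drop(1)[OF uv' l(2)] unfolding \<alpha>_def \<beta>_def l by auto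
      define c where "c = chain_digit u N' j"
      have c: "chain_digit (u @ v) (rounded_chain (u @ v) N) j = c" "chain_digit (u @ v') N' j = c"
        using j chain_digit by (auto simp: c_def chain_digit_append k_def)
      have cb: "0 \<le> c" "c \<le> int (u ! j)" using rounded_chain_chain_digit[OF uv l(1), of N] c l(3) by auto
      have "s j = - \<alpha> j * (s (Suc j) + (real (u ! j) / 2 - of_int c))"
        unfolding s_def \<alpha>_def using chain_residue_chain_digit[OF uv l(1) c(1) refl] l(3) by simp
      moreover have "t j = - \<beta> j * (t (Suc j) + (real (u ! j) / 2 - of_int c))"
        unfolding t_def \<beta>_def using chain_residue_chain_digit[OF uv' l(2) c(2) refl] l(4) by simp
      moreover have "\<bar>real (u ! j) / 2 - of_int c\<bar> \<le> real (u ! j) / 2"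
      proof -
        have "0 \<le> real_of_int c" "real_of_int c \<le> real (u ! j)" using cb by linarith+
        thus ?thesis by linarith
      qed
      ultimately show "s j = - \<alpha> j * (s (Suc j) + (real (u ! j) / 2 - of_int (chain_digit u N' j))) \<and>
          t j = - \<beta> j * (t (Suc j) + (real (u ! j) / 2 - of_int (chain_digit u N' j))) \<and>
          \<bar>real (u ! j) / 2 - of_int (chain_digit u N' j)\<bar> \<le> real (u ! j) / 2" unfolding c_def by blast
      show "\<bar>s j\<bar> \<le> 1/2" unfolding s_def \<alpha>_def by (rule rounded_chain_chain_residue)
    next
      show "\<bar>t (k - 1)\<bar> \<le> 1/2 + \<beta> (k - 1) / 2 * (1 - 1 / (real A + 1))"
        using last unfolding t_def \<beta>_def k_def .
    qed (use vv cval_bounds[of v A] cval_bounds[of v' A] in \<open>auto simp: \<alpha>_def \<beta>_def k_def\<close>)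
    have rng: "0 \<le> N' j \<and> N' j < int (cden (drop j (u @ v')))" if "j \<le> k" for j
    proof (rule chain_range[where \<alpha> = \<beta>, OF _ _ _ _ _ that])
      fix j assume j: "j < k"
      show "0 < \<beta> j" "real (cden (drop j (u @ v'))) * \<beta> j = real (cden (drop (Suc j) (u @ v')))"
        unfolding \<beta>_def using cval_drop[OF uv' len(2)[OF j]] by blast+
      show "\<bar>chain_residue \<beta> N' j\<bar> < 1/2 + \<beta> j / 2" using main j unfolding t_def by blast
    qed (use N'k in \<open>auto simp: k_def\<close>)
    have r0: "0 \<le> N' 0 \<and> N' 0 < int (cden (u @ v'))" using rng[of 0] by simp
    have crng: "0 \<le> rounded_chain (u @ v) N j \<and> rounded_chain (u @ v) N j < int (cden (drop j (u @ v)))" if "j \<le> k" for j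
      using rounded_chain_range[OF uv, of N j] N that by (auto simp: k_def)
    have "sudler (nat (rounded_chain (u @ v) N 0)) (cval (u @ v)) = sudler (nat (rounded_chain (u @ v) N k)) (cval (drop k (u @ v))) *
        exp (\<Sum>j<k. ln_reciprocity_factor (s j) (\<alpha> j))"
      unfolding s_def \<alpha>_def
    proof (rule sudler_chain[OF uv])
      fix j assume j: "j < k"
      show "\<bar>chain_residue (\<lambda>j. cval (drop j (u @ v))) (rounded_chain (u @ v) N) j\<bar> < 1/2 + cval (drop j (u @ v)) / 2"
        using rounded_chain_chain_residue[of "u @ v" N j] cval_drop(5)[OF uv len(1)[OF j]] by linarith
    qed (use crng in \<open>auto simp: k_def\<close>)
    hence e1: "sudler (nat N) (cval (u @ v)) = sudler (nat (rounded_chain (u @ v) N k)) (cval v) * exp (\<Sum>j<k. ln_reciprocity_factor (s j) (\<alpha> j))"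
      by (simp add: k_def)
    have "sudler (nat (N' 0)) (cval (u @ v')) = sudler (nat (N' k)) (cval (drop k (u @ v'))) *
        exp (\<Sum>j<k. ln_reciprocity_factor (t j) (\<beta> j))"
      unfolding t_def \<beta>_def
    proof (rule sudler_chain[OF uv'])
      fix j assume j: "j < k"
      show "\<bar>chain_residue (\<lambda>j. cval (drop j (u @ v'))) N' j\<bar> < 1/2 + cval (drop j (u @ v')) / 2"
        using main j unfolding t_def \<beta>_def by blast
    qed (use rng in \<open>auto simp: k_def\<close>)
    hence e2: "sudler (nat (N' 0)) (cval (u @ v')) = sudler (nat (N' k)) (cval v') * exp (\<Sum>j<k. ln_reciprocity_factor (t j) (\<beta> j))"
      by (simp add: k_def)
    have p1: "sudler (nat (rounded_chain (u @ v) N k)) (cval v) > 0"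
      using crng[of k] vv by (intro sudler_pos[of _ A]) (auto simp: k_def)
    have p2: "sudler (nat (N' k)) (cval v') > 0"
      using N'k vv by (intro sudler_pos[of _ A]) (auto simp: k_def)
    have "\<bar>(\<Sum>j<k. ln_reciprocity_factor (s j) (\<alpha> j)) - (\<Sum>j<k. ln_reciprocity_factor (t j) (\<beta> j))\<bar> \<le> (\<Sum>j<k. \<bar>ln_reciprocity_factor (s j) (\<alpha> j) - ln_reciprocity_factor (t j) (\<beta> j)\<bar>)"
      unfolding sum_subtractf[symmetric] by (rule sum_abs)
    also have "\<dots> \<le> C" using main by blast
    finally show "0 \<le> N' 0 \<and> N' 0 < int (cden (u @ v')) \<and>
      \<bar>(ln (sudler (nat N) (cval (u @ v))) - ln (sudler (nat (rounded_chain (u @ v) N (length u))) (cval v))) -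
       (ln (sudler (nat (N' 0)) (cval (u @ v'))) - ln (sudler (nat (N' (length u))) (cval v')))\<bar> \<le> C"
      using r0 p1 p2 unfolding e1 e2 k_def[symmetric] by (simp add: ln_mult_pos)
  qed
qed

section \<open>Splitting and joining words\<close>

definition sudler_word :: "nat list \<Rightarrow> nat \<Rightarrow> real" where
  "sudler_word w N = sudler N (cval w)"

lemma sudler_word_pos: "set w \<subseteq> {1..A} \<Longrightarrow> N < cden w \<Longrightarrow> sudler_word w N > 0"
  unfolding sudler_word_def by (rule sudler_pos)

text \<open>The chain of \<open>u @ v\<close> is shifted by continuants so that it ends in
  \<open>0\<close> after \<open>u\<close>, which produces an index for \<open>u\<close> alone; the
  old entry at the seam is the index for \<open>v\<close>. Injectivity lets the pointwise bound be
  summed.\<close>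

lemma sudler_word_split:
  fixes A :: nat
  assumes A: "A \<ge> 1"
  obtains C where "C \<ge> 0" "\<And>u v. \<lbrakk>u \<noteq> []; set u \<subseteq> {1..A}; set v \<subseteq> {1..A}\<rbrakk> \<Longrightarrow>
    \<exists>f :: nat \<Rightarrow> (nat \<times> nat) \<times> bool. inj_on f {..<cden (u @ v)} \<and>
      (\<forall>N<cden (u @ v). fst (fst (f N)) < cden u \<and> snd (fst (f N)) < cden v \<and>
         ln (sudler_word (u @ v) N) \<le> C + ln (sudler_word u (fst (fst (f N)))) + ln (sudler_word v (snd (fst (f N)))))"
proof -
  obtain C where C: "C \<ge> 0" and C_le: "\<And>u v v' N N'.
    \<lbrakk>u \<noteq> []; set (u @ v) \<subseteq> {1..A}; set (u @ v') \<subseteq> {1..A};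
     0 \<le> N \<and> N < int (cden (u @ v));
     \<And>j. j < length u \<Longrightarrow> chain_digit u N' j = chain_digit u (rounded_chain (u @ v) N) j;
     0 \<le> N' (length u); N' (length u) < int (cden v');
     \<bar>chain_residue (\<lambda>j. cval (drop j (u @ v'))) N' (length u - 1)\<bar> \<le> 1/2 + cval (drop (length u - 1) (u @ v')) / 2 * (1 - 1 / (real A + 1))\<rbrakk> \<Longrightarrow>
    0 \<le> N' 0 \<and> N' 0 < int (cden (u @ v')) \<and>
    \<bar>(ln (sudler (nat N) (cval (u @ v))) - ln (sudler (nat (rounded_chain (u @ v) N (length u))) (cval v))) -
     (ln (sudler (nat (N' 0)) (cval (u @ v'))) - ln (sudler (nat (N' (length u))) (cval v')))\<bar> \<le> C"
    using sudler_transfer[OF A] by blast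
  show ?thesis
  proof (rule that[OF C])
    fix u v :: "nat list"
    assume u: "u \<noteq> []" "set u \<subseteq> {1..A}" and v: "set v \<subseteq> {1..A}"
    define k where "k = length u"
    have k: "0 < k" "k - 1 < length u" "Suc (k - 1) = k" using u by (auto simp: k_def)
    have uv: "set (u @ v) \<subseteq> {1..A}" using u v by simp
    define c where "c N = rounded_chain (u @ v) (int N)" for N :: nat
    \<comment> \<open>If the last digit takes its maximal value and the shifted chain continued with
      \<open>0\<close>, the last residue would be \<open>1/2 + 1 / (2 * a)\<close>, exactly on the
      singular boundary of the strip. Continuing with \<open>-1\<close> in this case brings it back
      to at most \<open>1/2\<close> in absolute value.\<close>
    define b where "b N = (if chain_digit u (c N) (k - 1) = int (u ! (k - 1)) then 1 else 0 :: int)" for N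
    define N' where "N' N = (\<lambda>j. c N j + continuant_A u j * (- c N k) + continuant_B u j * (- (c N (Suc k) + b N)))" for N
    define f where "f N = ((nat (N' N 0), nat (c N k)), b N = 1)" for N
    have c_rng: "0 \<le> c N k \<and> c N k < int (cden v)" if "N < cden (u @ v)" for N
      using rounded_chain_range[OF uv, of "int N" k] that by (simp add: c_def k_def)
    have main: "0 \<le> N' N 0 \<and> N' N 0 < int (cden u) \<and>
        ln (sudler_word (u @ v) N) \<le> C + ln (sudler_word u (nat (N' N 0))) + ln (sudler_word v (nat (c N k)))"
      if N: "N < cden (u @ v)" for N
    proof -
      have e1: "N' N k = 0" "N' N (Suc k) = - b N" by (simp_all add: N'_def k_def)
      have d: "chain_digit u (N' N) j = chain_digit u (c N) j" if "j < length u" for j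
        unfolding N'_def by (rule chain_digit_linear[OF that])
      define a where "a = real (u ! (k - 1))"
      define y where "y = chain_digit u (c N) (k - 1)"
      have l: "k - 1 < length (u @ v)" using k by simp
      have y: "0 \<le> y" "y \<le> int (u ! (k - 1))"
        using rounded_chain_chain_digit[OF uv l, of "int N"] k(2) by (simp_all add: y_def c_def chain_digit_append nth_append)
      define R where "R = chain_residue (\<lambda>j. cval (drop j u)) (N' N)"
      have "R (k - 1) = - cval (drop (k - 1) u) * (R k + (a / 2 - of_int y))"
        unfolding R_def a_def using chain_residue_chain_digit[OF u(2) k(2), of u "N' N" y] d[OF k(2)] k(3) by (simp add: y_def)
      moreover have cv: "cval (drop (k - 1) u) = 1 / a"
        using cval_drop(1)[OF u(2) k(2)] unfolding k(3) by (simp add: a_def k_def)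
      moreover have "R k = of_int (b N) - 1/2" unfolding R_def chain_residue_def e1 by (simp add: k_def)
      ultimately have R: "R (k - 1) = - (1 / a) * (of_int (b N) - 1/2 + (a / 2 - of_int y))" by simp
      have a1: "a \<ge> 1" using cval_drop(2)[OF u(2) k(2)] by (simp add: a_def)
      have "\<bar>of_int (b N) - 1/2 + (a / 2 - of_int y)\<bar> \<le> a / 2"
      proof (cases "y = int (u ! (k - 1))")
        case True
        thus ?thesis using a1 by (simp add: b_def y_def a_def)
      next
        case False
        hence "0 \<le> real_of_int y" "real_of_int y \<le> a - 1" using y unfolding a_def by linarith+
        moreover have "b N = 0" using False by (simp add: b_def y_def)
        ultimately show ?thesis by (simp only: of_int_0)
      qed
      hence "\<bar>R (k - 1)\<bar> \<le> (1 / a) * (a / 2)"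
        unfolding R using a1 by (simp add: abs_mult divide_right_mono)
      also have "\<dots> = 1/2" using a1 by simp
      also have "\<dots> \<le> 1/2 + cval (drop (k - 1) u) / 2 * (1 - 1 / (real A + 1))"
        unfolding cv using a1 by (simp add: divide_le_eq)
      finally have last: "\<bar>R (k - 1)\<bar> \<le> \<dots>" .
      have cl: "0 \<le> N' N 0 \<and> N' N 0 < int (cden (u @ [])) \<and>
    \<bar>(ln (sudler (nat (int N)) (cval (u @ v))) - ln (sudler (nat (rounded_chain (u @ v) (int N) (length u))) (cval v))) -
     (ln (sudler (nat (N' N 0)) (cval (u @ []))) - ln (sudler (nat (N' N (length u))) (cval [])))\<bar> \<le> C"
        by (rule C_le) (use u uv N d last e1(1) in \<open>auto simp: c_def R_def k_def\<close>)
      moreover have "N' N (length u) = 0" using e1(1) by (simp add: k_def)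
      ultimately show ?thesis unfolding sudler_word_def c_def k_def by (simp, linarith)
    qed
    have "inj_on f {..<cden (u @ v)}"
    proof (rule inj_onI)
      fix M N assume MN: "M \<in> {..<cden (u @ v)}" "N \<in> {..<cden (u @ v)}" "f M = f N"
      have nn: "0 \<le> N' M 0" "0 \<le> N' N 0" "0 \<le> c M k" "0 \<le> c N k"
        using MN main[of M] main[of N] c_rng[of M] c_rng[of N] by auto
      have "b M = 1 \<longleftrightarrow> b N = 1" using MN by (simp add: f_def)
      hence "b M = b N" by (auto simp: b_def split: if_splits)
      moreover have "N' M 0 = N' N 0" "c M k = c N k"
        using MN nn by (auto simp: f_def eq_nat_nat_iff)
      ultimately have e: "N' M 0 = N' N 0" "c M k = c N k" "b M = b N" by auto
      \<comment> \<open>The entry after the seam is the rounding of the entry at the seam, so the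
        two indices and the bit determine the whole shift, hence the original index.\<close>
      have "c M (Suc k) = c N (Suc k)" using e(2) by (simp add: c_def)
      hence "c M 0 = c N 0" using e unfolding N'_def by simp
      thus "M = N" by (simp add: c_def)
    qed
    moreover have "\<forall>N<cden (u @ v). fst (fst (f N)) < cden u \<and> snd (fst (f N)) < cden v \<and>
         ln (sudler_word (u @ v) N) \<le> C + ln (sudler_word u (fst (fst (f N)))) + ln (sudler_word v (snd (fst (f N))))"
      using main c_rng unfolding f_def by (auto simp: nat_less_iff)
    ultimately show "\<exists>f :: nat \<Rightarrow> (nat \<times> nat) \<times> bool. inj_on f {..<cden (u @ v)} \<and>
      (\<forall>N<cden (u @ v). fst (fst (f N)) < cden u \<and> snd (fst (f N)) < cden v \<and>
         ln (sudler_word (u @ v) N) \<le> C + ln (sudler_word u (fst (fst (f N)))) + ln (sudler_word v (snd (fst (f N)))))" by blast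
  qed
qed

text \<open>The rounded chain of \<open>u\<close>, which ends in \<open>0, 0\<close>, receives the
  end values \<open>M\<close> and the rounded successor of \<open>M\<close> along \<open>v\<close>,
  so that the glued chain continues in \<open>v\<close> as a rounded one.\<close>

lemma sudler_word_join:
  fixes A :: nat
  assumes A: "A \<ge> 1"
  obtains C where "C \<ge> 0" "\<And>u v. \<lbrakk>u \<noteq> []; v \<noteq> []; set u \<subseteq> {1..A}; set v \<subseteq> {1..A}\<rbrakk> \<Longrightarrow>
    \<exists>g :: nat \<times> nat \<Rightarrow> nat. inj_on g ({..<cden u} \<times> {..<cden v}) \<and>
      (\<forall>N<cden u. \<forall>M<cden v. g (N, M) < cden (u @ v) \<and>
         ln (sudler_word u N) + ln (sudler_word v M) \<le> C + ln (sudler_word (u @ v) (g (N, M))))"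
proof -
  obtain C where C: "C \<ge> 0" and C_le: "\<And>u v v' N N'.
    \<lbrakk>u \<noteq> []; set (u @ v) \<subseteq> {1..A}; set (u @ v') \<subseteq> {1..A};
     0 \<le> N \<and> N < int (cden (u @ v));
     \<And>j. j < length u \<Longrightarrow> chain_digit u N' j = chain_digit u (rounded_chain (u @ v) N) j;
     0 \<le> N' (length u); N' (length u) < int (cden v');
     \<bar>chain_residue (\<lambda>j. cval (drop j (u @ v'))) N' (length u - 1)\<bar> \<le> 1/2 + cval (drop (length u - 1) (u @ v')) / 2 * (1 - 1 / (real A + 1))\<rbrakk> \<Longrightarrow>
    0 \<le> N' 0 \<and> N' 0 < int (cden (u @ v')) \<and>
    \<bar>(ln (sudler (nat N) (cval (u @ v))) - ln (sudler (nat (rounded_chain (u @ v) N (length u))) (cval v))) -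
     (ln (sudler (nat (N' 0)) (cval (u @ v'))) - ln (sudler (nat (N' (length u))) (cval v')))\<bar> \<le> C"
    using sudler_transfer[OF A] by blast
  show ?thesis
  proof (rule that[OF C])
    fix u v :: "nat list"
    assume u: "u \<noteq> []" "set u \<subseteq> {1..A}" and v: "v \<noteq> []" "set v \<subseteq> {1..A}"
    define k where "k = length u"
    have k: "0 < k" "k - 1 < length u" "Suc (k - 1) = k" using u by (auto simp: k_def)
    have uv: "set (u @ v) \<subseteq> {1..A}" using u v by simp
    define q where "q M = \<lfloor>(real M + 1/2) * cval v\<rfloor>" for M :: nat
    define N' where "N' N M = (\<lambda>j. rounded_chain u (int N) j + continuant_A u j * int M + continuant_B u j * q M)" for N M :: nat
    have main: "0 \<le> N' N M 0 \<and> N' N M 0 < int (cden (u @ v)) \<and>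
        ln (sudler_word u N) + ln (sudler_word v M) \<le> C + ln (sudler_word (u @ v) (nat (N' N M 0)))"
      if N: "N < cden u" and M: "M < cden v" for N M
    proof -
      have cl: "rounded_chain u (int N) k = 0" "rounded_chain u (int N) (Suc k) = 0"
        using rounded_chain_length[OF u(2), of "int N"] N unfolding k_def by simp_all
      have e1: "N' N M k = int M" "N' N M (Suc k) = q M"
        unfolding N'_def cl by (simp_all add: k_def)
      have d: "chain_digit u (N' N M) j = chain_digit u (rounded_chain u (int N)) j" if "j < length u" for j
        unfolding N'_def by (rule chain_digit_linear[OF that])
      define a where "a = real (u ! (k - 1))"
      define y where "y = chain_digit u (rounded_chain u (int N)) (k - 1)"
      have l: "k - 1 < length (u @ v)" using k by simp
      have y: "0 \<le> y" "y \<le> int (u ! (k - 1))"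
        using rounded_chain_chain_digit[OF u(2) k(2), of "int N"] by (simp_all add: y_def)
      define R where "R = chain_residue (\<lambda>j. cval (drop j (u @ v))) (N' N M)"
      define \<beta> where "\<beta> = cval (drop (k - 1) (u @ v))"
      have "R (k - 1) = - \<beta> * (R k + (real ((u @ v) ! (k - 1)) / 2 - of_int y))"
        unfolding R_def \<beta>_def using chain_residue_chain_digit[OF uv l, of "u @ v" "N' N M" y] d[OF k(2)] k by (simp add: y_def chain_digit_append)
      hence R: "R (k - 1) = - \<beta> * (R k + (a / 2 - of_int y))" using k by (simp add: a_def nth_append)
      define x where "x = (real M + 1/2) * cval v"
      have "R k = x - of_int \<lfloor>x\<rfloor> - 1/2"
        unfolding R_def chain_residue_def e1 q_def x_def by (simp add: k_def)
      hence Rk: "\<bar>R k\<bar> \<le> 1/2" using floor_correct[of x] by linarith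
      have cd: "\<beta> = 1 / (a + cval v)" "\<beta> > 0"
        using cval_drop[OF uv l] k unfolding k(3) \<beta>_def by (simp_all add: a_def nth_append k_def)
      have a1: "a \<ge> 1" using cval_drop(2)[OF u(2) k(2)] by (simp add: a_def)
      have vb: "1 / (real A + 1) \<le> cval v" "0 < cval v"
        using cval_drop(4,5)[OF v(2), of 0] v(1) by simp_all
      have "0 \<le> real_of_int y" "real_of_int y \<le> a" using y unfolding a_def by linarith+
      hence "\<bar>R k + (a / 2 - of_int y)\<bar> \<le> 1/2 + a/2" using Rk by linarith
      hence "\<bar>R (k - 1)\<bar> \<le> \<beta> * (1/2 + a/2)"
        unfolding R using cd(2) by (simp add: abs_mult)
      also have "\<dots> = \<beta> * (a + cval v) / 2 + \<beta> / 2 * (1 - cval v)" by (simp add: field_simps)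
      also have "\<beta> * (a + cval v) = 1" using cd(1) a1 vb by simp
      \<comment> \<open>The distance to the boundary of the strip is
        \<open>\<beta> / 2 * cval v\<close>, and a nonempty \<open>v\<close> has value at least
        \<open>1 / (A + 1)\<close>. This is the origin of the factor \<open>1 - 1 / (A + 1)\<close>
        in the seam condition.\<close>
      also have "1 / 2 + \<beta> / 2 * (1 - cval v) \<le> 1/2 + \<beta> / 2 * (1 - 1 / (real A + 1))"
        using vb cd(2) by (intro add_left_mono mult_left_mono) auto
      finally have last: "\<bar>R (k - 1)\<bar> \<le> \<dots>" .
      have "0 \<le> N' N M 0 \<and> N' N M 0 < int (cden (u @ v)) \<and>
    \<bar>(ln (sudler (nat (int N)) (cval (u @ []))) - ln (sudler (nat (rounded_chain (u @ []) (int N) (length u))) (cval []))) -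
     (ln (sudler (nat (N' N M 0)) (cval (u @ v))) - ln (sudler (nat (N' N M (length u))) (cval v)))\<bar> \<le> C"
        by (rule C_le) (use u uv N M d last e1(1) in \<open>auto simp: R_def k_def \<beta>_def\<close>)
      moreover have "N' N M (length u) = int M" "rounded_chain u (int N) (length u) = 0" using e1(1) cl by (simp_all add: k_def)
      ultimately show ?thesis unfolding sudler_word_def by (simp, linarith)
    qed
    define g where "g = (\<lambda>(N, M). nat (N' N M 0))"
    have N'0: "N' N M 0 = int N + (int (cden u) * int M + int (truncated_cden u) * q M)" for N M
      by (simp add: N'_def continuant_A_def continuant_B_def)
    have q_mono: "q M \<le> q M'" if "M \<le> M'" for M M'
      unfolding q_def using that v cval_bounds[of v A] by (intro floor_mono mult_right_mono) auto
    \<comment> \<open>The glued index is \<open>N + cden u * M + truncated_cden u * q M\<close> with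
      \<open>N < cden u\<close> and \<open>q\<close> nondecreasing, so glued indices are ordered by
      \<open>M\<close> first.\<close>
    have lt: "N' N1 M1 0 < N' N2 M2 0" if "N1 < cden u" "M1 < M2" for N1 N2 M1 M2
    proof -
      have "int (cden u) * (int M1 + 1) \<le> int (cden u) * int M2" using that by (intro mult_left_mono) auto
      moreover have "int (truncated_cden u) * q M1 \<le> int (truncated_cden u) * q M2" using q_mono[of M1 M2] that by (intro mult_left_mono) auto
      ultimately show ?thesis using that(1) unfolding N'0 by (simp add: algebra_simps)
    qed
    have "inj_on g ({..<cden u} \<times> {..<cden v})"
    proof (rule inj_onI, clarify)
      fix N1 M1 N2 M2 assume a: "N1 < cden u" "M1 < cden v" "N2 < cden u" "M2 < cden v" "g (N1, M1) = g (N2, M2)"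
      hence e: "N' N1 M1 0 = N' N2 M2 0" using main[of N1 M1] main[of N2 M2] by (simp add: g_def eq_nat_nat_iff)
      have "M1 = M2" using lt[of N1 M1 M2 N2] lt[of N2 M2 M1 N1] e a by (cases M1 M2 rule: linorder_cases) auto
      thus "N1 = N2 \<and> M1 = M2" using e unfolding N'0 by simp
    qed
    moreover have "\<forall>N<cden u. \<forall>M<cden v. g (N, M) < cden (u @ v) \<and>
         ln (sudler_word u N) + ln (sudler_word v M) \<le> C + ln (sudler_word (u @ v) (g (N, M)))"
      using main by (auto simp: g_def nat_less_iff)
    ultimately show "\<exists>g :: nat \<times> nat \<Rightarrow> nat. inj_on g ({..<cden u} \<times> {..<cden v}) \<and>
      (\<forall>N<cden u. \<forall>M<cden v. g (N, M) < cden (u @ v) \<and>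
         ln (sudler_word u N) + ln (sudler_word v M) \<le> C + ln (sudler_word (u @ v) (g (N, M))))" by blast
  qed
qed

section \<open>Almost additivity\<close>

text \<open>The claim compares the double sine at \<open>\<alpha>\<close> and at \<open>1\<close>.
  Both points are one period away from its zero, so the quotient is the limit of
  \<open>sin (pi * x / \<alpha>) / sin (pi * x)\<close> as \<open>x\<close> tends to
  \<open>0\<close>.\<close>

lemma ln_reciprocity_factor_top:
  assumes \<alpha>: "0 < \<alpha>" "\<alpha> \<le> 1"
  shows "ln_reciprocity_factor ((1 - \<alpha>) / 2) \<alpha> = - ln \<alpha>"
proof -
  obtain C where C: "C \<ge> 0" and C_le: "\<And>L s t \<beta> \<gamma>. \<lbrakk>1 \<le> L; 2 / \<alpha> \<le> real L; \<alpha> \<le> \<beta>; \<beta> \<le> 1; \<alpha> \<le> \<gamma>; \<gamma> \<le> 1;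
      \<bar>s\<bar> \<le> 1/2 + \<beta>/2 - \<alpha>/4; \<bar>t\<bar> \<le> 1/2 + \<gamma>/2 - \<alpha>/4\<rbrakk> \<Longrightarrow>
      \<bar>ln_reciprocity_factor s \<beta> - ln_reciprocity_factor t \<gamma>\<bar> \<le> C * (1 / real L + real L ^ 3 * (\<bar>\<beta> - \<gamma>\<bar> + \<bar>s - t\<bar>))"
    using ln_reciprocity_factor_modulus[of \<alpha> "\<alpha>/4"] \<alpha> by auto
  \<comment> \<open>At truncation level \<open>n + 1\<close> the modulus of continuity is of order
    \<open>1 / (n + 1) + (n + 1)^3 * x n\<close>, and the fourth power makes it tend to
    zero.\<close>
  define x where "x n = inverse (real (Suc n)) ^ 4" for n
  have x0: "x \<longlonglongrightarrow> 0" unfolding x_def by real_asymp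
  have xpos: "x n > 0" for n by (simp add: x_def)
  have lim: "(\<lambda>n. ln_reciprocity_factor (x n + s) \<alpha>) \<longlonglongrightarrow> ln_reciprocity_factor s \<alpha>" if s: "\<bar>s\<bar> \<le> 1/2" for s
  proof (rule LIM_zero_cancel, rule Lim_null_comparison)
    show "(\<lambda>n. C * (1 / real (Suc n) + real (Suc n) ^ 3 * x n)) \<longlonglongrightarrow> 0"
      unfolding x_def by real_asymp
    obtain n0 :: nat where n0: "2 / \<alpha> \<le> real n0" using real_arch_simple by blast
    have "\<forall>\<^sub>F n in sequentially. x n < \<alpha> / 4"
      using x0 \<alpha> by (intro order_tendstoD) auto
    thus "\<forall>\<^sub>F n in sequentially. norm (ln_reciprocity_factor (x n + s) \<alpha> - ln_reciprocity_factor s \<alpha>) \<le> C * (1 / real (Suc n) + real (Suc n) ^ 3 * x n)"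
      using eventually_ge_at_top[of n0]
    proof eventually_elim
      case (elim n)
      have "\<bar>ln_reciprocity_factor (x n + s) \<alpha> - ln_reciprocity_factor s \<alpha>\<bar> \<le> C * (1 / real (Suc n) + real (Suc n) ^ 3 * (\<bar>\<alpha> - \<alpha>\<bar> + \<bar>x n + s - s\<bar>))"
        using n0 elim s \<alpha> xpos[of n] by (intro C_le) auto
      thus ?case using xpos[of n] by simp
    qed
  qed
  have "(\<lambda>n. ln_reciprocity_factor (x n + (1 - \<alpha>) / 2) \<alpha> - ln_reciprocity_factor (x n + (\<alpha> - 1) / 2) \<alpha>) \<longlonglongrightarrow> ln_reciprocity_factor ((1 - \<alpha>) / 2) \<alpha> - ln_reciprocity_factor ((\<alpha> - 1) / 2) \<alpha>"
    using \<alpha> by (intro tendsto_intros lim) auto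
  moreover have "(\<lambda>n. ln_reciprocity_factor (x n + (1 - \<alpha>) / 2) \<alpha> - ln_reciprocity_factor (x n + (\<alpha> - 1) / 2) \<alpha>) \<longlonglongrightarrow> - ln \<alpha>"
  proof (rule Lim_transform_eventually)
    have "(\<lambda>n. ln (sin (pi / \<alpha> * x n) / sin (pi * x n))) \<longlonglongrightarrow> ln (1 / \<alpha>)"
    proof (rule tendsto_ln)
      have "((\<lambda>x. sin (pi / \<alpha> * x) / sin (pi * x)) \<longlongrightarrow> 1 / \<alpha>) (at_right 0)"
        using \<alpha> by real_asymp
      moreover have "filterlim x (at_right 0) sequentially"
        using x0 xpos less_imp_neq[OF xpos] by (auto simp: filterlim_at eventually_sequentially)
      ultimately show "(\<lambda>n. sin (pi / \<alpha> * x n) / sin (pi * x n)) \<longlonglongrightarrow> 1 / \<alpha>"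
        by (rule filterlim_compose)
    qed (use \<alpha> in auto)
    thus "(\<lambda>n. ln (sin (pi / \<alpha> * x n) / sin (pi * x n))) \<longlonglongrightarrow> - ln \<alpha>"
      using \<alpha> by (simp add: ln_div)
    have "\<forall>\<^sub>F n in sequentially. x n < \<alpha>"
      using x0 \<alpha> by (intro order_tendstoD) auto
    thus "\<forall>\<^sub>F n in sequentially. ln (sin (pi / \<alpha> * x n) / sin (pi * x n)) = ln_reciprocity_factor (x n + (1 - \<alpha>) / 2) \<alpha> - ln_reciprocity_factor (x n + (\<alpha> - 1) / 2) \<alpha>"
    proof eventually_elim
      case (elim n)
      define u where "u = x n / \<alpha>"
      have u: "0 < u" "u < 1" using elim xpos[of n] \<alpha> by (auto simp: u_def)
      have "x n < 1" using elim \<alpha> by simp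
      hence s1: "sin (pi * x n) > 0" using xpos[of n] by (intro sin_gt_zero) auto
      have s2: "sin (pi * u) > 0" using u by (intro sin_gt_zero) auto
      have "ln_double_sine (x n - (1 + \<alpha>) / 2 + \<alpha>) \<alpha> = ln_double_sine (x n - (1 + \<alpha>) / 2) \<alpha> - ln (2 * sin (pi * x n))"
        by (rule ln_double_sine_shift_alpha[OF \<alpha> xpos \<open>x n < 1\<close>])
      moreover have "ln_double_sine (x n - (1 + \<alpha>) / 2 + 1) \<alpha> = ln_double_sine (x n - (1 + \<alpha>) / 2) \<alpha> - ln (2 * sin (pi * u))"
        unfolding u_def by (rule ln_double_sine_shift_one[OF \<alpha> xpos elim])
      moreover have "x n - (1 + \<alpha>) / 2 + \<alpha> = x n + (\<alpha> - 1) / 2" "x n - (1 + \<alpha>) / 2 + 1 = x n + (1 - \<alpha>) / 2"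
        by (simp_all add: field_simps)
      moreover have "pi / \<alpha> * x n = pi * u" by (simp add: u_def)
      ultimately show ?case using s1 s2 by (simp add: ln_reciprocity_factor_def ln_div ln_mult_pos)
    qed
  qed
  ultimately have "ln_reciprocity_factor ((1 - \<alpha>) / 2) \<alpha> - ln_reciprocity_factor ((\<alpha> - 1) / 2) \<alpha> = - ln \<alpha>"
    by (rule LIMSEQ_unique)
  thus ?thesis by (simp add: ln_reciprocity_factor_def)
qed

text \<open>Starting from the last index, the indices \<open>q - 1\<close> at successive levels form
  a chain whose residue is always \<open>(1 - \<alpha>) / 2\<close>. Each level contributes
  \<open>1 / \<alpha>\<close>, and these factors telescope, because \<open>q * \<alpha>\<close> is
  the next denominator.\<close>

lemma sudler_word_top:
  assumes "set w \<subseteq> {1..A}"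
  shows "sudler_word w (cden w - 1) = real (cden w)"
  using assms
proof (induction w)
  case Nil
  thus ?case by (simp add: sudler_word_def)
next
  case (Cons a w)
  define \<alpha> where "\<alpha> = cval (a # w)"
  define q where "q = cden (a # w)"
  have w: "set w \<subseteq> {1..A}" using Cons.prems by simp
  have pos: "cden w > 0" "q > 0" using cden_pos[OF w] cden_pos[OF Cons.prems] by (simp_all add: q_def del: cden.simps)
  note cb = cval_Cons_bounds[OF Cons.prems] cval_bounds[OF w]
  have q\<alpha>: "real q * \<alpha> = real (cden w)" unfolding q_def \<alpha>_def by (rule cden_Cons_cval[OF Cons.prems])
  have "sudler (q - 1) \<alpha> = sudler (cden w - 1) (1 / \<alpha>) * exp (ln_reciprocity_factor ((1 - \<alpha>) / 2) \<alpha>)"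
  proof (rule sudler_reciprocity)
    show "(1 - \<alpha>) / 2 = (real (q - 1) + 1 / 2) * \<alpha> - real (cden w - 1) - 1 / 2"
      using pos q\<alpha> by (simp add: of_nat_diff field_simps)
    have "\<bar>1 - \<alpha>\<bar> = 1 - \<alpha>" using cb by (simp add: \<alpha>_def)
    thus "\<bar>(1 - \<alpha>) / 2\<bar> < 1/2 + \<alpha>/2" using cb(2) by (simp add: \<alpha>_def)
  qed (use cb in \<open>auto simp: \<alpha>_def\<close>)
  also have "1 / \<alpha> = cval w + of_int (int a)"
    unfolding \<alpha>_def cval_Cons[OF Cons.prems] by simp
  also have "sudler (cden w - 1) \<dots> = real (cden w)"
    using Cons.IH[OF w] by (simp add: sudler_plus_int sudler_word_def del: of_int_of_nat_eq)
  also have "exp (ln_reciprocity_factor ((1 - \<alpha>) / 2) \<alpha>) = 1 / \<alpha>"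
    using cb(2,3) by (simp add: ln_reciprocity_factor_top \<alpha>_def exp_minus inverse_eq_divide)
  also have "real (cden w) * (1 / \<alpha>) = real q" using q\<alpha> cb(2) by (simp add: \<alpha>_def field_simps)
  finally show ?case by (simp add: sudler_word_def q_def \<alpha>_def)
qed

section \<open>Power means and maxima over all indices of a word\<close>

definition sudler_power_sum :: "real \<Rightarrow> nat list \<Rightarrow> real" where
  "sudler_power_sum c w = (\<Sum>N<cden w. sudler_word w N powr c)"

definition ln_sudler_mean :: "real \<Rightarrow> nat list \<Rightarrow> real" where
  "ln_sudler_mean c w = ln (sudler_power_sum c w powr (1 / c))"

definition ln_sudler_max :: "nat list \<Rightarrow> real" where
  "ln_sudler_max w = ln (Max (sudler_word w ` {..<cden w}))"

lemma ln_sudler_max_ge: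
  assumes "set w \<subseteq> {1..A}" "N < cden w"
  shows "ln (sudler_word w N) \<le> ln_sudler_max w"
proof -
  have "sudler_word w N \<le> Max (sudler_word w ` {..<cden w})" using assms by (intro Max_ge) auto
  thus ?thesis unfolding ln_sudler_max_def using sudler_word_pos[OF assms] by (subst ln_le_cancel_iff) auto
qed

lemma ln_sudler_max_attained:
  assumes "set w \<subseteq> {1..A}"
  obtains N where "N < cden w" "ln_sudler_max w = ln (sudler_word w N)"
proof -
  have "Max (sudler_word w ` {..<cden w}) \<in> sudler_word w ` {..<cden w}"
    using cden_pos[OF assms] by (intro Max_in) auto
  thus ?thesis using that unfolding ln_sudler_max_def by auto
qed

lemma ln_sudler_max_ge_ln_cden:
  assumes "set w \<subseteq> {1..A}"
  shows "ln (real (cden w)) \<le> ln_sudler_max w"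
  using ln_sudler_max_ge[OF assms, of "cden w - 1"] sudler_word_top[OF assms] cden_pos[OF assms] by simp

lemma sudler_word_powr:
  assumes "set w \<subseteq> {1..A}" "N < cden w"
  shows "sudler_word w N powr c = exp (c * ln (sudler_word w N))"
  using sudler_word_pos[OF assms] by (simp add: powr_def)

lemma sudler_power_sum_pos:
  assumes "set w \<subseteq> {1..A}"
  shows "sudler_power_sum c w > 0"
  unfolding sudler_power_sum_def
proof (rule sum_pos)
  fix N assume "N \<in> {..<cden w}"
  thus "sudler_word w N powr c > 0" using sudler_word_pos[OF assms, of N] by simp
qed (use cden_pos[OF assms] in auto)

lemma ln_sudler_mean_eq: "set w \<subseteq> {1..A} \<Longrightarrow> ln_sudler_mean c w = ln (sudler_power_sum c w) / c"
  using sudler_power_sum_pos[of w A c] by (simp add: ln_sudler_mean_def ln_powr)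

text \<open>Together with the reverse bound below, this reduces estimates for every \<open>c\<close>
  to the maximum, at the cost of \<open>ln (cden w) / c\<close>. It also transfers the lower bound
  \<open>ln (cden w)\<close> to the means.\<close>

lemma ln_sudler_max_le_ln_sudler_mean:
  assumes w: "set w \<subseteq> {1..A}" and c: "c > 0"
  shows "ln_sudler_max w \<le> ln_sudler_mean c w"
proof -
  obtain N where N: "N < cden w" "ln_sudler_max w = ln (sudler_word w N)" using ln_sudler_max_attained[OF w] by blast
  have "sudler_word w N powr c \<le> sudler_power_sum c w" unfolding sudler_power_sum_def using N by (intro member_le_sum) auto
  hence "exp (c * ln (sudler_word w N)) \<le> sudler_power_sum c w" using sudler_word_powr[OF w N(1)] by simp
  hence "c * ln (sudler_word w N) \<le> ln (sudler_power_sum c w)" using sudler_power_sum_pos[OF w] by (simp add: ln_ge_iff)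
  thus ?thesis unfolding ln_sudler_mean_eq[OF w] N(2) using c by (simp add: field_simps)
qed

lemma ln_sudler_mean_le:
  assumes w: "set w \<subseteq> {1..A}" and c: "c > 0"
  shows "ln_sudler_mean c w \<le> ln_sudler_max w + ln (real (cden w)) / c"
proof -
  have "sudler_power_sum c w \<le> (\<Sum>N<cden w. exp (c * ln_sudler_max w))"
    unfolding sudler_power_sum_def
  proof (rule sum_mono)
    fix N assume "N \<in> {..<cden w}"
    thus "sudler_word w N powr c \<le> exp (c * ln_sudler_max w)"
      using sudler_word_powr[OF w, of N c] ln_sudler_max_ge[OF w, of N] c by simp
  qed
  hence "ln (sudler_power_sum c w) \<le> ln (real (cden w) * exp (c * ln_sudler_max w))"
    using sudler_power_sum_pos[OF w, of c] by (subst ln_le_cancel_iff) auto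
  also have "\<dots> = ln (real (cden w)) + c * ln_sudler_max w"
    using cden_pos[OF w] by (simp add: ln_mult_pos)
  finally show ?thesis unfolding ln_sudler_mean_eq[OF w] using c by (simp add: field_simps)
qed

text \<open>Splitting gives the upper bound and joining the lower one; injectivity of the index maps
  turns pointwise comparison into comparison of sums. The constants enter the power sums as
  \<open>exp (c * C)\<close> and become independent of \<open>c\<close> after taking the root of
  order \<open>c\<close>.\<close>

lemma free_energy_additive:
  fixes A :: nat
  assumes A: "A \<ge> 1"
  obtains B where "B \<ge> 0"
    "\<And>u v c. \<lbrakk>u \<noteq> []; v \<noteq> []; set u \<subseteq> {1..A}; set v \<subseteq> {1..A}; c > 0\<rbrakk> \<Longrightarrow>
       \<bar>ln_sudler_mean c (u @ v) - ln_sudler_mean c u - ln_sudler_mean c v\<bar> \<le> B * max 1 (1 / c)"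
    "\<And>u v. \<lbrakk>u \<noteq> []; v \<noteq> []; set u \<subseteq> {1..A}; set v \<subseteq> {1..A}\<rbrakk> \<Longrightarrow>
       \<bar>ln_sudler_max (u @ v) - ln_sudler_max u - ln_sudler_max v\<bar> \<le> B"
proof -
  obtain C1 where C1: "C1 \<ge> 0" and split: "\<And>u v. \<lbrakk>u \<noteq> []; set u \<subseteq> {1..A}; set v \<subseteq> {1..A}\<rbrakk> \<Longrightarrow>
    \<exists>f :: nat \<Rightarrow> (nat \<times> nat) \<times> bool. inj_on f {..<cden (u @ v)} \<and>
      (\<forall>N<cden (u @ v). fst (fst (f N)) < cden u \<and> snd (fst (f N)) < cden v \<and>
         ln (sudler_word (u @ v) N) \<le> C1 + ln (sudler_word u (fst (fst (f N)))) + ln (sudler_word v (snd (fst (f N)))))"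
    using sudler_word_split[OF A] by blast
  obtain C2 where C2: "C2 \<ge> 0" and join: "\<And>u v. \<lbrakk>u \<noteq> []; v \<noteq> []; set u \<subseteq> {1..A}; set v \<subseteq> {1..A}\<rbrakk> \<Longrightarrow>
    \<exists>g :: nat \<times> nat \<Rightarrow> nat. inj_on g ({..<cden u} \<times> {..<cden v}) \<and>
      (\<forall>N<cden u. \<forall>M<cden v. g (N, M) < cden (u @ v) \<and>
         ln (sudler_word u N) + ln (sudler_word v M) \<le> C2 + ln (sudler_word (u @ v) (g (N, M))))"
    using sudler_word_join[OF A] by blast
  show ?thesis
  proof (rule that[of "C1 + C2 + 1"])
    fix u v :: "nat list" and c :: real
    assume u: "u \<noteq> []" "set u \<subseteq> {1..A}" and v: "v \<noteq> []" "set v \<subseteq> {1..A}" and c: "c > 0"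
    have uv: "set (u @ v) \<subseteq> {1..A}" using u v by simp
    note pos = sudler_power_sum_pos[OF u(2), of c] sudler_power_sum_pos[OF v(2), of c] sudler_power_sum_pos[OF uv, of c]
    obtain f :: "nat \<Rightarrow> (nat \<times> nat) \<times> bool" where f: "inj_on f {..<cden (u @ v)}"
      "\<And>N. N < cden (u @ v) \<Longrightarrow> fst (fst (f N)) < cden u \<and> snd (fst (f N)) < cden v \<and>
         ln (sudler_word (u @ v) N) \<le> C1 + ln (sudler_word u (fst (fst (f N)))) + ln (sudler_word v (snd (fst (f N))))"
      using split[OF u v(2)] by blast
    define h where "h z = exp (c * C1) * (sudler_word u (fst (fst z)) powr c * sudler_word v (snd (fst z)) powr c)" for z :: "(nat \<times> nat) \<times> bool"
    have "sudler_power_sum c (u @ v) \<le> (\<Sum>N<cden (u @ v). h (f N))"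
      unfolding sudler_power_sum_def
    proof (rule sum_mono)
      fix N assume "N \<in> {..<cden (u @ v)}"
      hence N: "N < cden (u @ v)" by simp
      have "sudler_word (u @ v) N powr c = exp (c * ln (sudler_word (u @ v) N))" by (rule sudler_word_powr[OF uv N])
      also have "\<dots> \<le> exp (c * (C1 + ln (sudler_word u (fst (fst (f N)))) + ln (sudler_word v (snd (fst (f N))))))"
        using f(2)[OF N] c by simp
      also have "\<dots> = h (f N)"
        using f(2)[OF N] sudler_word_powr[OF u(2), of _ c] sudler_word_powr[OF v(2), of _ c]
        by (simp add: h_def distrib_left exp_add)
      finally show "sudler_word (u @ v) N powr c \<le> h (f N)" .
    qed
    also have "\<dots> = (\<Sum>z\<in>f ` {..<cden (u @ v)}. h z)" using f(1) by (simp add: sum.reindex)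
    also have "\<dots> \<le> (\<Sum>z\<in>({..<cden u} \<times> {..<cden v}) \<times> (UNIV :: bool set). h z)"
    proof (rule sum_mono2)
      show "f ` {..<cden (u @ v)} \<subseteq> ({..<cden u} \<times> {..<cden v}) \<times> UNIV"
      proof
        fix z assume "z \<in> f ` {..<cden (u @ v)}"
        then obtain N where "z = f N" "N < cden (u @ v)" by auto
        thus "z \<in> ({..<cden u} \<times> {..<cden v}) \<times> UNIV" using f(2)[of N] by (simp add: mem_Times_iff)
      qed
    qed (auto simp: h_def)
    also have "\<dots> = 2 * (exp (c * C1) * (sudler_power_sum c u * sudler_power_sum c v))"
      unfolding sum.cartesian_product' sudler_power_sum_def sum_product h_def
      by (simp add: sum.cartesian_product' sum_distrib_left UNIV_bool mult_ac)
    finally have "ln (sudler_power_sum c (u @ v)) \<le> ln (2 * (exp (c * C1) * (sudler_power_sum c u * sudler_power_sum c v)))"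
      using pos by (subst ln_le_cancel_iff) auto
    also have "\<dots> = ln 2 + (c * C1 + (ln (sudler_power_sum c u) + ln (sudler_power_sum c v)))"
      using pos by (simp add: ln_mult_pos)
    finally have upper: "ln_sudler_mean c (u @ v) \<le> ln 2 / c + C1 + ln_sudler_mean c u + ln_sudler_mean c v"
      unfolding ln_sudler_mean_eq[OF uv] ln_sudler_mean_eq[OF u(2)] ln_sudler_mean_eq[OF v(2)] using c by (simp add: field_simps)
    obtain g :: "nat \<times> nat \<Rightarrow> nat" where g: "inj_on g ({..<cden u} \<times> {..<cden v})"
      "\<And>N M. N < cden u \<Longrightarrow> M < cden v \<Longrightarrow> g (N, M) < cden (u @ v) \<and>
         ln (sudler_word u N) + ln (sudler_word v M) \<le> C2 + ln (sudler_word (u @ v) (g (N, M)))"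
      using join[OF u(1) v(1) u(2) v(2)] by blast
    have "sudler_power_sum c u * sudler_power_sum c v = (\<Sum>z\<in>{..<cden u} \<times> {..<cden v}. sudler_word u (fst z) powr c * sudler_word v (snd z) powr c)"
      unfolding sudler_power_sum_def sum_product by (simp add: sum.cartesian_product case_prod_unfold)
    also have "\<dots> \<le> (\<Sum>z\<in>{..<cden u} \<times> {..<cden v}. exp (c * C2) * sudler_word (u @ v) (g z) powr c)"
    proof (rule sum_mono)
      fix z assume "z \<in> {..<cden u} \<times> {..<cden v}"
      then obtain N M where z: "z = (N, M)" "N < cden u" "M < cden v" by auto
      have "sudler_word u N powr c * sudler_word v M powr c = exp (c * (ln (sudler_word u N) + ln (sudler_word v M)))"
        using sudler_word_powr[OF u(2) z(2)] sudler_word_powr[OF v(2) z(3)] by (simp add: distrib_left exp_add)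
      also have "\<dots> \<le> exp (c * (C2 + ln (sudler_word (u @ v) (g z))))"
        using g(2)[OF z(2,3)] c by (simp add: z)
      also have "\<dots> = exp (c * C2) * sudler_word (u @ v) (g z) powr c"
        using sudler_word_powr[OF uv, of "g z"] g(2)[OF z(2,3)] by (simp add: z distrib_left exp_add)
      finally show "sudler_word u (fst z) powr c * sudler_word v (snd z) powr c \<le> \<dots>" by (simp add: z)
    qed
    also have "\<dots> = exp (c * C2) * (\<Sum>n\<in>g ` ({..<cden u} \<times> {..<cden v}). sudler_word (u @ v) n powr c)"
      using g(1) by (simp add: sum.reindex sum_distrib_left)
    also have "\<dots> \<le> exp (c * C2) * sudler_power_sum c (u @ v)"
      unfolding sudler_power_sum_def using g(2) by (intro mult_left_mono sum_mono2) auto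
    finally have "ln (sudler_power_sum c u * sudler_power_sum c v) \<le> ln (exp (c * C2) * sudler_power_sum c (u @ v))"
      using pos by (subst ln_le_cancel_iff) auto
    hence "ln (sudler_power_sum c u) + ln (sudler_power_sum c v) \<le> c * C2 + ln (sudler_power_sum c (u @ v))"
      using pos by (simp add: ln_mult_pos)
    hence "(ln (sudler_power_sum c u) + ln (sudler_power_sum c v)) / c \<le> (c * C2 + ln (sudler_power_sum c (u @ v))) / c"
      using c by (intro divide_right_mono) auto
    hence lower: "ln_sudler_mean c u + ln_sudler_mean c v \<le> C2 + ln_sudler_mean c (u @ v)"
      unfolding ln_sudler_mean_eq[OF uv] ln_sudler_mean_eq[OF u(2)] ln_sudler_mean_eq[OF v(2)] using c by (simp add: add_divide_distrib)
    \<comment> \<open>The factor \<open>2\<close> counts the values of the bit in the splitting map.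
      It costs \<open>ln 2 / c\<close>, which the summand \<open>1\<close> in the constant
      covers.\<close>
    have "ln (2::real) \<le> 1" using ln_le_minus_one[of "2::real"] by simp
    hence "ln 2 / c \<le> 1 / c" using c by (intro divide_right_mono) auto
    moreover have "1 / c \<le> max 1 (1 / c)" "1 \<le> max 1 (1 / c)" by auto
    moreover have "C1 * 1 \<le> C1 * max 1 (1 / c)" "C2 * 1 \<le> C2 * max 1 (1 / c)" using C1 C2 by (intro mult_left_mono; simp)+
    ultimately show "\<bar>ln_sudler_mean c (u @ v) - ln_sudler_mean c u - ln_sudler_mean c v\<bar> \<le> (C1 + C2 + 1) * max 1 (1 / c)"
      using upper lower C1 C2 unfolding distrib_right by linarith
  next
    fix u v :: "nat list"
    assume u: "u \<noteq> []" "set u \<subseteq> {1..A}" and v: "v \<noteq> []" "set v \<subseteq> {1..A}"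
    have uv: "set (u @ v) \<subseteq> {1..A}" using u v by simp
    obtain f :: "nat \<Rightarrow> (nat \<times> nat) \<times> bool" where f: 
      "\<And>N. N < cden (u @ v) \<Longrightarrow> fst (fst (f N)) < cden u \<and> snd (fst (f N)) < cden v \<and>
         ln (sudler_word (u @ v) N) \<le> C1 + ln (sudler_word u (fst (fst (f N)))) + ln (sudler_word v (snd (fst (f N))))"
      using split[OF u v(2)] by blast
    obtain g :: "nat \<times> nat \<Rightarrow> nat" where g: 
      "\<And>N M. N < cden u \<Longrightarrow> M < cden v \<Longrightarrow> g (N, M) < cden (u @ v) \<and>
         ln (sudler_word u N) + ln (sudler_word v M) \<le> C2 + ln (sudler_word (u @ v) (g (N, M)))"
      using join[OF u(1) v(1) u(2) v(2)] by blast
    obtain N where N: "N < cden (u @ v)" "ln_sudler_max (u @ v) = ln (sudler_word (u @ v) N)" using ln_sudler_max_attained[OF uv] by blast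
    have "ln_sudler_max (u @ v) \<le> C1 + ln_sudler_max u + ln_sudler_max v"
      using f[OF N(1)] N(2) ln_sudler_max_ge[OF u(2), of "fst (fst (f N))"] ln_sudler_max_ge[OF v(2), of "snd (fst (f N))"] by linarith
    moreover obtain N1 where N1: "N1 < cden u" "ln_sudler_max u = ln (sudler_word u N1)" using ln_sudler_max_attained[OF u(2)] by blast
    moreover obtain N2 where N2: "N2 < cden v" "ln_sudler_max v = ln (sudler_word v N2)" using ln_sudler_max_attained[OF v(2)] by blast
    have "ln_sudler_max u + ln_sudler_max v \<le> C2 + ln_sudler_max (u @ v)"
      using g[OF N1(1) N2(1)] ln_sudler_max_ge[OF uv, of "g (N1, N2)"] N1(2) N2(2) by linarith
    ultimately show "\<bar>ln_sudler_max (u @ v) - ln_sudler_max u - ln_sudler_max v\<bar> \<le> C1 + C2 + 1" using C1 C2 by linarith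
  qed (use C1 C2 in simp)
qed

text \<open>Comparing \<open>g (m * n)\<close> with both \<open>m * g n\<close> and
  \<open>n * g m\<close> shows that \<open>g n / n\<close> is Cauchy with an explicit rate. For
  fixed \<open>n\<close>, letting \<open>m\<close> tend to infinity leaves the error
  \<open>E / n\<close>.\<close>

lemma approx_additive_limit:
  fixes g :: "nat \<Rightarrow> real"
  assumes "E \<ge> 0" and add: "\<And>m n. m \<ge> 1 \<Longrightarrow> n \<ge> 1 \<Longrightarrow> \<bar>g (m + n) - g m - g n\<bar> \<le> E"
  obtains K where "\<And>n. n \<ge> 1 \<Longrightarrow> \<bar>g n - K * real n\<bar> \<le> E"
proof -
  have mult: "\<bar>g (m * n) - real m * g n\<bar> \<le> real m * E" if "m \<ge> 1" "n \<ge> 1" for m n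
    using that(1)
  proof (induction m rule: dec_induct)
    case (step m)
    have "\<bar>g (n + m * n) - g n - g (m * n)\<bar> \<le> E" using add[of n "m * n"] that step by simp
    moreover have "real (Suc m) * g n = real m * g n + g n" "real (Suc m) * E = real m * E + E"
      by (simp_all add: algebra_simps)
    ultimately show ?case using step.IH by simp
  qed (use assms in simp)
  have cmp: "\<bar>g n / real n - g m / real m\<bar> \<le> E / real n + E / real m" if m: "m \<ge> 1" and n: "n \<ge> 1" for m n
  proof -
    have "\<bar>real m * g n - real n * g m\<bar> \<le> real m * E + real n * E"
      using mult[OF m n] mult[OF n m] by (simp add: mult.commute)
    hence "\<bar>(real m * g n - real n * g m) / (real m * real n)\<bar> \<le> (real m * E + real n * E) / (real m * real n)"
      using m n by (simp add: abs_mult abs_divide divide_right_mono)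
    moreover have "(real m * g n - real n * g m) / (real m * real n) = g n / real n - g m / real m"
      "(real m * E + real n * E) / (real m * real n) = E / real n + E / real m"
      using m n by (simp_all add: field_simps)
    ultimately show ?thesis by simp
  qed
  have "Cauchy (\<lambda>n. g n / real n)"
  proof (rule metric_CauchyI)
    fix e :: real assume e: "e > 0"
    obtain M :: nat where M: "2 * E / e < real M" using reals_Archimedean2 by blast
    show "\<exists>M. \<forall>m\<ge>M. \<forall>n\<ge>M. dist (g m / real m) (g n / real n) < e"
    proof (intro exI[of _ "Suc M"] allI impI)
      fix m n assume mn: "m \<ge> Suc M" "n \<ge> Suc M"
      have "E / real i < e / 2" if "i \<ge> Suc M" for i
      proof -
        have "2 * E / e < real i" using M that by linarith
        thus ?thesis using e that by (simp add: field_simps)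
      qed
      from this[OF mn(1)] this[OF mn(2)] show "dist (g m / real m) (g n / real n) < e"
        using cmp[of m n] cmp[of n m] mn unfolding dist_real_def by linarith
    qed
  qed
  then obtain K where K: "(\<lambda>n. g n / real n) \<longlonglongrightarrow> K"
    using Cauchy_convergent convergent_def by blast
  show ?thesis
  proof (rule that[of K])
    fix n :: nat assume n: "n \<ge> 1"
    have up: "(\<lambda>m. E / real n + E / real m) \<longlonglongrightarrow> E / real n + 0"
      by (intro tendsto_intros lim_const_over_n)
    have lo: "(\<lambda>m. \<bar>g n / real n - g m / real m\<bar>) \<longlonglongrightarrow> \<bar>g n / real n - K\<bar>"
      by (intro tendsto_intros K)
    have "\<bar>g n / real n - K\<bar> \<le> E / real n + 0"
      by (rule LIMSEQ_le[OF lo up]) (use cmp[OF _ n] in blast)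
    hence "\<bar>g n / real n - K\<bar> * real n \<le> E" using n by (simp add: field_simps)
    moreover have "g n - K * real n = (g n / real n - K) * real n" using n by (simp add: field_simps)
    ultimately show "\<bar>g n - K * real n\<bar> \<le> E" by (simp add: abs_mult)
  qed
qed

section \<open>Growth along a periodic word\<close>

text \<open>Linear growth suffices for positivity of the slope: only the unboundedness of
  \<open>ln (cden w)\<close> along the periods matters.\<close>

lemma cden_ge_length: "set w \<subseteq> {1..A} \<Longrightarrow> length w \<le> cden w"
proof (induction w)
  case (Cons a w)
  have w: "set w \<subseteq> {1..A}" "1 \<le> a" using Cons.prems by auto
  show ?case
  proof (cases w)
    case Nil
    thus ?thesis using w by simp
  next
    case (Cons b v)
    hence "cnum w > 0" using w cden_pos[of v A] by simp
    moreover have "1 * cden w \<le> a * cden w" using w by (intro mult_right_mono) auto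
    ultimately show ?thesis using Cons.IH[OF w(1)] unfolding cden.simps list.size by linarith
  qed
qed simp

lemma ln_sudler_mean_Nil [simp]: "ln_sudler_mean c [] = 0" and ln_sudler_max_Nil [simp]: "ln_sudler_max [] = 0"
  by (simp_all add: ln_sudler_mean_def sudler_power_sum_def ln_sudler_max_def sudler_word_def lessThan_Suc)

text \<open>The word is cut into preperiod, whole periods and an incomplete period. Almost
  additivity gives the periods a slope, and the two short pieces are bounded by \<open>M\<close>.
  The functional is abstract so that the power means for all \<open>c\<close> and the maximum share
  one explicit error, in which any dependence on \<open>c\<close> enters through \<open>M\<close>
  and \<open>E\<close> alone.\<close>

lemma periodic_growth:
  fixes F :: "nat list \<Rightarrow> real" and b :: "nat \<Rightarrow> nat"
  assumes b: "\<And>n. n \<ge> 1 \<Longrightarrow> 1 \<le> b n \<and> b n \<le> A"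
    and m: "m \<ge> 1" and p: "p \<ge> 1" and per: "\<And>n. n \<ge> m \<Longrightarrow> b (n + p) = b n"
    and add: "\<And>u v. set u \<subseteq> {1..A} \<Longrightarrow> set v \<subseteq> {1..A} \<Longrightarrow> \<bar>F (u @ v) - F u - F v\<bar> \<le> E"
    and M: "\<And>w. set w \<subseteq> {1..A} \<Longrightarrow> length w \<le> m + p \<Longrightarrow> \<bar>F w\<bar> \<le> M"
    and F: "\<And>w. set w \<subseteq> {1..A} \<Longrightarrow> ln (real (cden w)) \<le> F w"
  obtains K where "K > 0" "\<And>k. \<bar>F (map b [1..<Suc k]) - K * real k\<bar> \<le> (3 + real m + real p) * (M + E)"
proof -
  have word: "set (map b [i..<j]) \<subseteq> {1..A}" if "i \<ge> 1" for i j
  proof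
    fix x assume "x \<in> set (map b [i..<j])"
    then obtain n where "x = b n" "i \<le> n" by auto
    thus "x \<in> {1..A}" using b[of n] that by simp
  qed
  have E0: "E \<ge> 0" using add[of "[]" "[]"] by simp
  have M0: "M \<ge> 0" using M[of "[]"] by simp
  define v where "v n = map b [m..<m + p * n]" for n
  have vw: "set (v n) \<subseteq> {1..A}" for n unfolding v_def by (rule word[OF m])
  have pern: "b (i + p * n) = b i" if "i \<ge> m" for i n
  proof (induction n)
    case (Suc n)
    have "b (i + p * Suc n) = b ((i + p * n) + p)" by (simp add: add_ac)
    also have "\<dots> = b (i + p * n)" using that by (intro per) simp
    finally show ?case using Suc.IH by simp
  qed simp
  have v_add: "v (i + n) = v i @ v n" for i n
  proof -
    have "[m..<m + p * (i + n)] = [m..<m + p * i] @ [m + p * i..<m + p * i + p * n]"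
      using upt_add_eq_append[of m "m + p * i" "p * n"] by (simp add: algebra_simps)
    moreover have "map b [m + p * i..<m + p * i + p * n] = map b [m..<m + p * n]"
    proof -
      have "[m + p * i..<m + p * i + p * n] = map (\<lambda>j. j + p * i) [m..<m + p * n]"
        using map_add_upt[of "p * i" "p * n"] by (intro nth_equalityI) (simp_all add: add_ac)
      hence "map b [m + p * i..<m + p * i + p * n] = map (\<lambda>j. b (j + p * i)) [m..<m + p * n]"
        by (simp add: o_def)
      also have "\<dots> = map b [m..<m + p * n]" by (rule map_cong) (auto simp: pern)
      finally show ?thesis .
    qed
    ultimately show ?thesis unfolding v_def by simp
  qed
  have "\<bar>F (v (i + n)) - F (v i) - F (v n)\<bar> \<le> E" for i n
    unfolding v_add by (rule add[OF vw vw])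
  then obtain K0 where K0: "\<And>n. n \<ge> 1 \<Longrightarrow> \<bar>F (v n) - K0 * real n\<bar> \<le> E"
    using approx_additive_limit[of E "\<lambda>n. F (v n)"] E0 by blast
  have F0: "\<bar>F []\<bar> \<le> E" using add[of "[]" "[]"] by simp
  have K0': "\<bar>F (v n) - K0 * real n\<bar> \<le> E" for n
    using K0[of n] F0 by (cases "n = 0") (auto simp: v_def)
  have "\<bar>F (v 1)\<bar> \<le> M" by (intro M vw) (simp add: v_def)
  hence K0b: "\<bar>K0\<bar> \<le> M + E" using K0[of 1] by simp
  \<comment> \<open>With a slope that is not positive, \<open>F (v n)\<close> would stay below
    \<open>E\<close>, whereas it is at least \<open>ln n\<close>.\<close>
  have K0pos: "K0 > 0"
  proof (rule ccontr)
    assume "\<not> K0 > 0"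
    obtain n :: nat where n: "exp E < real n" using reals_Archimedean2 by blast
    hence n1: "n \<ge> 1" using exp_gt_zero[of E] by (cases n) auto
    have "p * n \<le> cden (v n)" using cden_ge_length[OF vw, of n] by (simp add: v_def)
    moreover have "n \<le> p * n" using p by (cases p) auto
    ultimately have "real n \<le> real (cden (v n))" by linarith
    hence "E < ln (real (cden (v n)))" using n n1 ln_less_cancel_iff[of "exp E" "real (cden (v n))"] by simp
    also have "\<dots> \<le> F (v n)" by (rule F[OF vw])
    also have "\<dots> \<le> E + K0 * real n" using K0[OF n1] by linarith
    also have "\<dots> \<le> E" using \<open>\<not> K0 > 0\<close> by (simp add: mult_nonpos_nonneg)
    finally show False by simp
  qed
  define K where "K = K0 / real p"
  have Kb: "0 < K" "K \<le> M + E"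
  proof -
    show "0 < K" using K0pos p by (simp add: K_def)
    have "K0 / real p \<le> K0 / 1" using K0pos p by (intro divide_left_mono) auto
    thus "K \<le> M + E" using K0b by (simp add: K_def)
  qed
  show ?thesis
  proof (rule that[OF Kb(1)])
    fix k :: nat
    show "\<bar>F (map b [1..<Suc k]) - K * real k\<bar> \<le> (3 + real m + real p) * (M + E)"
    proof (cases "Suc k < m")
      case True
      have "\<bar>F (map b [1..<Suc k])\<bar> \<le> M" using True by (intro M word) auto
      moreover have "K * real k \<le> (M + E) * real m" using True Kb by (intro mult_mono) auto
      moreover have "K * real k \<ge> 0" using Kb by simp
      ultimately have "\<bar>F (map b [1..<Suc k]) - K * real k\<bar> \<le> M + (M + E) * real m" by linarith
      also have "\<dots> \<le> (3 + real m + real p) * (M + E)"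
        using M0 E0 by (simp add: algebra_simps)
      finally show ?thesis .
    next
      case False
      define n where "n = (Suc k - m) div p"
      define r where "r = (Suc k - m) mod p"
      have kn: "Suc k = m + p * n + r" using False by (simp add: n_def r_def)
      have r: "r < p" using p by (simp add: r_def)
      define u where "u = map b [1..<m]"
      define t where "t = map b [m + p * n..<Suc k]"
      have "m + p * n \<ge> 1" using m by simp
      hence ut: "set u \<subseteq> {1..A}" "set t \<subseteq> {1..A}" unfolding u_def t_def by (intro word order_refl; assumption)+
      have "[1..<Suc k] = [1..<m] @ [m..<m + p * n] @ [m + p * n..<Suc k]"
        using upt_add_eq_append[of 1 m "p * n + r"] upt_add_eq_append[of m "m + p * n" r] m kn
        by (simp add: add_ac del: upt_Suc)
      hence w: "map b [1..<Suc k] = u @ v n @ t" by (simp add: u_def v_def t_def del: upt_Suc)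
      have "\<bar>F (u @ v n @ t) - F u - F (v n @ t)\<bar> \<le> E" using ut vw[of n] by (intro add) auto
      moreover have "\<bar>F (v n @ t) - F (v n) - F t\<bar> \<le> E" using ut vw[of n] by (intro add) auto
      moreover have "\<bar>F u\<bar> \<le> M" by (intro M ut) (simp add: u_def)
      moreover have "\<bar>F t\<bar> \<le> M" using r kn by (intro M ut) (simp add: t_def del: upt_Suc)
      moreover have "\<bar>K0 * real n - K * real k\<bar> \<le> (M + E) * (real m + real p)"
      proof -
        \<comment> \<open>Words start at index \<open>1\<close>, so the preperiod has
          \<open>m - 1\<close> letters and \<open>k = p * n + (m - 1) + r\<close>.\<close>
        have rk: "real k = real p * real n + (real m + real r - 1)"
          using arg_cong[OF kn, of real] by simp
        have "K * real p = K0" using p by (simp add: K_def)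
        moreover have "K * real k = (K * real p) * real n + K * (real m + real r - 1)"
          unfolding rk by (simp only: distrib_left mult.assoc)
        ultimately have "K * real k - K0 * real n = K * (real m + real r - 1)" by simp
        moreover have "0 \<le> K * (real m + real r - 1)" using Kb m by simp
        moreover have "K * (real m + real r - 1) \<le> (M + E) * (real m + real p)"
          using Kb r m by (intro mult_mono) auto
        ultimately show ?thesis by linarith
      qed
      ultimately have "\<bar>F (map b [1..<Suc k]) - K * real k\<bar> \<le> 3 * E + 2 * M + (M + E) * (real m + real p)"
        using K0'[of n] unfolding w by linarith
      also have "\<dots> \<le> (3 + real m + real p) * (M + E)" using M0 by (simp add: algebra_simps)
      finally show ?thesis .
    qed
  qed
qed

section \<open>Lagrange's theorem on continued fractions\<close>

context
  fixes \<alpha> :: real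
  assumes irrat: "\<alpha> \<notin> \<rat>"
begin

lemma cf_quotient_irrational: "cf_complete_quotient \<alpha> n \<notin> \<rat>"
proof (induction n)
  case (Suc n)
  show ?case
  proof
    assume "cf_complete_quotient \<alpha> (Suc n) \<in> \<rat>"
    hence "1 / cf_complete_quotient \<alpha> (Suc n) \<in> \<rat>" by (intro Rats_divide Rats_1)
    hence "frac (cf_complete_quotient \<alpha> n) \<in> \<rat>" by simp
    hence "frac (cf_complete_quotient \<alpha> n) + of_int \<lfloor>cf_complete_quotient \<alpha> n\<rfloor> \<in> \<rat>"
      by (intro Rats_add Rats_of_int)
    thus False using Suc by (simp add: frac_def)
  qed
qed (use irrat in simp)

lemma cf_frac_bounds: "0 < frac (cf_complete_quotient \<alpha> n)" "frac (cf_complete_quotient \<alpha> n) < 1"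
proof -
  have "cf_complete_quotient \<alpha> n \<notin> \<int>" using cf_quotient_irrational[of n] Ints_subset_Rats by auto
  thus "0 < frac (cf_complete_quotient \<alpha> n)" by simp
qed (rule frac_lt_1)

lemma cf_quotient_gt_1: "n \<ge> 1 \<Longrightarrow> cf_complete_quotient \<alpha> n > 1"
  using cf_frac_bounds[of "n - 1"] by (cases n) auto

lemma cf_partial_ge_1: "n \<ge> 1 \<Longrightarrow> cf_partial_quotient \<alpha> n \<ge> 1"
  using cf_quotient_gt_1[of n] by (simp add: cf_partial_quotient_def)

lemma cf_quotient_Suc:
  "cf_complete_quotient \<alpha> (Suc n) = 1 / (cf_complete_quotient \<alpha> n - of_int (cf_partial_quotient \<alpha> n))"
  by (simp add: frac_def cf_partial_quotient_def)

text \<open>The Gauss steps of \<open>\<alpha>\<close> applied to another number \<open>y\<close>: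
  the integers subtracted are the partial quotients of \<open>\<alpha>\<close>. For the algebraic
  conjugate of \<open>\<alpha>\<close> this gives the conjugates of the complete quotients.\<close>

fun conjugate_quotient :: "real \<Rightarrow> nat \<Rightarrow> real" where
  "conjugate_quotient y 0 = y"
| "conjugate_quotient y (Suc n) = 1 / (conjugate_quotient y n - of_int (cf_partial_quotient \<alpha> n))"

lemma conjugate_quotient_irrational:
  assumes "y \<notin> \<rat>"
  shows "conjugate_quotient y n \<notin> \<rat>"
proof (induction n)
  case (Suc n)
  show ?case
  proof
    assume "conjugate_quotient y (Suc n) \<in> \<rat>"
    hence "1 / conjugate_quotient y (Suc n) \<in> \<rat>" by (intro Rats_divide Rats_1)
    hence "conjugate_quotient y n - of_int (cf_partial_quotient \<alpha> n) + of_int (cf_partial_quotient \<alpha> n) \<in> \<rat>"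
      by (intro Rats_add Rats_of_int) simp
    thus False using Suc by simp
  qed
qed (use assms in simp)

text \<open>Subtracting a positive partial quotient from a negative number and inverting gives a
  negative number again.\<close>

lemma conjugate_quotient_neg_persists:
  assumes "n \<ge> 1" "conjugate_quotient y n < 0" "n \<le> k"
  shows "conjugate_quotient y k < 0"
  using assms(3)
proof (induction k rule: dec_induct)
  case (step k)
  have "real_of_int (cf_partial_quotient \<alpha> k) \<ge> 1" using cf_partial_ge_1[of k] step assms by simp
  thus ?case using step by (simp add: divide_less_0_iff)
qed (use assms in simp)

text \<open>Otherwise both sequences would share all their partial quotients, although their distance grows geometrically.\<close>
lemma conjugate_quotient_eventually_neg:
  assumes y: "y \<notin> \<rat>" "y \<noteq> \<alpha>"
  obtains n where "n \<ge> 1" "conjugate_quotient y n < 0"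
proof (rule ccontr)
  assume "\<not> thesis"
  let ?x = "cf_complete_quotient \<alpha>" and ?y = "conjugate_quotient y" and ?a = "cf_partial_quotient \<alpha>"
  have nonneg: "?y n > 0" if "n \<ge> 1" for n
  proof -
    have "\<not> ?y n < 0" using that \<open>\<not> thesis\<close> \<open>\<And>n. 1 \<le> n \<Longrightarrow> conjugate_quotient y n < 0 \<Longrightarrow> thesis\<close> by blast
    moreover have "?y n \<noteq> 0" using conjugate_quotient_irrational[OF y(1), of n] by auto
    ultimately show ?thesis by simp
  qed
  have ygt: "?y n > of_int (?a n)" if "n \<ge> 1" for n
    using nonneg[of "Suc n"] by (simp add: zero_less_divide_iff)
  have xgt: "?x n > of_int (?a n)" "?x n < of_int (?a n) + 1" for n
    using cf_frac_bounds[of n] by (auto simp: frac_def cf_partial_quotient_def)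
  have a1: "real_of_int (?a n) \<ge> 1" if "n \<ge> 1" for n using cf_partial_ge_1[OF that] by simp
  have diff: "?x (Suc n) - ?y (Suc n) = - (?x (Suc n) * ?y (Suc n)) * (?x n - ?y n)" for n
  proof -
    have "?x n - of_int (?a n) \<noteq> 0" using xgt[of n] by simp
    moreover have "?y n - of_int (?a n) \<noteq> 0" using conjugate_quotient_irrational[OF y(1), of n] by auto
    ultimately show ?thesis unfolding cf_quotient_Suc conjugate_quotient.simps by (simp add: divide_simps) 
  qed
  have ne: "?x n \<noteq> ?y n" for n
  proof (induction n)
    case (Suc n)
    have "?x (Suc n) \<noteq> 0" "?y (Suc n) \<noteq> 0"
      using cf_quotient_irrational[of "Suc n"] conjugate_quotient_irrational[OF y(1), of "Suc n"] Rats_0 by metis+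
    thus ?case using diff[of n] Suc by auto
  qed (use y in simp)
  have grow: "\<bar>?x (Suc (Suc n)) - ?y (Suc (Suc n))\<bar> \<ge> 2 * \<bar>?x n - ?y n\<bar>" if n: "n \<ge> 1" for n
  proof -
    \<comment> \<open>Two steps are combined: a single complete quotient merely exceeds
      \<open>1\<close>, while the product of two consecutive ones is \<open>a * x + 1\<close>, hence
      at least \<open>2\<close>.\<close>
    define P where "P = ?x (Suc n) * ?x (Suc (Suc n))"
    have e: "?x (Suc (Suc n)) * (?x (Suc n) - of_int (?a (Suc n))) = 1"
      using xgt[of "Suc n"] unfolding cf_quotient_Suc[of "Suc n"] by simp
    have "P = of_int (?a (Suc n)) * ?x (Suc (Suc n)) + 1" using e by (simp add: P_def algebra_simps)
    moreover have "1 * 1 \<le> of_int (?a (Suc n)) * ?x (Suc (Suc n))"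
      using a1[of "Suc n"] cf_quotient_gt_1[of "Suc (Suc n)"] by (intro mult_mono) auto
    ultimately have P: "P \<ge> 2" by simp
    have Q: "?y (Suc n) * ?y (Suc (Suc n)) \<ge> 1 * 1"
    proof (rule mult_mono)
      show "1 \<le> ?y (Suc n)" "1 \<le> ?y (Suc (Suc n))"
        using ygt[of "Suc n"] a1[of "Suc n"] ygt[of "Suc (Suc n)"] a1[of "Suc (Suc n)"] by linarith+
    qed (use nonneg in \<open>auto intro: less_imp_le simp del: conjugate_quotient.simps\<close>)
    have "\<bar>?x (Suc (Suc n)) - ?y (Suc (Suc n))\<bar> = (P * (?y (Suc n) * ?y (Suc (Suc n)))) * \<bar>?x n - ?y n\<bar>"
      unfolding diff[of "Suc n"] diff[of n] P_def
      using cf_quotient_gt_1[of "Suc n"] cf_quotient_gt_1[of "Suc (Suc n)"] nonneg[of "Suc n"] nonneg[of "Suc (Suc n)"]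
      by (simp add: abs_mult mult_ac del: cf_complete_quotient.simps conjugate_quotient.simps)
    moreover have "2 * 1 \<le> P * (?y (Suc n) * ?y (Suc (Suc n)))" using P Q by (intro mult_mono) auto
    ultimately show ?thesis using mult_right_mono[of 2 "P * (?y (Suc n) * ?y (Suc (Suc n)))" "\<bar>?x n - ?y n\<bar>"] by simp
  qed
  have geo: "\<bar>?x (1 + 2 * i) - ?y (1 + 2 * i)\<bar> \<ge> 2 ^ i * \<bar>?x 1 - ?y 1\<bar>" for i
  proof (induction i)
    case (Suc i)
    have "1 + 2 * Suc i = Suc (Suc (1 + 2 * i))" by simp
    thus ?case using grow[of "1 + 2 * i"] Suc by (simp del: cf_complete_quotient.simps conjugate_quotient.simps)
  qed simp
  have close: "\<bar>?x n - ?y n\<bar> < 1" if n: "n \<ge> 1" for n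
  proof -
    have "?y (Suc n) > 1" using ygt[of "Suc n"] a1[of "Suc n"] by simp
    hence "?y n - of_int (?a n) < 1" using ygt[OF n] by (simp add: less_divide_eq)
    thus ?thesis using ygt[OF n] xgt[of n] by (simp add: abs_less_iff)
  qed
  have pos: "\<bar>?x 1 - ?y 1\<bar> > 0" using ne[of 1] by simp
  obtain i :: nat where "1 / \<bar>?x 1 - ?y 1\<bar> < 2 ^ i" using real_arch_pow[of 2] by auto
  hence "1 < 2 ^ i * \<bar>?x 1 - ?y 1\<bar>" using pos by (simp only: divide_less_eq)
  thus False using geo[of i] close[of "1 + 2 * i"] by linarith
qed

text \<open>Each complete quotient and its conjugate are the roots of an integer quadratic, and
  \<open>d = |A * (x - y)|\<close>, the square root of the discriminant, is invariant. Once
  \<open>y < 0\<close> and \<open>x > 1\<close>, both \<open>1\<close> and \<open>|x + y|\<close>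
  are at most \<open>x - y\<close>, so \<open>|A|\<close> and \<open>|B|\<close> are at most
  \<open>d\<close>. Finitely many pairs remain, and a repetition forces the period.\<close>

lemma cf_eventually_periodic:
  assumes quad: "A0 \<noteq> 0" "of_int A0 * \<alpha>\<^sup>2 + of_int B0 * \<alpha> + of_int C0 = 0"
  obtains m p where "m \<ge> 1" "p \<ge> 1" "\<And>n. n \<ge> m \<Longrightarrow> cf_partial_quotient \<alpha> (n + p) = cf_partial_quotient \<alpha> n"
proof -
  let ?x = "cf_complete_quotient \<alpha>" and ?a = "cf_partial_quotient \<alpha>"
  define y0 where "y0 = - of_int B0 / of_int A0 - \<alpha>"
  define y where "y = conjugate_quotient y0"
  have y0: "y0 \<notin> \<rat>"
  proof
    assume "y0 \<in> \<rat>"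
    hence "- of_int B0 / of_int A0 - y0 \<in> \<rat>" by (intro Rats_diff Rats_divide Rats_minus_iff[THEN iffD2] Rats_of_int)
    thus False using irrat by (simp add: y0_def)
  qed
  have y0_ne: "y0 \<noteq> \<alpha>"
  proof
    assume "y0 = \<alpha>"
    hence "\<alpha> = - of_int B0 / of_int A0 / 2" by (simp add: y0_def)
    also have "\<dots> \<in> \<rat>" by (intro Rats_divide Rats_minus_iff[THEN iffD2] Rats_of_int) auto
    finally show False using irrat by simp
  qed
  define d where "d = \<bar>of_int A0 * (\<alpha> - y0)\<bar>"
  have ex: "\<exists>A B C :: int. A \<noteq> 0 \<and> of_int B = - of_int A * (?x n + y n) \<and> of_int C = of_int A * ?x n * y n
      \<and> \<bar>of_int A * (?x n - y n)\<bar> = d" for n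
  proof (induction n)
    case 0
    have "of_int B0 = - of_int A0 * (\<alpha> + y0)" using quad(1) by (simp add: y0_def field_simps)
    moreover have "of_int C0 = of_int A0 * \<alpha> * y0"
    proof -
      have "of_int C0 = - (of_int A0 * \<alpha>\<^sup>2 + of_int B0 * \<alpha>)" using quad(2) by linarith
      thus ?thesis unfolding calculation by (simp add: power2_eq_square algebra_simps)
    qed
    ultimately show ?case using quad(1) by (intro exI[of _ A0] exI[of _ B0] exI[of _ C0]) (simp add: y_def d_def)
  next
    case (Suc n)
    then obtain A B C :: int where ABC: "A \<noteq> 0" "real_of_int B = - of_int A * (?x n + y n)"
      "real_of_int C = of_int A * ?x n * y n" "\<bar>of_int A * (?x n - y n)\<bar> = d" by blast
    define a where "a = ?a n"
    define X where "X = ?x n - of_int a"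
    define Y where "Y = y n - of_int a"
    have XY: "X \<noteq> 0" "Y \<noteq> 0"
      using cf_quotient_irrational[of n] conjugate_quotient_irrational[OF y0, of n] by (auto simp: X_def Y_def y_def)
    have x': "?x (Suc n) = 1 / X" unfolding cf_quotient_Suc X_def a_def by simp
    have y': "y (Suc n) = 1 / Y" unfolding y_def Y_def a_def by simp
    have xy: "?x n = X + of_int a" "y n = Y + of_int a" by (simp_all add: X_def Y_def)
    \<comment> \<open>Coefficients of the quadratic after substituting
      \<open>x = a + 1 / x'\<close>; its constant coefficient is the old \<open>A\<close>.\<close>
    define A' where "A' = A * a\<^sup>2 + B * a + C"
    define B' where "B' = 2 * A * a + B"
    have A': "real_of_int A' = of_int A * (X * Y)"
      unfolding A'_def of_int_add of_int_mult of_int_power ABC(2,3) xy by (simp add: power2_eq_square algebra_simps)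
    have B': "real_of_int B' = - of_int A * (X + Y)"
      unfolding B'_def of_int_add of_int_mult ABC(2) xy by (simp add: algebra_simps)
    have "A' \<noteq> 0"
    proof
      assume "A' = 0"
      thus False using A' ABC(1) XY by simp
    qed
    moreover have "real_of_int B' = - of_int A' * (?x (Suc n) + y (Suc n))"
      unfolding A' B' x' y' using XY by (simp add: field_simps)
    moreover have "real_of_int A = of_int A' * ?x (Suc n) * y (Suc n)"
      unfolding A' x' y' using XY by simp
    moreover have "\<bar>of_int A' * (?x (Suc n) - y (Suc n))\<bar> = d"
    proof -
      have "of_int A' * (?x (Suc n) - y (Suc n)) = - (of_int A * (?x n - y n))"
        unfolding A' x' y' xy using XY by (simp add: field_simps)
      thus ?thesis using ABC(4) by simp
    qed
    ultimately show ?case by blast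
  qed
  then obtain A B :: "nat \<Rightarrow> int" where AB: "\<And>n. A n \<noteq> 0" "\<And>n. real_of_int (B n) = - of_int (A n) * (?x n + y n)"
      "\<And>n. \<bar>of_int (A n) * (?x n - y n)\<bar> = d" by metis
  obtain n0 where n0: "n0 \<ge> 1" "conjugate_quotient y0 n0 < 0" using conjugate_quotient_eventually_neg[OF y0 y0_ne] by blast
  have yneg: "y n < 0" if "n \<ge> n0" for n unfolding y_def using conjugate_quotient_neg_persists[OF n0 that] .
  have x1: "?x n > 1" if "n \<ge> n0" for n using cf_quotient_gt_1[of n] n0 that by simp
  define I where "I = {-\<lceil>d\<rceil>..\<lceil>d\<rceil>}"
  have box: "(A n, B n) \<in> I \<times> I" if n: "n \<ge> n0" for n
  proof -
    have d: "d = \<bar>of_int (A n)\<bar> * (?x n - y n)" using AB(3)[of n] yneg[OF n] x1[OF n] by (simp add: abs_mult)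
    have "\<bar>real_of_int (A n)\<bar> * 1 \<le> d" unfolding d using yneg[OF n] x1[OF n] by (intro mult_left_mono) auto
    hence 1: "\<bar>real_of_int (A n)\<bar> \<le> of_int \<lceil>d\<rceil>" by linarith
    have "\<bar>real_of_int (B n)\<bar> = \<bar>of_int (A n)\<bar> * \<bar>?x n + y n\<bar>" unfolding AB(2) by (simp add: abs_mult)
    also have "\<dots> \<le> d" unfolding d using yneg[OF n] x1[OF n] by (intro mult_left_mono) auto
    finally have 2: "\<bar>real_of_int (B n)\<bar> \<le> of_int \<lceil>d\<rceil>" by linarith
    have "\<bar>A n\<bar> \<le> \<lceil>d\<rceil>" "\<bar>B n\<bar> \<le> \<lceil>d\<rceil>" using 1 2 by linarith+
    thus ?thesis by (auto simp: I_def abs_le_iff)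
  qed
  have "\<not> inj_on (\<lambda>n. (A n, B n)) {n0..}"
  proof
    assume inj: "inj_on (\<lambda>n. (A n, B n)) {n0..}"
    have "(\<lambda>n. (A n, B n)) ` {n0..} \<subseteq> I \<times> I"
    proof (rule image_subsetI)
      fix n assume "n \<in> {n0..}"
      thus "(A n, B n) \<in> I \<times> I" by (intro box) simp
    qed
    moreover have "finite (I \<times> I)" by (simp add: I_def)
    ultimately have "finite ((\<lambda>n. (A n, B n)) ` {n0..})" by (rule finite_subset)
    hence "finite {n0..}" using inj by (rule finite_imageD)
    thus False using infinite_Ici[of n0] by simp
  qed
  then obtain i j where ij: "i \<ge> n0" "j \<ge> n0" "i \<noteq> j" "A i = A j" "B i = B j"
    unfolding inj_on_def by auto
  \<comment> \<open>The sign \<open>y < 0 < x\<close> selects the larger root, so the pair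
    \<open>(A n, B n)\<close> alone determines the complete quotient.\<close>
  have root: "?x n = - of_int (B n) / (2 * of_int (A n)) + d / (2 * \<bar>of_int (A n)\<bar>)" if n: "n \<ge> n0" for n
  proof -
    have "d = \<bar>of_int (A n)\<bar> * (?x n - y n)" using AB(3)[of n] yneg[OF n] x1[OF n] by (simp add: abs_mult)
    hence "d / (2 * \<bar>of_int (A n)\<bar>) = (?x n - y n) / 2" using AB(1)[of n] by simp
    moreover have "- of_int (B n) / (2 * of_int (A n)) = (?x n + y n) / 2" unfolding AB(2) using AB(1)[of n] by simp
    ultimately show ?thesis by (simp add: field_simps)
  qed
  have xij: "?x i = ?x j" using root[OF ij(1)] root[OF ij(2)] ij(4,5) by simp
  define m where "m = min i j"
  define p where "p = max i j - m"
  have mp: "m \<ge> 1" "p \<ge> 1" "?x (m + p) = ?x m"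
    using ij n0 xij by (auto simp: m_def p_def min_def max_def)
  have "?x (m + p + i) = ?x (m + i)" for i
    by (induction i) (use mp in simp_all)
  hence per: "?x (n + p) = ?x n" if "n \<ge> m" for n
    using that by (metis le_add_diff_inverse add.assoc add.commute)
  show ?thesis
    by (rule that[OF mp(1,2)]) (simp add: cf_partial_quotient_def per)
qed

end

section \<open>Convergents of a quadratic irrational\<close>

lemma coprime_cnum_cden: "coprime (cnum w) (cden w)"
proof (induction w)
  case (Cons a w)
  have "gcd (cden w) (a * cden w + cnum w) = gcd (cden w) (cnum w)"
    by (metis gcd_add_mult mult.commute)
  thus ?case using Cons.IH by (simp add: coprime_iff_gcd_eq_1 gcd.commute)
qed simp

lemma cf_value_cden:
  assumes "set w \<subseteq> {1..A}"
  shows "cf_value (a # map int w) = of_int (a * int (cden w) + int (cnum w)) / of_nat (cden w)"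
  using assms
proof (induction w arbitrary: a)
  case (Cons b w)
  have w: "set w \<subseteq> {1..A}" "b \<ge> 1" using Cons.prems by auto
  have p: "cden w > 0" "cden (b # w) > 0" using cden_pos[OF w(1)] cden_pos[OF Cons.prems] by (simp_all del: cden.simps)
  have "cf_value (a # map int (b # w)) = of_int a + 1 / cf_value (int b # map int w)" by simp
  also have "cf_value (int b # map int w) = of_nat (cden (b # w)) / of_nat (cden w)"
    using Cons.IH[OF w(1), of "int b"] by simp
  also have "of_int a + 1 / (of_nat (cden (b # w)) / of_nat (cden w)) =
      (of_int (a * int (cden (b # w)) + int (cnum (b # w))) / of_nat (cden (b # w)) :: rat)"
    using p by (simp add: add_divide_distrib del: cden.simps)
  finally show ?case .
qed simp

text \<open>\<open>quotient_of\<close> returns lowest terms, and the continuants are coprime even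
  after a multiple of the denominator is added to the numerator, so the two denominators agree
  exactly.\<close>

lemma cf_num_denom:
  assumes w: "set w \<subseteq> {1..A}" and eq: "map (cf_partial_quotient \<alpha>) [0..<Suc k] = a # map int w"
  shows "cf_num \<alpha> k = a * int (cden w) + int (cnum w)" "cf_denom \<alpha> k = cden w"
proof -
  have "cf_convergent \<alpha> k = Fract (a * int (cden w) + int (cnum w)) (int (cden w))"
    unfolding cf_convergent_def eq cf_value_cden[OF w] by (simp add: Fract_of_int_quotient)
  moreover have "coprime (a * int (cden w) + int (cnum w)) (int (cden w))"
  proof -
    have "gcd (int (cden w)) (int (cnum w) + a * int (cden w)) = gcd (int (cden w)) (int (cnum w))"
      by (metis add.commute gcd_add_mult)
    thus ?thesis using coprime_cnum_cden[of w] by (simp add: coprime_iff_gcd_eq_1 gcd.commute add.commute)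
  qed
  ultimately have "quotient_of (cf_convergent \<alpha> k) = (a * int (cden w) + int (cnum w), int (cden w))"
    using cden_pos[OF w] by (simp add: quotient_of_Fract normalize_stable)
  thus "cf_num \<alpha> k = a * int (cden w) + int (cnum w)" "cf_denom \<alpha> k = cden w"
    by (simp_all add: cf_num_def cf_denom_def)
qed

theorem theorem1:
  fixes \<alpha> :: real
  assumes "quadratic_irrational \<alpha>"
  shows "\<exists>(K :: real \<Rightarrow> real) (K_inf :: real) (C :: real) (C_inf :: real).
    (\<forall>c>0. K c > 0) \<and> K_inf > 0 \<and>
    (\<forall>c>0. \<forall>k\<ge>1.
      \<bar>ln ((\<Sum>N<cf_denom \<alpha> k.
             sudler N (of_int (cf_num \<alpha> k) / of_nat (cf_denom \<alpha> k)) powr c) powr (1 / c))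
        - K c * real k\<bar> \<le> C * max 1 (1 / c)) \<and>
    (\<forall>k\<ge>1.
      \<bar>ln (Max ((\<lambda>N. sudler N (of_int (cf_num \<alpha> k) / of_nat (cf_denom \<alpha> k))) ` {..<cf_denom \<alpha> k}))
        - K_inf * real k\<bar> \<le> C_inf)"
proof -
  obtain A0 B0 C0 :: int where irr: "\<alpha> \<notin> \<rat>" and quad: "A0 \<noteq> 0" "of_int A0 * \<alpha>\<^sup>2 + of_int B0 * \<alpha> + of_int C0 = 0"
    using assms unfolding quadratic_irrational_def by blast
  obtain m p where m: "m \<ge> 1" and p: "p \<ge> 1"
    and per: "\<And>n. n \<ge> m \<Longrightarrow> cf_partial_quotient \<alpha> (n + p) = cf_partial_quotient \<alpha> n"
    using cf_eventually_periodic[OF irr quad] by blast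
  \<comment> \<open>At index \<open>0\<close> the conversion may truncate a negative integer part;
    the words below contain only indices from \<open>1\<close> on, where partial quotients are
    positive.\<close>
  define b where "b n = nat (cf_partial_quotient \<alpha> n)" for n
  define A where "A = Max (insert 1 (b ` {..<m + p}))"
  have A1: "A \<ge> 1" unfolding A_def by (intro Max_ge) auto
  have b_per: "b (n + p) = b n" if "n \<ge> m" for n using per[OF that] by (simp add: b_def)
  have b_le: "b n \<le> A" for n
  proof (induction n rule: less_induct)
    case (less n)
    show ?case
    proof (cases "n < m + p")
      case True
      thus ?thesis unfolding A_def by (intro Max_ge) auto
    next
      case False
      thus ?thesis using b_per[of "n - p"] less.IH[of "n - p"] p by simp
    qed
  qed
  have b: "1 \<le> b n \<and> b n \<le> A" if "n \<ge> 1" for n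
    using cf_partial_ge_1[OF irr that] b_le[of n] by (simp add: b_def)
  define w where "w k = map b [1..<Suc k]" for k
  have w: "set (w k) \<subseteq> {1..A}" for k
  proof
    fix x assume "x \<in> set (w k)"
    then obtain n where "x = b n" "n \<ge> 1" by (auto simp: w_def)
    thus "x \<in> {1..A}" using b[of n] by simp
  qed
  have list: "map (cf_partial_quotient \<alpha>) [0..<Suc k] = cf_partial_quotient \<alpha> 0 # map int (w k)" for k
  proof -
    have "[0..<Suc k] = 0 # [1..<Suc k]" by (simp add: upt_conv_Cons del: upt_Suc)
    moreover have "map (cf_partial_quotient \<alpha>) [1..<Suc k] = map int (w k)"
      unfolding w_def map_map
    proof (rule map_cong)
      fix n assume "n \<in> set [1..<Suc k]"
      hence "n \<ge> 1" by auto
      thus "cf_partial_quotient \<alpha> n = (int \<circ> b) n" using cf_partial_ge_1[OF irr, of n] by (simp add: b_def)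
    qed simp
    ultimately show ?thesis by simp
  qed
  have den: "cf_denom \<alpha> k = cden (w k)" for k by (rule cf_num_denom[OF w list])
  \<comment> \<open>The integer part of \<open>\<alpha>\<close> shifts the convergent by an integer
    and is lost in the Sudler product.\<close>
  have sudler_word: "sudler N (of_int (cf_num \<alpha> k) / of_nat (cf_denom \<alpha> k)) = sudler_word (w k) N" for N k
  proof -
    have "of_int (cf_num \<alpha> k) / of_nat (cf_denom \<alpha> k) = cval (w k) + of_int (cf_partial_quotient \<alpha> 0)"
      unfolding cf_num_denom[OF w list] using cden_pos[OF w, of k] by (simp add: cval_def field_simps)
    thus ?thesis by (simp add: sudler_plus_int sudler_word_def)
  qed
  obtain B where B: "B \<ge> 0"
    and addS: "\<And>u v c. \<lbrakk>u \<noteq> []; v \<noteq> []; set u \<subseteq> {1..A}; set v \<subseteq> {1..A}; c > 0\<rbrakk> \<Longrightarrow>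
       \<bar>ln_sudler_mean c (u @ v) - ln_sudler_mean c u - ln_sudler_mean c v\<bar> \<le> B * max 1 (1 / c)"
    and addM: "\<And>u v. \<lbrakk>u \<noteq> []; v \<noteq> []; set u \<subseteq> {1..A}; set v \<subseteq> {1..A}\<rbrakk> \<Longrightarrow>
       \<bar>ln_sudler_max (u @ v) - ln_sudler_max u - ln_sudler_max v\<bar> \<le> B"
    using free_energy_additive[OF A1] by blast
  define W where "W = {w. set w \<subseteq> {1..A} \<and> length w \<le> m + p}"
  have finW: "finite W" unfolding W_def by (rule finite_lists_length_le) simp
  \<comment> \<open>A sum of nonnegative terms over the finitely many short words bounds each of
    them. The part \<open>ln (cden w)\<close> pays for the \<open>1 / c\<close> loss of the power
    means.\<close>
  define M where "M = (\<Sum>w\<in>W. ln_sudler_max w + ln (real (cden w)))"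
  have lnc: "ln (real (cden w)) \<ge> 0" if "set w \<subseteq> {1..A}" for w
    using cden_pos[OF that] by simp
  have Mb: "0 \<le> ln_sudler_max w" "ln_sudler_max w + ln (real (cden w)) \<le> M" if "set w \<subseteq> {1..A}" "length w \<le> m + p" for w
  proof -
    have nn: "0 \<le> ln_sudler_max v" if "set v \<subseteq> {1..A}" for v using ln_sudler_max_ge_ln_cden[OF that] lnc[OF that] by linarith
    show "0 \<le> ln_sudler_max w" by (rule nn[OF that(1)])
    show "ln_sudler_max w + ln (real (cden w)) \<le> M"
      unfolding M_def using finW that nn lnc by (intro member_le_sum) (auto simp: W_def)
  qed
  have M0: "M \<ge> 0" using Mb[of "[]"] by simp
  define R where "R = 3 + real m + real p"
  have R0: "R \<ge> 0" by (simp add: R_def)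
  \<comment> \<open>The dependence on \<open>c\<close> is confined to \<open>max 1 (1 / c)\<close>,
    so \<open>R\<close>, \<open>M\<close> and \<open>B\<close> are common to all \<open>c\<close>,
    while the slope is chosen for each \<open>c\<close> separately.\<close>
  have "\<exists>K>0. \<forall>k. \<bar>ln_sudler_mean c (w k) - K * real k\<bar> \<le> R * (M * max 1 (1 / c) + B * max 1 (1 / c))" if c: "c > 0" for c
  proof -
    have mx: "max 1 (1 / c) \<ge> 1" "max 1 (1 / c) \<ge> 1 / c" by auto
    obtain K where "K > 0" "\<And>k. \<bar>ln_sudler_mean c (map b [1..<Suc k]) - K * real k\<bar> \<le> (3 + real m + real p) * (M * max 1 (1 / c) + B * max 1 (1 / c))"
    proof (rule periodic_growth[where F = "ln_sudler_mean c" and b = b and A = A and m = m and p = p and E = "B * max 1 (1 / c)" and M = "M * max 1 (1 / c)"])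
      fix u v :: "nat list" assume uv: "set u \<subseteq> {1..A}" "set v \<subseteq> {1..A}"
      show "\<bar>ln_sudler_mean c (u @ v) - ln_sudler_mean c u - ln_sudler_mean c v\<bar> \<le> B * max 1 (1 / c)"
        using addS[OF _ _ uv c] B mx by (cases "u = [] \<or> v = []") auto
    next
      fix w :: "nat list" assume w: "set w \<subseteq> {1..A}" "length w \<le> m + p"
      have "0 \<le> ln_sudler_mean c w" using ln_sudler_max_le_ln_sudler_mean[OF w(1) c] Mb(1)[OF w] by linarith
      moreover have "ln_sudler_mean c w \<le> M * max 1 (1 / c)"
      proof -
        have "ln_sudler_mean c w \<le> ln_sudler_max w * 1 + ln (real (cden w)) * (1 / c)" using ln_sudler_mean_le[OF w(1) c] by simp
        also have "\<dots> \<le> ln_sudler_max w * max 1 (1 / c) + ln (real (cden w)) * max 1 (1 / c)"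
          using Mb(1)[OF w] lnc[OF w(1)] mx by (intro add_mono mult_left_mono) auto
        also have "\<dots> = (ln_sudler_max w + ln (real (cden w))) * max 1 (1 / c)" by (simp add: distrib_right)
        also have "\<dots> \<le> M * max 1 (1 / c)" using Mb(2)[OF w] mx by (intro mult_right_mono) auto
        finally show ?thesis .
      qed
      ultimately show "\<bar>ln_sudler_mean c w\<bar> \<le> M * max 1 (1 / c)" by simp
    next
      fix w :: "nat list" assume w: "set w \<subseteq> {1..A}"
      show "ln (real (cden w)) \<le> ln_sudler_mean c w" using ln_sudler_max_ge_ln_cden[OF w] ln_sudler_max_le_ln_sudler_mean[OF w c] by linarith
    qed (use b m p b_per in blast)+
    thus ?thesis unfolding w_def R_def by blast
  qed
  then obtain K where K: "\<And>c. c > 0 \<Longrightarrow> K c > 0"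
      "\<And>c k. c > 0 \<Longrightarrow> \<bar>ln_sudler_mean c (w k) - K c * real k\<bar> \<le> R * (M * max 1 (1 / c) + B * max 1 (1 / c))"
    by metis
  obtain K_inf where Ki: "K_inf > 0" "\<And>k. \<bar>ln_sudler_max (map b [1..<Suc k]) - K_inf * real k\<bar> \<le> (3 + real m + real p) * (M + B)"
  proof (rule periodic_growth[where F = ln_sudler_max and b = b and A = A and m = m and p = p and E = B and M = M])
    fix u v :: "nat list" assume uv: "set u \<subseteq> {1..A}" "set v \<subseteq> {1..A}"
    show "\<bar>ln_sudler_max (u @ v) - ln_sudler_max u - ln_sudler_max v\<bar> \<le> B"
      using addM[OF _ _ uv] B by (cases "u = [] \<or> v = []") auto
  next
    fix w :: "nat list" assume w: "set w \<subseteq> {1..A}" "length w \<le> m + p"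
    show "\<bar>ln_sudler_max w\<bar> \<le> M" using Mb[OF w] lnc[OF w(1)] by linarith
  next
    fix w :: "nat list" assume w: "set w \<subseteq> {1..A}"
    show "ln (real (cden w)) \<le> ln_sudler_max w" by (rule ln_sudler_max_ge_ln_cden[OF w])
  qed (use b m p b_per in blast)+
  show ?thesis
  proof (rule exI[of _ K], rule exI[of _ K_inf], rule exI[of _ "R * (M + B)"], rule exI[of _ "R * (M + B)"], intro conjI allI impI)
    fix c :: real and k :: nat assume c: "c > 0"
    have "\<bar>ln_sudler_mean c (w k) - K c * real k\<bar> \<le> R * (M + B) * max 1 (1 / c)"
      using K(2)[OF c, of k] by (simp only: distrib_right distrib_left mult.assoc)
    thus "\<bar>ln ((\<Sum>N<cf_denom \<alpha> k.
             sudler N (of_int (cf_num \<alpha> k) / of_nat (cf_denom \<alpha> k)) powr c) powr (1 / c))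
        - K c * real k\<bar> \<le> R * (M + B) * max 1 (1 / c)"
      unfolding sudler_word unfolding den ln_sudler_mean_def sudler_power_sum_def .
  next
    fix k :: nat
    show "\<bar>ln (Max ((\<lambda>N. sudler N (of_int (cf_num \<alpha> k) / of_nat (cf_denom \<alpha> k))) ` {..<cf_denom \<alpha> k}))
        - K_inf * real k\<bar> \<le> R * (M + B)"
    proof -
      have "\<bar>ln_sudler_max (w k) - K_inf * real k\<bar> \<le> R * (M + B)" using Ki(2)[of k] unfolding w_def R_def .
      thus ?thesis unfolding sudler_word unfolding den ln_sudler_max_def .
    qed
  qed (use K Ki in auto)
qed

end
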